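(* Let $k\ge2$ be an integer, let $A>4k^{2}-4k-1$ be real, and let $\mathcal{J}=[A,A+1]$. There exists $\rho=\rho(A)>0$ such that for every $f\in C_c^\infty(\mathbb{R}^{k-1})$, $$\mathrm{Var}\bigl(R_k(f,\cdot,N),\mathcal{J}\bigr)=O(N^{-\rho})$$ as $N\to\infty$ (the implied constant may depend on $f$).
   Context: $C_c^\infty(\mathbb{R}^{k-1})$ is the class of $C^\infty$ functions $\mathbb{R}^{k-1}\to\mathbb{R}$ with compact support. For $N\ge 1$ let $\mathcal{X}_k=\mathcal{X}_k(N)$ be the set of $k$-tuples $(x_1,\dots,x_k)$ of pairwise distinct integers with $1\le x_i\le N$. For $\mathbf{x}\in\mathcal{X}_k$ put $\Delta(\mathbf{x},\alpha)=(x_1^\alpha-x_2^\alpha,\dots,x_{k-1}^\alpha-x_k^\alpha)\in\mathbb{R}^{k-1}$, and $$R_k(f,\alpha,N)=\frac1N\sum_{\mathbf{x}\in\mathcal{X}_k}\ \sum_{\mathbf{m}\in\mathbb{Z}^{k-1}}f\bigl(N(\Delta(\mathbf{x},\alpha)-\mathbf{m})\bigr).$$ Let $C_k(N)=\left(1-\frac1N\right)\cdots\left(1-\frac{k-1}{N}\right)$. For an interval $\mathcal{I}\subseteq\mathbb{R}_{>0}$, the variance is defined by $$\mathrm{Var}\bigl(R_k(f,\cdot,N),\mathcal{I}\bigr)=\int_{\mathcal{I}}\left(R_k(f,\alpha,N)-C_k(N)\int_{\mathbb{R}^{k-1}}f(\mathbf{x})\,\mathrm{d}\mathbf{x}\right)^2\mathrm{d}\alpha.$$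 *)

theory Defs
  imports "HOL-Analysis.Analysis" "HOL-Library.Landau_Symbols"
begin

text \<open>
  Continuous differentiability of order \<open>n\<close> on the whole space, by recursion over directional
  derivatives: every derivative of order below \<open>n\<close> is Frechet differentiable everywhere, and the
  derivatives of order \<open>n\<close> are continuous.
\<close>

primrec C_diff :: "nat \<Rightarrow> ('a::euclidean_space \<Rightarrow> real) \<Rightarrow> bool" where
  "C_diff 0 f \<longleftrightarrow> continuous_on UNIV f"
| "C_diff (Suc n) f \<longleftrightarrow>
     (\<forall>x. f differentiable (at x)) \<and> (\<forall>v. C_diff n (\<lambda>x. frechet_derivative f (at x) v))"

definition Cc_infinity :: "('a::euclidean_space \<Rightarrow> real) set" where
  "Cc_infinity = {f. (\<forall>n. C_diff n f) \<and> compact (closure {x. f x \<noteq> 0})}"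

text \<open>A \<open>k\<close>-tuple is a function on \<open>{1..k}\<close>, \<^const>\<open>undefined\<close> outside, so that tuples are
  counted once.\<close>

definition distinct_tuples :: "nat \<Rightarrow> nat \<Rightarrow> (nat \<Rightarrow> nat) set" where
  "distinct_tuples k N = {x \<in> {1..k} \<rightarrow>\<^sub>E {1..N}. inj_on x {1..k}}"

text \<open>
  The space \<open>\<real>\<^sup>k\<^sup>-\<^sup>1\<close> is \<^typ>\<open>real ^ 'n\<close>, where \<open>pos\<close> is a bijection from the index type \<open>'n\<close> onto
  \<open>{1, \<dots>, k - 1}\<close> giving the position of each coordinate.
\<close>

definition Delta :: "('n::finite \<Rightarrow> nat) \<Rightarrow> (nat \<Rightarrow> nat) \<Rightarrow> real \<Rightarrow> real ^ 'n" where
  "Delta pos x \<alpha> = (\<chi> i. real (x (pos i)) powr \<alpha> - real (x (pos i + 1)) powr \<alpha>)"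

text \<open>For compactly supported \<open>f\<close> the sum over \<open>m\<close> has only finitely many nonzero terms.\<close>

definition R_corr ::
  "nat \<Rightarrow> ('n::finite \<Rightarrow> nat) \<Rightarrow> (real ^ 'n \<Rightarrow> real) \<Rightarrow> real \<Rightarrow> nat \<Rightarrow> real" where
  "R_corr k pos f \<alpha> N =
     1 / real N * (\<Sum>x\<in>distinct_tuples k N.
       \<Sum>\<^sub>\<infinity>m\<in>(UNIV :: (int ^ 'n) set).
         f (real N *\<^sub>R (Delta pos x \<alpha> - (\<chi> i. real_of_int (m $ i)))))"

definition C_factor :: "nat \<Rightarrow> nat \<Rightarrow> real" where
  "C_factor k N = (\<Prod>j\<in>{1..k - 1}. 1 - real j / real N)"

definition Var_corr ::
  "nat \<Rightarrow> ('n::finite \<Rightarrow> nat) \<Rightarrow> (real ^ 'n \<Rightarrow> real) \<Rightarrow> nat \<Rightarrow> real set \<Rightarrow> real" where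
  "Var_corr k pos f N I =
     (LBINT \<alpha>:I. (R_corr k pos f \<alpha> N - C_factor k N * (LBINT x. f x))\<^sup>2)"

end

theory Submission
  imports Defs
begin

text \<open>
  Poisson summation writes \<open>R\<^sub>k - C\<^sub>k \<integral> f\<close> as \<open>N\<^sup>-\<^sup>k\<close> times a sum over nonzero integer vectors \<open>n\<close>, of
  size essentially at most \<open>N\<close>, of \<open>e(n \<bullet> \<Delta>(x, \<alpha>))\<close>. Squaring and integrating over \<open>\<alpha>\<close> leads to
  phases \<open>\<Sum> w\<^sub>i p\<^sub>i\<^sup>\<alpha>\<close> with \<open>2k\<close> terms. After collecting equal bases and dropping those whose
  coefficients cancel, let \<open>L\<close> be the largest remaining base, with coefficient \<open>h\<close>. Some derivative
  of such an exponential sum is large, so its integral is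
  \<open>O((\<bar>h\<bar> L\<^sup>A \<Prod> (1 - z / L))\<^sup>-\<^sup>\<theta>)\<close> with \<open>\<theta> = 1 / (2k)\<close>, the product being over the other bases \<open>z\<close>.
  The factors \<open>(1 - z / L)\<^sup>-\<^sup>\<theta>\<close> are bounded on average over \<open>z\<close>, and averaging over \<open>h\<close> gains
  \<open>N\<^sup>-\<^sup>\<theta>\<close>; together with the two linear constraints on the coefficients this
  beats the number of terms as soon as \<open>A > 4k\<^sup>2 - 4k - 1\<close>. If some coefficients cancel, the
  cancellations force enough coincidences among the variables to compensate.
\<close>

section \<open>Exponential sums and their oscillatory integrals\<close>

text \<open>Where the threshold comes from: put n = 2k and \<theta> = 1/n. Since the square carries
  the factor N^(-2k), the weighted sum of phase integrals must beat N^n. If nothing cancels, the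
  coefficients contribute N^(n - 2 - \<theta>), and the bases contribute the sum of L^(n - 1 - A
  \<theta>) over L \<le> N, of order N^(n - A \<theta>) as long as that exponent is positive. The
  product beats N^n when A \<theta> > n - 2 - \<theta>, that is A > n^2 - 2n - 1.

  The gain from h is delicate. The coefficient h is w i or w i + w j with i and j in different
  factors of the square, and it has to remain a form in free coordinates after one coordinate of
  each factor has been eliminated by the linear constraints. As k \<ge> 2, the eliminated
  coordinates can be taken different from i and j.

  Cancelling pairs may make one of the two constraints useless, but each pair also ties two
  coefficients and two bases together. Such terms, and those with a single vanishing coefficient,
  are bounded by N^(n - 1 + \<theta>) without any gain from h.\<close>

primrec splits :: "(real \<Rightarrow> real \<Rightarrow> bool) \<Rightarrow> nat \<Rightarrow> real \<Rightarrow> real \<Rightarrow> bool" where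
  "splits P 0 a b \<longleftrightarrow> a = b"
| "splits P (Suc n) a b \<longleftrightarrow> (\<exists>c. a \<le> c \<and> c \<le> b \<and> P a c \<and> splits P n c b)"

lemma splits_append:
  assumes "splits P m a b" "splits P n b c" "b \<le> c"
  shows "splits P (m + n) a c"
  using assms
proof (induction m arbitrary: a)
  case (Suc m)
  then obtain d where "a \<le> d" "d \<le> b" "P a d" "splits P m d b" by auto
  with Suc show ?case by (auto intro!: exI[of _ d])
qed auto

lemma splits_refine:
  assumes "splits P n a b"
    and "\<And>x y. a \<le> x \<Longrightarrow> x \<le> y \<Longrightarrow> y \<le> b \<Longrightarrow> P x y \<Longrightarrow> splits Q m x y"
  shows "splits Q (n * m) a b"
  using assms
proof (induction n arbitrary: a)
  case (Suc n)
  then obtain d where d: "a \<le> d" "d \<le> b" "P a d" "splits P n d b" by auto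
  have "splits Q m a d" using Suc.prems(2) d by auto
  moreover have "splits Q (n * m) d b" using Suc.IH[OF d(4)] Suc.prems(2) d by auto
  ultimately show ?case using splits_append d by fastforce
qed auto

text \<open>The number of pieces in \<open>splits\<close> is exact, while the constructions below
  only bound the number needed; degenerate pieces at \<open>b\<close> fill the gap.\<close>

lemma splits_Suc_trivial:
  assumes "a \<le> b" "Q a b" "Q b b"
  shows "splits Q (Suc n) a b"
proof -
  have "splits Q n b b" using assms(3) by (induction n) auto
  then show ?thesis using assms by auto
qed

lemma splits_three:
  assumes "x \<le> u" "u \<le> v" "v \<le> y" "Q x u" "Q u v" "Q v y"
  shows "splits Q 3 x y"
  unfolding numeral_3_eq_3 splits.simps using assms
  by (intro exI[of _ u] conjI exI[of _ v] exI[of _ y]) auto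

lemma norm_integral_splits_le:
  fixes f :: "real \<Rightarrow> 'a::banach"
  assumes "splits P n a b" "continuous_on {a..b} f"
    and "\<And>x y. a \<le> x \<Longrightarrow> x \<le> y \<Longrightarrow> y \<le> b \<Longrightarrow> P x y \<Longrightarrow> norm (integral {x..y} f) \<le> M"
  shows "norm (integral {a..b} f) \<le> real n * M"
  using assms
proof (induction n arbitrary: a)
  case (Suc n)
  then obtain d where d: "a \<le> d" "d \<le> b" "P a d" "splits P n d b" by auto
  have "integral {a..b} f = integral {a..d} f + integral {d..b} f"
    using Suc.prems(2) d
    by (metis Henstock_Kurzweil_Integration.integral_combine integrable_continuous_interval)
  also have "norm \<dots> \<le> norm (integral {a..d} f) + norm (integral {d..b} f)"
    by (rule norm_triangle_ineq)
  also have "norm (integral {d..b} f) \<le> real n * M"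
    using d Suc.prems by (intro Suc.IH) (auto intro: continuous_on_subset)
  also have "norm (integral {a..d} f) \<le> M" using Suc.prems d by auto
  finally show ?case by (simp add: algebra_simps)
qed auto

section \<open>Real exponential sums: sign changes and lower bounds\<close>

definition exp_sum :: "(real \<Rightarrow> real) \<Rightarrow> real \<Rightarrow> real set \<Rightarrow> real \<Rightarrow> real" where
  "exp_sum c s V t = (\<Sum>l\<in>V. c l * exp ((l - s) * t))"

lemma exp_sum_derivative:
  "(exp_sum c s V has_real_derivative exp_sum (\<lambda>l. c l * (l - s)) s V t) (at t within S)"
  unfolding exp_sum_def by (auto intro!: derivative_eq_intros sum.cong simp: algebra_simps)

lemma exp_sum_continuous: "continuous_on S (exp_sum c s V)"
  unfolding exp_sum_def by (intro continuous_intros)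

text \<open>Recentring multiplies by a positive exponential and so preserves signs. With the centre
  at an exponent of the sum, that term is constant and differentiation removes it; both inductions
  below rest on this.\<close>

lemma exp_sum_shift: "exp_sum c s V t = exp ((b - s) * t) * exp_sum c b V t"
  unfolding exp_sum_def sum_distrib_left
  by (rule sum.cong) (auto simp: algebra_simps simp flip: exp_add)

lemma exp_sum_insert_centre:
  assumes "finite V" "b \<notin> V"
  shows "exp_sum (\<lambda>l. c l * (l - b)) b (insert b V) t = exp_sum (\<lambda>l. c l * (l - b)) b V t"
  using assms by (simp add: exp_sum_def)

text \<open>In the spirit of Rolle: recentred at \<open>m\<close>, the sum has a derivative with one
  exponential fewer. Where that derivative keeps its sign, the sum is monotone and changes sign at
  most once, so each piece is cut in two at a zero. The count 2^n is crude but depends on the number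
  of terms only.\<close>

lemma exp_sum_sign_splits:
  assumes "finite V" "a \<le> b"
  shows "splits (\<lambda>x y. (\<forall>t\<in>{x..y}. exp_sum c s V t \<ge> 0) \<or> (\<forall>t\<in>{x..y}. exp_sum c s V t \<le> 0))
           (2 ^ card V) a b"
  using assms
proof (induction V arbitrary: c s a b rule: finite_linorder_min_induct)
  case empty
  then show ?case by (auto simp: exp_sum_def)
next
  case (insert m V)
  define f where "f = exp_sum c m (insert m V)"
  define f' where "f' = exp_sum (\<lambda>l. c l * (l - m)) m V"
  define Q where "Q = (\<lambda>x y. (\<forall>t\<in>{x..y}. f t \<ge> 0) \<or> (\<forall>t\<in>{x..y}. f t \<le> 0))"
  have mV: "m \<notin> V" using insert by auto
  have der: "(f has_real_derivative f' t) (at t within S)" for t S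
    using exp_sum_derivative[of c m "insert m V"] exp_sum_insert_centre[OF insert(1) mV]
    by (simp add: f_def f'_def)
  have cont: "continuous_on S f" for S by (simp add: f_def exp_sum_continuous)
  have "splits Q (2 ^ card V * 2) a b"
  proof (rule splits_refine[OF insert.IH[of a b "\<lambda>l. c l * (l - m)" m]])
    show "a \<le> b" by fact
    fix x y assume xy: "a \<le> x" "x \<le> y" "y \<le> b"
      and "(\<forall>t\<in>{x..y}. exp_sum (\<lambda>l. c l * (l - m)) m V t \<ge> 0) \<or> (\<forall>t\<in>{x..y}. exp_sum (\<lambda>l. c l * (l
          - m)) m V t \<le> 0)"
    then consider "\<forall>t\<in>{x..y}. f' t \<ge> 0" | "\<forall>t\<in>{x..y}. f' t \<le> 0" by (auto simp: f'_def)
    then have mono: "(\<forall>s t. x \<le> s \<longrightarrow> s \<le> t \<longrightarrow> t \<le> y \<longrightarrow> f s \<le> f t) \<or> (\<forall>s t. x \<le> s \<longrightarrow> s \<le> t \<longrightarrow> t \<le> y \<longrightarrow> f t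
        \<le> f s)"
    proof cases
      case 1
      then show ?thesis
        by (intro disjI1 allI impI DERIV_nonneg_imp_nondecreasing[where f=f]) (auto intro!: exI[of _
            "f' _"] der)
    next
      case 2
      then show ?thesis
        by (intro disjI2 allI impI DERIV_nonpos_imp_nonincreasing[where f=f]) (auto intro!: exI[of _
            "f' _"] der)
    qed
    show "splits Q 2 x y"
    proof (cases "Q x y")
      case True
      then show ?thesis using xy splits_Suc_trivial[of x y Q 1] by (auto simp: Q_def numeral_2_eq_2)
    next
      case False
      have "\<exists>z. x \<le> z \<and> z \<le> y \<and> f z = 0"
      proof (cases "f x \<le> 0")
        case True
        then have "f y \<ge> 0" using False mono xy unfolding Q_def
          by (smt (verit) atLeastAtMost_iff)
        then show ?thesis using IVT'[of f x 0 y] True xy cont by auto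
      next
        case f: False
        then have "f y \<le> 0" using False mono xy unfolding Q_def
          by (smt (verit) atLeastAtMost_iff)
        then show ?thesis using IVT2'[of f y 0 x] f xy cont by auto
      qed
      then obtain z where z: "x \<le> z" "z \<le> y" "f z = 0" by auto
      have "Q x z \<and> Q z y" using mono z unfolding Q_def by (smt (verit) atLeastAtMost_iff)
      then show ?thesis using z by (auto simp: numeral_2_eq_2 intro!: exI[of _ z])
    qed
  qed
  moreover have "Q = (\<lambda>x y. (\<forall>t\<in>{x..y}. exp_sum c s (insert m V) t \<ge> 0) \<or> (\<forall>t\<in>{x..y}. exp_sum c s
      (insert m V) t \<le> 0))"
    unfolding Q_def f_def by (subst (3 4) exp_sum_shift[where b
        = m]) (simp add: zero_le_mult_iff mult_le_0_iff)
  ultimately show ?case using insert(1) mV by (simp add: mult.commute)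
qed

text \<open>A function that climbs at rate at least \<open>\<eta>\<close> passes from
  \<open>- \<eta> * \<delta>\<close> to \<open>\<eta> * \<delta>\<close> within length
  \<open>2 * \<delta>\<close>. The alternatives \<open>u = x\<close> and \<open>v = y\<close> cover
  an empty outer stretch: at the single remaining point there is no lower bound, and that degenerate
  piece counts as short.\<close>

lemma steep_function_small_interval:
  fixes f :: "real \<Rightarrow> real"
  assumes "x \<le> y" "\<eta> > 0" "\<delta> > 0" "continuous_on {x..y} f"
    and steep: "\<And>s t. x \<le> s \<Longrightarrow> s \<le> t \<Longrightarrow> t \<le> y \<Longrightarrow> f t - f s \<ge> \<eta> * (t - s)"
  shows "\<exists>u v. x \<le> u \<and> u \<le> v \<and> v \<le> y \<and> v - u \<le> 2 * \<delta> \<and>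
           (u = x \<or> (\<forall>t\<in>{x..u}. \<bar>f t\<bar> \<ge> \<eta> * \<delta>)) \<and> (v = y \<or> (\<forall>t\<in>{v..y}. \<bar>f t\<bar> \<ge> \<eta> * \<delta>))"
proof -
  define r where "r = \<eta> * \<delta>"
  have r: "r > 0" using assms by (simp add: r_def)
  have mono: "f s \<le> f t" if "x \<le> s" "s \<le> t" "t \<le> y" for s t
    using steep[OF that] that assms(2) by (smt (verit) mult_nonneg_nonneg)
  consider "f x \<ge> r" | "f y \<le> -r" | "f x < r" "f y > -r" by linarith
  then show ?thesis
  proof cases
    case 1
    have "\<forall>t\<in>{x..y}. \<bar>f t\<bar> \<ge> r" using 1 mono[of x] by force
    then show ?thesis using assms by (auto simp: r_def intro!: exI[of _ x])
  next
    case 2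
    have "\<forall>t\<in>{x..y}. \<bar>f t\<bar> \<ge> r" using 2 mono[of _ y] by force
    then show ?thesis using assms by (auto simp: r_def intro!: exI[of _ y])
  next
    case 3
    obtain u where u: "x \<le> u" "u \<le> y" "f u \<ge> -r" "u = x \<or> f u = - r"
      using IVT'[of f x "-r" y] 3 assms by (cases "f x \<le> -r") force+
    obtain v where v: "x \<le> v" "v \<le> y" "f v \<le> r" "v = y \<or> f v = r"
      using IVT'[of f x r y] 3 assms by (cases "f y \<ge> r") force+
    have uv: "u \<le> v"
      using u v steep[of v u] r assms(2) by (smt (verit) mult_pos_pos)
    have "\<eta> * (v - u) \<le> 2 * r" using steep[of u v] u v uv by auto
    then have "v - u \<le> 2 * \<delta>" using assms(2) by (simp add: r_def)
    moreover have "u = x \<or> (\<forall>t\<in>{x..u}. \<bar>f t\<bar> \<ge> r)" using u mono[of _ u] r by force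
    moreover have "v = y \<or> (\<forall>t\<in>{v..y}. \<bar>f t\<bar> \<ge> r)" using v mono[of v] r by force
    ultimately show ?thesis using u v uv by (auto simp: r_def)
  qed
qed

text \<open>Dividing by the smallest exponential and differentiating lowers the number of exponentials
  by one; this replaces the Vandermonde argument for a lower bound on some derivative.\<close>

lemma exp_sum_large_splits:
  assumes "finite V" "\<forall>l\<in>V. l < L" "c L \<noteq> 0" "\<forall>l\<in>V. s \<le> l" "s \<le> L" "0 \<le> a" "a \<le> b" "\<delta> > 0"
  shows "splits (\<lambda>x y. y - x \<le> 2 * \<delta> \<or>
             (\<forall>t\<in>{x..y}. \<bar>exp_sum c s (insert L V) t\<bar> \<ge> \<bar>c L\<bar> * (\<Prod>l\<in>V. L - l) * \<delta> ^ card V))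
           (3 ^ card V) a b"
  using assms
proof (induction V arbitrary: c s a b rule: finite_linorder_min_induct)
  case empty
  have "\<bar>exp_sum c s {L} t\<bar> \<ge> \<bar>c L\<bar>" if "t \<ge> 0" for t
    using that empty by (simp add: exp_sum_def abs_mult mult_le_cancel_left1)
  then show ?case using empty by auto
next
  case (insert m V)
  define W where "W = insert L (insert m V)"
  define f where "f = exp_sum c m W"
  define f' where "f' = exp_sum (\<lambda>l. c l * (l - m)) m (insert L V)"
  \<comment> \<open>The inductive lower bound for \<open>f'\<close>, whose leading coefficient is
    \<open>c L * (L - m)\<close>. Steepness turns it into \<open>\<eta> * \<delta>\<close>, which is
    the bound claimed for the larger sum.\<close>
  define \<eta> where "\<eta> = \<bar>c L * (L - m)\<bar> * (\<Prod>l\<in>V. L - l) * \<delta> ^ card V"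
  define Q where "Q = (\<lambda>x y. y - x \<le> 2 * \<delta> \<or> (\<forall>t\<in>{x..y}. \<bar>exp_sum c s W t\<bar> \<ge> \<eta> * \<delta>))"
  have mV: "m \<notin> V" "m \<noteq> L" "m < L" "s \<le> m" using insert by auto
  have \<eta>: "\<eta> > 0" unfolding \<eta>_def using insert.prems mV by (auto intro!: mult_pos_pos prod_pos)
  have der: "(f has_real_derivative f' t) (at t within S)" for t S
    using exp_sum_derivative[of c m W] exp_sum_insert_centre[of "insert L V" m] insert(1) mV
    by (simp add: f_def f'_def W_def insert_commute)
  have cont: "continuous_on S f" "continuous_on S f'" for S
    by (simp_all add: f_def f'_def exp_sum_continuous)
  \<comment> \<open>Returning from centre \<open>m\<close> to centre \<open>s\<close> multiplies by
    exp((m - s) t), which is at least 1 because \<open>s \<le> m\<close> and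
    \<open>t \<ge> 0\<close>. Lower bounds therefore survive.\<close>
  have W: "\<bar>exp_sum c s W t\<bar> \<ge> r" if "\<bar>f t\<bar> \<ge> r" "t \<ge> 0" "r \<ge> 0" for t r
  proof -
    have "1 * \<bar>f t\<bar> \<le> exp ((m - s) * t) * \<bar>f t\<bar>" using that mV by (intro mult_right_mono) auto
    then show ?thesis using that exp_sum_shift[of c s W t m] by (simp add: f_def abs_mult)
  qed
  have "splits Q (3 ^ card V * 3) a b"
  proof (rule splits_refine[OF insert.IH[of "\<lambda>l. c l * (l - m)" m a b]])
    fix x y assume xy: "a \<le> x" "x \<le> y" "y \<le> b"
      and "y - x \<le> 2 * \<delta> \<or> (\<forall>t\<in>{x..y}. \<bar>c L * (L - m)\<bar> * (\<Prod>l\<in>V. L - l) * \<delta> ^ card V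
            \<le> \<bar>exp_sum (\<lambda>l. c l * (l - m)) m (insert L V) t\<bar>)"
    then consider "y - x \<le> 2 * \<delta>" | "\<forall>t\<in>{x..y}. \<bar>f' t\<bar> \<ge> \<eta>" by (auto simp: f'_def \<eta>_def)
    then show "splits Q 3 x y"
    proof cases
      case 1
      then show ?thesis using xy splits_Suc_trivial[of x y Q 2] insert.prems
          by (auto simp: Q_def numeral_3_eq_3 numeral_2_eq_2)
    next
      case 2
      have "(\<forall>t\<in>{x..y}. f' t \<ge> \<eta>) \<or> (\<forall>t\<in>{x..y}. f' t \<le> - \<eta>)"
      proof (cases "f' x \<ge> 0")
        case True
        have "f' t \<ge> \<eta>" if t: "t \<in> {x..y}" for t
        proof (rule ccontr)
          assume "\<not> ?thesis"
          then have "f' t \<le> 0" using bspec[OF 2 t] by linarith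
          then obtain z where "x \<le> z" "z \<le> t" "f' z = 0"
              using IVT2'[of f' t 0 x, OF _ _ _ cont(2)] True t by auto
          then show False using 2 t \<eta> by force
        qed
        then show ?thesis by auto
      next
        case False
        have "f' t \<le> -\<eta>" if t: "t \<in> {x..y}" for t
        proof (rule ccontr)
          assume "\<not> ?thesis"
          then have "f' t \<ge> 0" using bspec[OF 2 t] by linarith
          then obtain z where "x \<le> z" "z \<le> t" "f' z = 0"
              using IVT'[of f' x 0 t, OF _ _ _ cont(2)] False t by auto
          then show False using 2 t \<eta> by force
        qed
        then show ?thesis by auto
      qed
      then obtain \<sigma> where \<sigma>: "\<sigma> = 1 \<or> \<sigma> = -1" "\<forall>t\<in>{x..y}. \<sigma> * f' t \<ge> \<eta>"
      proof (elim disjE)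
        assume "\<forall>t\<in>{x..y}. f' t \<ge> \<eta>"
        then show ?thesis by (intro that[of 1]) auto
      next
        assume "\<forall>t\<in>{x..y}. f' t \<le> - \<eta>"
        then show ?thesis by (intro that[of "-1"]) (auto simp: le_minus_iff)
      qed
      have "\<sigma> * f t - \<sigma> * f r \<ge> \<eta> * (t - r)" if "x \<le> r" "r \<le> t" "t \<le> y" for r t
      proof -
        have "(\<lambda>t. \<sigma> * f t - \<eta> * t) r \<le> (\<lambda>t. \<sigma> * f t - \<eta> * t) t"
        proof (rule DERIV_nonneg_imp_nondecreasing[OF that(2)])
          fix z assume "r \<le> z" "z \<le> t"
          then show "\<exists>y. ((\<lambda>t. \<sigma> * f t - \<eta> * t) has_real_derivative y) (at z) \<and> 0 \<le> y"
            using \<sigma> that by (intro exI[of _ "\<sigma> * f' z - \<eta>"]) (auto intro!: derivative_eq_intros der)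
        qed
        then show ?thesis by (simp add: algebra_simps)
      qed
      then obtain u v where uv: "x \<le> u" "u \<le> v" "v \<le> y" "v - u \<le> 2 * \<delta>"
           "u = x \<or> (\<forall>t\<in>{x..u}. \<bar>\<sigma> * f t\<bar> \<ge> \<eta> * \<delta>)" "v = y \<or> (\<forall>t\<in>{v..y}. \<bar>\<sigma> * f t\<bar> \<ge> \<eta> * \<delta>)"
        using steep_function_small_interval[of x y \<eta> \<delta> "\<lambda>t. \<sigma> * f t"] xy \<eta> insert.prems
        by (force intro!: continuous_intros cont)
      have *: "\<bar>\<sigma> * f t\<bar> = \<bar>f t\<bar>" for t using \<sigma>(1) by (auto simp: abs_mult)
      have nn: "\<eta> * \<delta> \<ge> 0" using \<eta> insert.prems by auto
      have "Q x u" using uv W[of "\<eta> * \<delta>"] xy insert.prems nn unfolding Q_def * by fastforce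
      moreover have "Q u v" using uv by (simp add: Q_def)
      moreover have "Q v y" using uv W[of "\<eta> * \<delta>"] xy insert.prems nn unfolding Q_def * by fastforce
      ultimately show ?thesis using uv(1-3) by (intro splits_three)
    qed
  qed (use insert mV in auto)
  moreover have "\<bar>c L\<bar> * (\<Prod>l\<in>insert m V. L - l) * \<delta> ^ card (insert m V) = \<eta> * \<delta>"
    using insert(1) mV by (simp add: \<eta>_def abs_mult)
  moreover have "(3::nat) ^ card (insert m V) = 3 ^ card V * 3" using insert(1) mV by simp
  ultimately show ?case by (simp only: Q_def W_def)
qed

text \<open>Integration by parts with cis \<phi> / (i \<phi>') as approximate primitive. The error
  \<open>G\<close> has modulus |\<phi>''| / \<phi>'^2, and because \<phi>'' keeps its sign this
  integrates exactly to a difference of values of 1 / \<phi>' up to sign. Four boundary values of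
  size at most 1/m give the constant 4.\<close>

lemma van_der_Corput_first_derivative:
  fixes \<phi> \<phi>' \<phi>'' :: "real \<Rightarrow> real"
  assumes "a \<le> b" "m > 0"
    and d1: "\<And>t. t \<in> {a..b} \<Longrightarrow> (\<phi> has_real_derivative \<phi>' t) (at t within {a..b})"
    and d2: "\<And>t. t \<in> {a..b} \<Longrightarrow> (\<phi>' has_real_derivative \<phi>'' t) (at t within {a..b})"
    and large: "\<And>t. t \<in> {a..b} \<Longrightarrow> \<bar>\<phi>' t\<bar> \<ge> m"
    and sign: "(\<forall>t\<in>{a..b}. \<phi>'' t \<ge> 0) \<or> (\<forall>t\<in>{a..b}. \<phi>'' t \<le> 0)"
  shows "norm (integral {a..b} (\<lambda>t. cis (\<phi> t))) \<le> 4 / m"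
proof -
  have nz: "\<phi>' t \<noteq> 0" if "t \<in> {a..b}" for t using large[OF that] assms(2) by auto
  define F where "F = (\<lambda>t. cis (\<phi> t) * of_real (1 / \<phi>' t) / \<i>)"
  define G where "G = (\<lambda>t. cis (\<phi> t) * of_real (- \<phi>'' t / (\<phi>' t)\<^sup>2) / \<i>)"
  have dF: "(F has_vector_derivative (cis (\<phi> t) + G t)) (at t within {a..b})" if t: "t \<in> {a..b}" for t
  proof -
    have c: "((\<lambda>t. cis (\<phi> t)) has_vector_derivative (\<i> * \<phi>' t * cis (\<phi> t))) (at t within {a..b})"
    proof -
      have "((\<lambda>t. \<i> * complex_of_real (\<phi> t)) has_vector_derivative \<i> * \<phi>' t) (at t within {a..b})"
        by (intro has_vector_derivative_mult_right has_vector_derivative_of_real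
d1[OF t])
      from field_vector_diff_chain_within[OF this, of exp "exp (\<i> * \<phi> t)"] show ?thesis
        by (simp add: o_def cis_conv_exp DERIV_exp has_field_derivative_at_within)
    qed
    have r: "((\<lambda>t. 1 / \<phi>' t) has_real_derivative (- \<phi>'' t / (\<phi>' t)\<^sup>2)) (at t within {a..b})"
      by (rule DERIV_cong[OF DERIV_inverse_fun[OF d2[OF t] nz[OF t], unfolded inverse_eq_divide]])
         (simp add: power2_eq_square)
    have "((\<lambda>t. cis (\<phi> t) * of_real (1 / \<phi>' t)) has_vector_derivative
            (cis (\<phi> t) * of_real (- \<phi>'' t / (\<phi>' t)\<^sup>2) + (\<i> * \<phi>' t * cis (\<phi> t))
                * of_real (1 / \<phi>' t))) (at t within {a..b})"
      by (intro has_vector_derivative_mult c has_vector_derivative_of_real r)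
    from has_vector_derivative_divide[OF this, of \<i>]
    show ?thesis unfolding F_def
      by (rule has_vector_derivative_eq_rhs) (use nz[OF t] in \<open>simp add: G_def add_divide_distrib
          right_diff_distrib\<close>)
  qed
  have iF: "((\<lambda>t. cis (\<phi> t) + G t) has_integral (F b - F a)) {a..b}"
    by (rule fundamental_theorem_of_calculus[OF assms(1) dF])
  have \<phi>: "continuous_on {a..b} \<phi>" using d1 by (intro DERIV_continuous_on) auto
  have icis: "(\<lambda>t. cis (\<phi> t)) integrable_on {a..b}"
    by (intro integrable_continuous_interval continuous_intros \<phi>)
  have iG: "G integrable_on {a..b}"
    using integrable_diff[OF has_integral_integrable[OF iF] icis] by simp
  obtain \<sigma> where \<sigma>: "\<sigma> = 1 \<or> \<sigma> = -1" "\<forall>t\<in>{a..b}. \<bar>\<phi>'' t\<bar> = \<sigma> * \<phi>'' t"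
    using sign
  proof (elim disjE)
    assume "\<forall>t\<in>{a..b}. \<phi>'' t \<ge> 0"
    then show ?thesis by (intro that[of 1]) auto
  next
    assume "\<forall>t\<in>{a..b}. \<phi>'' t \<le> 0"
    then show ?thesis by (intro that[of "-1"]) auto
  qed
  have iH: "((\<lambda>t. \<bar>\<phi>'' t\<bar> / (\<phi>' t)\<^sup>2) has_integral (- \<sigma> / \<phi>' b - (- \<sigma> / \<phi>' a))) {a..b}"
  proof (rule fundamental_theorem_of_calculus[OF assms(1)])
    fix t assume t: "t \<in> {a..b}"
    show "((\<lambda>t. - \<sigma> / \<phi>' t) has_vector_derivative (\<bar>\<phi>'' t\<bar> / (\<phi>' t)\<^sup>2)) (at t within {a..b})"
      unfolding has_real_derivative_iff_has_vector_derivative[symmetric]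
      by (rule DERIV_cong[OF DERIV_cmult[OF DERIV_inverse_fun[OF d2[OF t] nz[OF t]], of "- \<sigma>",
          folded divide_inverse]])
         (use \<sigma>(2) t in \<open>simp add: power2_eq_square divide_inverse\<close>)
  qed
  have inv: "\<bar>1 / \<phi>' t\<bar> \<le> 1 / m" if "t \<in> {a..b}" for t
    using large[OF that] assms(2) by (simp add: abs_divide frac_le)
  have s: "\<bar>\<sigma> / \<phi>' t\<bar> \<le> 1 / m" if "t \<in> {a..b}" for t
    using inv[OF that] \<sigma>(1) by (auto simp: abs_divide)
  have "norm (integral {a..b} G) \<le> integral {a..b} (\<lambda>t. \<bar>\<phi>'' t\<bar> / (\<phi>' t)\<^sup>2)"
    by (rule integral_norm_bound_integral[OF iG has_integral_integrable[OF iH]])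
       (auto simp: G_def norm_mult norm_divide norm_power)
  also have "\<dots> = - \<sigma> / \<phi>' b - (- \<sigma> / \<phi>' a)" using iH by (rule integral_unique)
  also have "\<dots> \<le> 1 / m + 1 / m"
    using abs_le_D1[OF s[of a]] abs_le_D2[OF s[of b]] assms(1) by simp
  also have "\<dots> = 2 / m" by simp
  finally have nG: "norm (integral {a..b} G) \<le> 2 / m" .
  have "integral {a..b} (\<lambda>t. cis (\<phi> t)) = F b - F a - integral {a..b} G"
    using integral_unique[OF iF] integral_add[OF icis iG] by (simp add: algebra_simps)
  moreover have "norm (F t) \<le> 1 / m" if "t \<in> {a..b}" for t
    using inv[OF that] by (simp add: F_def norm_mult norm_divide)
  ultimately have "norm (integral {a..b} (\<lambda>t. cis (\<phi> t))) \<le> 1 / m + 1 / m + 2 / m"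
    using nG assms(1) by (smt (verit) atLeastAtMost_iff norm_triangle_ineq4)
  then show ?thesis by simp
qed

text \<open>With n = card V, the choice \<delta> = \<Lambda>^(-1/(n+1)) balances two kinds of
  pieces: a short one contributes at most 2 \<delta>, and on the others |\<phi>'| is at least
  \<Lambda> \<delta>^n = 1/\<delta>, so that van der Corput gives 4 \<delta>. There are 3^n pieces
  for the size of \<phi>', each cut into 2^(n+1) for the sign of \<phi>'', whence the power of
  6.\<close>

lemma exponential_phase_integral_bound:
  fixes c :: "real \<Rightarrow> real"
  assumes V: "finite V" "\<forall>l\<in>V. l < L" "\<forall>l\<in>V. 0 \<le> l" and L: "0 < L" and c: "c L \<noteq> 0"
  defines "\<Lambda> \<equiv> \<bar>c L\<bar> * L * (\<Prod>l\<in>V. L - l)"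
  shows "norm (integral {0..1} (\<lambda>t. cis (\<Sum>l\<in>insert L V. c l * exp (l * t))))
           \<le> 4 * 6 ^ (card V + 1) * \<Lambda> powr (- 1 / real (card V + 1))"
proof -
  define \<phi> where "\<phi> = exp_sum c 0 (insert L V)"
  define c' where "c' = (\<lambda>l. c l * l)"
  define \<phi>' where "\<phi>' = exp_sum c' 0 (insert L V)"
  define \<phi>'' where "\<phi>'' = exp_sum (\<lambda>l. c' l * l) 0 (insert L V)"
  define n where "n = card V"
  have \<Lambda>: "\<Lambda> > 0" unfolding \<Lambda>_def using V L c by (auto intro!: mult_pos_pos prod_pos)
  define \<delta> where "\<delta> = \<Lambda> powr (- 1 / real (n + 1))"
  have \<delta>: "\<delta> > 0" using \<Lambda> by (simp add: \<delta>_def)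
  have "\<Lambda> * \<delta> ^ (n + 1) = 1"
  proof -
    have e: "- 1 / real (n + 1) * real (n + 1) = - 1" by (simp add: field_simps)
    have "\<delta> ^ (n + 1) = \<delta> powr real (n + 1)" using \<delta> by (simp only: powr_realpow)
    also have "\<dots> = \<Lambda> powr (- 1)" by (simp only: \<delta>_def powr_powr e)
    finally show ?thesis using \<Lambda> by (simp add: powr_minus)
  qed
  then have \<delta>n: "\<Lambda> * \<delta> ^ n = 1 / \<delta>" using \<delta> by (simp add: field_simps)
  define P where "P = (\<lambda>x y. (\<forall>t\<in>{x..y}. \<phi>'' t \<ge> 0) \<or> (\<forall>t\<in>{x..y}. \<phi>'' t \<le> 0))"
  define Q where "Q = (\<lambda>x y. (y - x \<le> 2 * \<delta> \<or> (\<forall>t\<in>{x..y}. \<bar>\<phi>' t\<bar> \<ge> 1 / \<delta>)))"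
  have LV: "L \<notin> V" using V by auto
  have large: "splits Q (3 ^ n) x y" if "0 \<le> x" "x \<le> y" for x y
    using exp_sum_large_splits[of V L c' 0 x y \<delta>] that V L c \<delta> \<delta>n
    unfolding Q_def \<phi>'_def n_def \<Lambda>_def c'_def by (simp add: abs_mult mult_ac)
  have sgn: "splits P (2 ^ (n + 1)) x y" if "x \<le> y" for x y
    using exp_sum_sign_splits[of "insert L V" x y] that V LV unfolding P_def \<phi>''_def n_def by simp
  have d1: "(\<phi> has_real_derivative \<phi>' t) (at t within S)" for t S
    unfolding \<phi>_def \<phi>'_def c'_def using exp_sum_derivative[of c 0] by simp
  have d2: "(\<phi>' has_real_derivative \<phi>'' t) (at t within S)" for t S
    unfolding \<phi>'_def \<phi>''_def using exp_sum_derivative[of c' 0] by simp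
  have cont: "continuous_on S (\<lambda>t. cis (\<phi> t))" for S
    unfolding \<phi>_def by (intro continuous_intros exp_sum_continuous)
  have "norm (integral {0..1} (\<lambda>t. cis (\<phi> t))) \<le> real (3 ^ n) * (real (2 ^ (n + 1)) * (4 * \<delta>))"
  proof (rule norm_integral_splits_le[OF large[of 0 1] cont])
    fix x y :: real assume xy: "0 \<le> x" "x \<le> y" "y \<le> 1" "Q x y"
    show "norm (integral {x..y} (\<lambda>t. cis (\<phi> t))) \<le> real (2 ^ (n + 1)) * (4 * \<delta>)"
    proof (rule norm_integral_splits_le[OF sgn[of x y] cont])
      fix u v assume uv: "x \<le> u" "u \<le> v" "v \<le> y" "P u v"
      from xy(4) consider "v - u \<le> 2 * \<delta>" | "\<forall>t\<in>{u..v}. \<bar>\<phi>' t\<bar> \<ge> 1 / \<delta>"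
        using uv unfolding Q_def by fastforce
      then show "norm (integral {u..v} (\<lambda>t. cis (\<phi> t))) \<le> 4 * \<delta>"
      proof cases
        case 1
        have "norm (integral {u..v} (\<lambda>t. cis (\<phi> t))) \<le> 1 * (v - u)"
          by (rule integral_bound[OF uv(2) cont]) auto
        then show ?thesis using 1 \<delta> by simp
      next
        case 2
        have "norm (integral {u..v} (\<lambda>t. cis (\<phi> t))) \<le> 4 / (1 / \<delta>)"
          by (rule van_der_Corput_first_derivative[OF uv(2) _ d1 d2]) (use 2 \<delta> uv(4) in \<open>auto simp:
              P_def\<close>)
        then show ?thesis by simp
      qed
    qed (use xy in auto)
  qed auto
  also have "\<dots> = 8 * 6 ^ n * \<delta>" by (simp add: power_mult_distrib[symmetric])
  also have "\<dots> \<le> 4 * 6 ^ (n + 1) * \<delta>" using \<delta> by simp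
  finally show ?thesis by (simp add: \<phi>_def exp_sum_def \<delta>_def n_def)
qed

text \<open>The substitution l = ln z, \<alpha> = A + t moves z^A into the coefficient. The
  differences ln L - ln z are at least 1 - z/L, and L \<ge> 2 bounds ln L below by ln 2.\<close>

lemma power_phase_integral_bound:
  fixes h :: "nat \<Rightarrow> real" and A :: real
  assumes V: "finite V" "\<forall>z\<in>V. 1 \<le> z \<and> z < L" and L: "2 \<le> L" and h: "h L \<noteq> 0"
  shows "norm (integral {A..A + 1} (\<lambda>\<alpha>. cis (2 * pi * (\<Sum>z\<in>insert L V. h z * real z powr \<alpha>))))
     \<le> 4 * 6 ^ (card V + 1) * (\<bar>h L\<bar> * ln 2 * real L powr A * (\<Prod>z\<in>V. 1 - real z / real L))
            powr (- 1 / real (card V + 1))"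
proof -
  define W where "W = (\<lambda>z. ln (real z)) ` V"
  \<comment> \<open>Coefficients have to be indexed by the exponent l = ln z; rounding exp l to the
    nearest integer gives z back.\<close>
  define c where "c = (\<lambda>l. 2 * pi * h (nat \<lfloor>exp l + 1 / 2\<rfloor>) * exp (l * A))"
  have c_ln: "c (ln (real z)) = 2 * pi * h z * real z powr A" if "z \<ge> 1" for z
  proof -
    have "\<lfloor>real z + 1 / 2\<rfloor> = int z" by linarith
    then show ?thesis using that by (simp add: c_def powr_def mult.commute)
  qed
  have inj: "inj_on (\<lambda>z. ln (real z)) (insert L V)" 
    proof (rule inj_onI)
    fix x y assume xy: "x \<in> insert L V" "y \<in> insert L V" "ln (real x) = ln (real y)"
    then have "real x > 0" "real y > 0" using V L by (auto simp: Suc_le_eq)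
    then show "x = y" using xy(3) by simp
  qed
  have injV: "inj_on (\<lambda>z. ln (real z)) V" using inj by (rule inj_on_subset) auto
  have ins: "insert (ln (real L)) W = (\<lambda>z. ln (real z)) ` insert L V" by (simp add: W_def)
  have card: "card W = card V" unfolding W_def using injV by (rule card_image)
  have eq: "2 * pi * (\<Sum>z\<in>insert L V. h z * real z powr (A + t))
              = (\<Sum>l\<in>insert (ln (real L)) W. c l * exp (l * t))" for t
    unfolding ins sum.reindex[OF inj] o_def sum_distrib_left
  proof (rule sum.cong[OF refl])
    fix z assume "z \<in> insert L V"
    then have "z \<ge> 1" using V L by auto
    then show "2 * pi * (h z * real z powr (A + t)) = c (ln (real z)) * exp (ln (real z) * t)"
      by (simp add: c_ln powr_add powr_def algebra_simps exp_add[symmetric])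
  qed
  define \<Lambda>' where "\<Lambda>' = \<bar>c (ln (real L))\<bar> * ln (real L) * (\<Prod>l\<in>W. ln (real L) - l)"
  define \<Lambda> where "\<Lambda> = \<bar>h L\<bar> * ln 2 * real L powr A * (\<Prod>z\<in>V. 1 - real z / real L)"
  have "norm (integral {0..1} (\<lambda>t. cis (\<Sum>l\<in>insert (ln (real L)) W. c l * exp (l * t))))
           \<le> 4 * 6 ^ (card W + 1) * \<Lambda>' powr (- 1 / real (card W + 1))"
    unfolding \<Lambda>'_def
    by (rule exponential_phase_integral_bound) (use V L h c_ln[of L] in \<open>auto simp: W_def\<close>)
  moreover have "integral {A..A + 1} (\<lambda>\<alpha>. cis (2 * pi * (\<Sum>z\<in>insert L V. h z * real z powr \<alpha>)))
     = integral {0..1} (\<lambda>t. cis (2 * pi * (\<Sum>z\<in>insert L V. h z * real z powr (A + t))))"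
  proof -
    have "integral {0..1} ((\<lambda>\<alpha>. cis (2 * pi * (\<Sum>z\<in>insert L V. h z * real z powr \<alpha>))) \<circ> (\<lambda>t. A + t))
      = integral {A..A + 1} (\<lambda>\<alpha>. cis (2 * pi * (\<Sum>z\<in>insert L V. h z * real z powr \<alpha>)))"
      by (subst integral_shift_Icc_real) (simp add: add.commute)
    then show ?thesis by (simp add: o_def)
  qed
  moreover have "\<Lambda> > 0" unfolding \<Lambda>_def using V L h by (auto intro!: mult_pos_pos prod_pos)
  moreover have "\<Lambda> \<le> \<Lambda>'"
  proof -
    have "(\<Prod>z\<in>V. 1 - real z / real L) \<le> (\<Prod>z\<in>V. ln (real L) - ln (real z))"
    proof (rule prod_mono)
      fix z assume z: "z \<in> V"
      then have "ln (real z / real L) \<le> real z / real L - 1" using V by (intro ln_le_minus_one) auto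
      then show "0 \<le> 1 - real z / real L \<and> 1 - real z / real L \<le> ln (real L) - ln (real z)"
        using V z L by (auto simp: ln_div)
    qed
    moreover have "\<bar>h L\<bar> * ln 2 * real L powr A \<le> \<bar>c (ln (real L))\<bar> * ln (real L)"
    proof -
      have "\<bar>h L\<bar> * real L powr A * ln 2 \<le> (2 * pi * (\<bar>h L\<bar> * real L powr A)) * ln (real L)"
      proof (rule mult_mono)
        have "1 * (\<bar>h L\<bar> * real L powr A) \<le> 2 * pi * (\<bar>h L\<bar> * real L powr A)"
          using pi_ge_two by (intro mult_right_mono) auto
        then show "\<bar>h L\<bar> * real L powr A \<le> 2 * pi * (\<bar>h L\<bar> * real L powr A)" by simp
      qed (use L in auto)
      then show ?thesis using c_ln[of L] L by (simp add: abs_mult mult_ac)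
    qed
    ultimately show ?thesis unfolding \<Lambda>_def \<Lambda>'_def W_def prod.reindex[OF injV] o_def
      by (intro mult_mono[of "\<bar>h L\<bar> * ln 2 * real L powr A"]) (use V L in \<open>auto intro!: prod_nonneg\<close>)
  qed
  ultimately have "norm (integral {A..A + 1} (\<lambda>\<alpha>. cis (2 * pi * (\<Sum>z\<in>insert L V. h z * real z powr \<alpha>))))
      \<le> 4 * 6 ^ (card V + 1) * \<Lambda>' powr (- 1 / real (card V + 1))"
    by (simp only: eq card)
  also have "\<dots> \<le> 4 * 6 ^ (card V + 1) * \<Lambda> powr (- 1 / real (card V + 1))"
    using \<open>\<Lambda> > 0\<close> \<open>\<Lambda> \<le> \<Lambda>'\<close> by (intro mult_left_mono powr_mono2') auto
  finally show ?thesis by (simp only: \<Lambda>_def)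
qed

section \<open>Weighted sums over integer tuples\<close>

text \<open>Comparison with an integral in telescoped form: by the mean value theorem each term is
  at most an increment of n^(1 - \<sigma>) / (1 - \<sigma>).\<close>

lemma sum_powr_minus_le:
  assumes "0 \<le> \<sigma>" "\<sigma> < 1"
  shows "(\<Sum>d=1..n. real d powr - \<sigma>) \<le> real n powr (1 - \<sigma>) / (1 - \<sigma>)"
proof (induction n)
  case (Suc n)
  have "(1 - \<sigma>) * real (Suc n) powr - \<sigma> \<le> real (Suc n) powr (1 - \<sigma>) - real n powr (1 - \<sigma>)"
  proof (cases "n = 0")
    case False
    have "\<exists>z>real n. z < real n + 1 \<and> (real n + 1) powr (1 - \<sigma>) - real n powr (1 - \<sigma>)
            = (real n + 1 - real n) * ((1 - \<sigma>) * z powr (1 - \<sigma> - 1))"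
      using False by (intro MVT2) (auto intro!: derivative_eq_intros)
    then obtain z where z: "z > real n" "z < real n + 1"
      and eq: "(real n + 1) powr (1 - \<sigma>) - real n powr (1 - \<sigma>) = (1 - \<sigma>) * z powr - \<sigma>" by auto
    have "(1 - \<sigma>) * (real n + 1) powr - \<sigma> \<le> (1 - \<sigma>) * z powr - \<sigma>"
      using z assms by (intro mult_left_mono powr_mono2') auto
    then show ?thesis using eq by (simp add: add.commute)
  qed (use assms in auto)
  then have "real (Suc n) powr - \<sigma> \<le> (real (Suc n) powr (1 - \<sigma>) - real n powr (1 - \<sigma>)) / (1 - \<sigma>)"
    using assms by (simp add: field_simps)
  then show ?case using Suc by (simp add: diff_divide_distrib)
qed auto

lemma sum_powr_le:
  assumes "\<beta> \<le> \<gamma>" "0 \<le> \<gamma>"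
  shows "(\<Sum>d=1..n. real d powr \<beta>) \<le> real n powr (\<gamma> + 1)"
proof (cases "n = 0")
  case False
  have "(\<Sum>d=1..n. real d powr \<beta>) \<le> (\<Sum>d=1..n. real n powr \<gamma>)"
  proof (rule sum_mono)
    fix d assume "d \<in> {1..n}"
    then show "real d powr \<beta> \<le> real n powr \<gamma>"
      using assms by (auto intro!: order_trans[OF powr_mono powr_mono2])
  qed
  then show ?thesis using False by (simp add: powr_add mult.commute)
qed auto

text \<open>The factor that a further base \<open>b\<close> contributes to the bound for a phase
  with largest base \<open>a\<close>. The value 1 for \<open>b \<ge> a\<close> covers indices that
  share the largest base, and keeps every factor at least 1, so that additional factors may be
  inserted into upper bounds.\<close>

definition gap_weight :: "real \<Rightarrow> nat \<Rightarrow> nat \<Rightarrow> real" where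
  "gap_weight \<theta> a b = (if b < a then (1 - real b / real a) powr - \<theta> else 1)"

lemma gap_weight_ge_1: "\<theta> \<ge> 0 \<Longrightarrow> gap_weight \<theta> a b \<ge> 1"
  by (auto simp: gap_weight_def powr_minus intro!: one_le_inverse powr_le1)

text \<open>With d = z - b the weight is (z/d)^\<theta>. As \<theta> < 1 the singularity at small d
  is summable: the sum of d^(-\<theta>) up to z is of order z^(1 - \<theta>).\<close>

lemma sum_gap_weight_le:
  assumes "0 \<le> \<theta>" "\<theta> < 1" "z \<ge> 1"
  shows "(\<Sum>b=1..z. gap_weight \<theta> z b) \<le> (1 + 1 / (1 - \<theta>)) * real z"
proof -
  have "(\<Sum>b=1..z. gap_weight \<theta> z b) = 1 + (\<Sum>b\<in>{1..<z}. (1 - real b / real z) powr - \<theta>)"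
    using assms(3) by (simp add: atLeastLessThanSuc_atLeastAtMost[symmetric] gap_weight_def)
  also have "(\<Sum>b\<in>{1..<z}. (1 - real b / real z) powr - \<theta>)
      = (\<Sum>d\<in>{1..<z}. real z powr \<theta> * real d powr - \<theta>)"
  proof (rule sum.reindex_bij_witness[of _ "\<lambda>d. z - d" "\<lambda>b. z - b"])
    fix b assume b: "b \<in> {1..<z}"
    then have e: "1 - real b / real z = real (z - b) / real z" by (simp add: field_simps of_nat_diff)
    show "real z powr \<theta> * real (z - b) powr - \<theta> = (1 - real b / real z) powr - \<theta>"
      unfolding e by (simp add: powr_divide powr_minus field_simps)
  qed auto
  also have "\<dots> \<le> (\<Sum>d=1..z. real z powr \<theta> * real d powr - \<theta>)" by (rule sum_mono2) auto
  also have "\<dots> \<le> real z powr \<theta> * (real z powr (1 - \<theta>) / (1 - \<theta>))"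
    unfolding sum_distrib_left[symmetric] using assms by (intro mult_left_mono sum_powr_minus_le) auto
  also have "\<dots> = real z / (1 - \<theta>)" using assms by (simp flip: powr_add)
  finally show ?thesis using assms(3) by (simp add: algebra_simps)
qed

text \<open>A soft version of the cut-off |t| \<le> N. Decay of order 2 suffices for a total of
  order N, and is what remains per coefficient when decay of order 4 is shared between two
  neighbours in \<open>prod_weight_power_coeff\<close>.\<close>

definition int_weight :: "real \<Rightarrow> int \<Rightarrow> real" where
  "int_weight N t = 1 / (1 + \<bar>real_of_int t\<bar> / N)\<^sup>2"

lemma int_weight_bounds: "N > 0 \<Longrightarrow> 0 \<le> int_weight N t" "N > 0 \<Longrightarrow> int_weight N t \<le> 1"
  by (auto simp: int_weight_def divide_le_eq_1 intro!: one_le_power)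

lemma sum_int_symmetric:
  fixes f :: "int \<Rightarrow> real"
  assumes "\<And>t. f (- t) = f t"
  shows "(\<Sum>t\<in>{- int n..int n}. f t) = f 0 + 2 * (\<Sum>d=1..n. f (int d))"
proof -
  have "(\<Sum>t\<in>{- int n..int n}. f t) = (\<Sum>t\<in>{0} \<union> int ` {1..n} \<union> (\<lambda>d. - int d) ` {1..n}. f t)"
  proof (rule sum.cong[OF _ refl], intro set_eqI iffI)
    fix t assume t: "t \<in> {- int n..int n}"
    consider "t = 0" | "t = int (nat t)" "nat t \<ge> 1" | "t = - int (nat (- t))" "nat (- t) \<ge> 1"
        by linarith
    then show "t \<in> {0} \<union> int ` {1..n} \<union> (\<lambda>d. - int d) ` {1..n}"
    proof cases
      case 2
      then show ?thesis using t by (auto intro!: image_eqI[of _ _ "nat t"])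
    next
      case 3
      then show ?thesis using t by (auto intro!: image_eqI[of _ _ "nat (- t)"])
    qed auto
  qed auto
  also have "\<dots> = f 0 + (\<Sum>t\<in>int ` {1..n}. f t) + (\<Sum>t\<in>(\<lambda>d. - int d) ` {1..n}. f t)"
    by (subst sum.union_disjoint, simp, simp, force, subst sum.union_disjoint) auto
  also have "\<dots> = f 0 + 2 * (\<Sum>d=1..n. f (int d))"
    by (simp add: sum.reindex inj_on_def assms)
  finally show ?thesis .
qed

text \<open>Telescoping against N / (1 + d/N): the positive integers contribute at most N, so the
  total is at most 1 + 2N \<le> 3N.\<close>

lemma sum_int_weight_le:
  assumes "N \<ge> 1" "finite T"
  shows "(\<Sum>t\<in>T. int_weight N t) \<le> 3 * N"
proof -
  obtain n :: nat where n: "T \<subseteq> {- int n..int n}"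
  proof -
    have "\<forall>t\<in>T. \<bar>t\<bar> \<le> Max (insert 0 (abs ` T))" using assms(2) by (auto intro!: Max_ge)
    then have "T \<subseteq> {- int (nat (Max (insert 0 (abs ` T))))..int (nat (Max (insert 0 (abs ` T))))}"
      by (intro subsetI) (smt (verit) atLeastAtMost_iff int_nat_eq)
    then show ?thesis by (rule that)
  qed
  have "(\<Sum>t\<in>T. int_weight N t) \<le> (\<Sum>t\<in>{- int n..int n}. int_weight N t)"
    using n assms int_weight_bounds by (intro sum_mono2) auto
  also have "\<dots> = int_weight N 0 + 2 * (\<Sum>d=1..n. int_weight N (int d))"
    by (rule sum_int_symmetric) (simp add: int_weight_def)
  also have "(\<Sum>d=1..n. int_weight N (int d)) \<le> N * (1 - 1 / (1 + real n / N))"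
  proof (induction n)
    case (Suc n)
    have "int_weight N (int (Suc n)) \<le> N * (1 / (1 + real n / N) - 1 / (1 + real (Suc n) / N))"
    proof -
      have "N * (1 / (1 + real n / N) - 1 / (1 + real (Suc n) / N))
          = 1 / ((1 + real n / N) * (1 + real (Suc n) / N))"
      proof -
        have diff: "1 / x - 1 / y = (y - x) / (x * y)" if "x > 0" "y > 0" for x y :: real
          using that by (simp add: field_simps)
        have "1 / (1 + real n / N) - 1 / (1 + real (Suc n) / N)
            = ((1 + real (Suc n) / N) - (1 + real n / N)) / ((1 + real n / N) * (1 + real (Suc n) / N))"
          using assms(1) by (intro diff add_pos_nonneg) auto
        also have "(1 + real (Suc n) / N) - (1 + real n / N) = 1 / N" by (simp add: add_divide_distrib)
        finally have e: "1 / (1 + real n / N) - 1 / (1 + real (Suc n) / N)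
            = (1 / N) / ((1 + real n / N) * (1 + real (Suc n) / N))" .
        have "N * ((1 / N) / P) = 1 / P" for P using assms(1) by simp
        then show ?thesis unfolding e .
      qed
      moreover have "(1 + real n / N) * (1 + real (Suc n) / N) \<le> (1 + real (Suc n) / N)\<^sup>2"
        unfolding power2_eq_square using assms(1) by (intro mult_right_mono) (auto simp:
            divide_right_mono)
      moreover have "0 < (1 + real n / N) * (1 + real (Suc n) / N)"
        using assms(1) by (intro mult_pos_pos add_pos_nonneg) auto
      moreover have "int_weight N (int (Suc n)) = 1 / (1 + real (Suc n) / N)\<^sup>2"
        by (simp add: int_weight_def)
      ultimately show ?thesis using frac_le[of 1 1] by auto
    qed
    then show ?case using Suc by (simp add: algebra_simps)
  qed auto
  also have "N * (1 - 1 / (1 + real n / N)) \<le> N" using assms(1) by simp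
  finally show ?thesis using assms int_weight_bounds(2)[of N 0] by simp
qed

text \<open>For |t + s| \<le> N the weight is bounded by 1 and the power is summed directly;
  elsewhere the power is at most N^(-\<theta>) and the weight is summed. The result is uniform in
  the shift \<open>s\<close>.\<close>

lemma sum_int_weight_shifted_le:
  assumes "N \<ge> 1" "finite T" "0 \<le> \<theta>" "\<theta> < 1"
  shows "(\<Sum>t\<in>T. int_weight (real N) t * \<bar>real_of_int (t + s)\<bar> powr - \<theta>)
      \<le> (3 + 2 / (1 - \<theta>)) * real N powr (1 - \<theta>)"
proof -
  let ?r = "\<lambda>t. \<bar>real_of_int (t + s)\<bar> powr - \<theta>"
  let ?w = "int_weight (real N)"
  let ?J = "{- int N - s..int N - s}"
  have "?w t * ?r t
      \<le> (if t \<in> ?J then ?r t else 0) + ?w t * real N powr - \<theta>" for t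
  proof (cases "t \<in> ?J")
    case True
    have "?w t * ?r t \<le> 1 * ?r t"
      using assms int_weight_bounds by (intro mult_right_mono) auto
    moreover have "0 \<le> ?w t * real N powr - \<theta>" using assms int_weight_bounds by auto
    ultimately show ?thesis using True by simp
  next
    case False
    then have "int N \<le> \<bar>t + s\<bar>" by auto
    then have "real N \<le> \<bar>real_of_int (t + s)\<bar>" by linarith
    then have "?w t * ?r t \<le> ?w t * real N powr - \<theta>"
      using assms int_weight_bounds by (intro mult_left_mono powr_mono2') auto
    then show ?thesis using False by (simp only: if_False add_0_left)
  qed
  then have "(\<Sum>t\<in>T. ?w t * ?r t)
     \<le> (\<Sum>t\<in>T. (if t \<in> ?J then ?r t else 0)) + (\<Sum>t\<in>T. ?w t) * real N powr - \<theta>"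
    by (simp add: sum.distrib[symmetric] sum_distrib_right sum_mono)
  also have "(\<Sum>t\<in>T. ?w t) * real N powr - \<theta> \<le> (3 * real N) * real N powr - \<theta>"
    using assms by (intro mult_right_mono sum_int_weight_le) auto
  also have "(3 * real N) * real N powr - \<theta> = 3 * real N powr (1 - \<theta>)"
    using assms(1) powr_add[of "real N" 1 "- \<theta>"] by simp
  also have "(\<Sum>t\<in>T. (if t \<in> ?J then ?r t else 0))
      = (\<Sum>t\<in>T \<inter> ?J. ?r t)"
    by (rule sum.inter_restrict[OF assms(2), symmetric])
  also have "\<dots> \<le> (\<Sum>t\<in>?J. ?r t)"
    by (intro sum_mono2) auto
  also have "\<dots> = (\<Sum>t\<in>{- int N..int N}. \<bar>real_of_int t\<bar> powr - \<theta>)"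
    by (rule sum.reindex_bij_witness[of _ "\<lambda>t. t - s" "\<lambda>t. t + s"]) auto
  \<comment> \<open>The term at t = 0 vanishes because \<open>0 powr x = 0\<close>. This is
    harmless: the phase bound takes such powers only of nonzero net coefficients.\<close>
  also have "\<dots> = 2 * (\<Sum>d=1..N. real d powr - \<theta>)"
    by (subst sum_int_symmetric) auto
  also have "\<dots> \<le> 2 * (real N powr (1 - \<theta>) / (1 - \<theta>))"
    using assms by (intro mult_left_mono sum_powr_minus_le) auto
  finally show ?thesis by (simp add: algebra_simps)
qed

section \<open>Sums over constrained families of tuples\<close>

lemma sum_PiE_split:
  assumes "finite I" "finite S" "j \<in> I"
  shows "(\<Sum>p\<in>PiE I (\<lambda>_. S). F p) = (\<Sum>z\<in>S. \<Sum>p\<in>PiE I ((\<lambda>_. S)(j := {z})). F p)"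
proof -
  have "PiE I (\<lambda>_. S) = (\<Union>z\<in>S. PiE I ((\<lambda>_. S)(j := {z})))"
  proof (intro set_eqI iffI)
    fix p assume "p \<in> PiE I (\<lambda>_. S)"
    then have "p j \<in> S" "p \<in> PiE I ((\<lambda>_. S)(j := {p j}))" using assms(3) by (auto simp: PiE_iff)
    then show "p \<in> (\<Union>z\<in>S. PiE I ((\<lambda>_. S)(j := {z})))" by blast
  next
    fix p assume "p \<in> (\<Union>z\<in>S. PiE I ((\<lambda>_. S)(j := {z})))"
    then obtain z where "z \<in> S" "p \<in> PiE I ((\<lambda>_. S)(j := {z}))" by blast
    then show "p \<in> PiE I (\<lambda>_. S)" by (auto simp: PiE_iff split: if_splits)
  qed
  moreover have "(\<Sum>p\<in>(\<Union>z\<in>S. PiE I ((\<lambda>_. S)(j := {z}))). F p) = (\<Sum>z\<in>S. \<Sum>p\<in>PiE I ((\<lambda>_. S)(j := {z})). F p)"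
    using assms by (intro sum.UNION_disjoint) (auto intro!: finite_PiE dest!: PiE_mem[where x = j])
  ultimately show ?thesis by simp
qed

text \<open>The way in which linear constraints save powers of N: pairs that are determined by their
  free coordinates \<open>F\<close> and \<open>R\<close> are summed as if these coordinates were
  independent.\<close>

lemma sum_restrict_pair_le:
  fixes f :: "('i \<Rightarrow> 'b) \<Rightarrow> real" and g :: "('i \<Rightarrow> 'c) \<Rightarrow> real"
  assumes "finite I" "finite T" "finite S" "F \<subseteq> I" "R \<subseteq> I"
    and X: "X \<subseteq> PiE I (\<lambda>_. T) \<times> PiE I (\<lambda>_. S)"
    and inj: "inj_on (\<lambda>(w, p). (restrict w F, restrict p R)) X"
    and nonneg: "\<And>w. f w \<ge> 0" "\<And>p. g p \<ge> 0"
  shows "(\<Sum>(w, p)\<in>X. f (restrict w F) * g (restrict p R))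
      \<le> (\<Sum>w\<in>PiE F (\<lambda>_. T). f w) * (\<Sum>p\<in>PiE R (\<lambda>_. S). g p)"
proof -
  have fin: "finite F" "finite R" using assms finite_subset by blast+
  have "(\<Sum>(w, p)\<in>X. f (restrict w F) * g (restrict p R))
      = (\<Sum>(w, p)\<in>(\<lambda>(w, p). (restrict w F, restrict p R)) ` X. f w * g p)"
    by (subst sum.reindex[OF inj]) (auto intro!: sum.cong)
  also have "\<dots> \<le> (\<Sum>(w, p)\<in>PiE F (\<lambda>_. T) \<times> PiE R (\<lambda>_. S). f w * g p)"
  proof (rule sum_mono2)
    show "(\<lambda>(w, p). (restrict w F, restrict p R)) ` X \<subseteq> PiE F (\<lambda>_. T) \<times> PiE R (\<lambda>_. S)"
      using X assms(4,5) by (force simp: PiE_iff)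
  qed (use assms nonneg fin in \<open>auto intro!: finite_PiE\<close>)
  also have "\<dots> = (\<Sum>w\<in>PiE F (\<lambda>_. T). f w) * (\<Sum>p\<in>PiE R (\<lambda>_. S). g p)"
    by (simp add: sum.cartesian_product[symmetric] sum_product)
  finally show ?thesis .
qed

text \<open>The bound for the phase integral when the largest base is attained at \<open>i\<close>;
  the parameter \<open>a\<close> will be A \<theta>. Summing over all \<open>i \<in> E\<close>
  avoids having to select one index in case of ties.\<close>

definition top_weight :: "real \<Rightarrow> real \<Rightarrow> 'i set \<Rightarrow> ('i \<Rightarrow> nat) \<Rightarrow> 'i \<Rightarrow> real" where
  "top_weight \<theta> a E p i = (if \<forall>j\<in>E. p j \<le> p i
     then real (p i) powr - a * (\<Prod>j\<in>E - {i}. gap_weight \<theta> (p i) (p j)) else 0)"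

lemma top_weight_nonneg: "\<theta> \<ge> 0 \<Longrightarrow> top_weight \<theta> a E p i \<ge> 0"
  unfolding top_weight_def
  by (auto intro!: prod_nonneg mult_nonneg_nonneg order_trans[OF zero_le_one gap_weight_ge_1])

text \<open>With z = p i fixed, every other index of \<open>E\<close> ranges over 1..z and its gap
  weight costs a constant on average, so it contributes order z. Indices outside \<open>E\<close>
  contribute N each. This leaves the sum over z of z^(card E - 1 - a).\<close>

lemma sum_top_weight_le:
  assumes "finite I" "E \<subseteq> I" "i \<in> E" "0 \<le> \<theta>" "\<theta> < 1"
  shows "(\<Sum>p\<in>PiE I (\<lambda>_. {1..N}). top_weight \<theta> a E p i)
     \<le> (1 + 1 / (1 - \<theta>)) ^ (card E - 1) * real N ^ (card I - card E)
         * (\<Sum>z=1..N. real z powr (real (card E) - 1 - a))"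
proof -
  define C where "C = 1 + 1 / (1 - \<theta>)"
  have C: "C \<ge> 0" using assms by (simp add: C_def)
  have finE: "finite E" using assms finite_subset by auto
  have iI: "i \<in> I" using assms by auto
  \<comment> \<open>Putting the maximality of \<open>z\<close> into each coordinate as
    \<open>b \<le> z\<close> makes the summand a product, so that the sum over tuples
    factorises.\<close>
  define H where "H = (\<lambda>z j b. if j = i then 1 else if j \<in> E then (if b
      \<le> z then gap_weight \<theta> z b else 0) else 1)"
  have Hnn: "H z j b \<ge> 0" for z j b using gap_weight_ge_1[of \<theta> z b] assms by (auto simp: H_def)
  have "(\<Sum>p\<in>PiE I ((\<lambda>_. {1..N})(i := {z})). top_weight \<theta> a E p i)
      \<le> C ^ (card E - 1) * real N ^ (card I - card E) * real z powr (real (card E) - 1 - a)"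
          if z: "z \<in> {1..N}" for z
  proof -
    have "(\<Sum>p\<in>PiE I ((\<lambda>_. {1..N})(i := {z})). top_weight \<theta> a E p i)
        \<le> (\<Sum>p\<in>PiE I ((\<lambda>_. {1..N})(i := {z})). real z powr - a * (\<Prod>j\<in>I. H z j (p j)))"
    proof (rule sum_mono)
      fix p assume "p \<in> PiE I ((\<lambda>_. {1..N})(i := {z}))"
      then have pi: "p i = z" using iI by (force simp: PiE_iff)
      show "top_weight \<theta> a E p i \<le> real z powr - a * (\<Prod>j\<in>I. H z j (p j))"
      proof (cases "\<forall>j\<in>E. p j \<le> p i")
        case True
        have "(\<Prod>j\<in>I. H z j (p j)) = (\<Prod>j\<in>E - {i}. gap_weight \<theta> (p i) (p j))"
        proof (rule prod.mono_neutral_cong_right)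
          show "\<forall>j\<in>I - (E - {i}). H z j (p j) = 1" by (auto simp: H_def)
        qed (use assms True pi in \<open>auto simp: H_def\<close>)
        then show ?thesis using True pi by (simp add: top_weight_def)
      next
        case False
        then show ?thesis using Hnn by (auto simp: top_weight_def intro!: mult_nonneg_nonneg prod_nonneg)
      qed
    qed
    also have "\<dots> = real z powr - a * (\<Prod>j\<in>I. \<Sum>b\<in>((\<lambda>_. {1..N})(i := {z})) j. H z j b)"
      using assms by (subst prod_sum_PiE) (auto simp: sum_distrib_left)
    also have "\<dots> \<le> real z powr - a * (\<Prod>j\<in>I. if j = i then 1 else if j \<in> E then C * real z else real N)"
    proof (intro mult_left_mono prod_mono)
      fix j assume "j \<in> I"
      have "(\<Sum>b\<in>((\<lambda>_. {1..N})(i := {z})) j. H z j b) \<le> (if j = i then 1 else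
          if j \<in> E then C * real z else real N)"
      proof (cases "j = i \<or> j \<notin> E")
        case True
        then show ?thesis using assms by (auto simp: H_def)
      next
        case False
        have "(\<Sum>b=1..N. if b \<le> z then gap_weight \<theta> z b else 0) = (\<Sum>b=1..z. gap_weight \<theta> z b)"
          using z by (intro sum.mono_neutral_cong_right) auto
        also have "\<dots> \<le> C * real z" unfolding C_def using sum_gap_weight_le[of \<theta> z] assms z by auto
        finally show ?thesis using False by (simp add: H_def)
      qed
      then show "0 \<le> (\<Sum>b\<in>((\<lambda>_. {1..N})(i := {z})) j. H z j b) \<and>
         (\<Sum>b\<in>((\<lambda>_. {1..N})(i := {z})) j. H z j b) \<le> (if j = i then 1 else
             if j \<in> E then C * real z else real N)"
        using Hnn by (auto intro!: sum_nonneg)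
    qed auto
    also have "(\<Prod>j\<in>I. if j = i then 1 else if j \<in> E then C * real z else real N)
        = (C * real z) ^ (card E - 1) * real N ^ (card I - card E)"
    proof -
      have "(\<Prod>j\<in>I. if j = i then 1 else if j \<in> E then C * real z else real N)
          = (\<Prod>j\<in>I - {i}. if j \<in> E then C * real z else real N)"
        by (rule prod.mono_neutral_cong_right) (use assms in auto)
      also have "\<dots> = (\<Prod>j\<in>E - {i}. C * real z) * (\<Prod>j\<in>I - E. real N)"
      proof -
        have "(I - {i}) \<inter> E = E - {i}" "(I - {i}) \<inter> - E = I - E" using assms by auto
        then show ?thesis using assms(1) by (subst prod.If_cases) (auto simp: Collect_mem_eq)
      qed
      finally show ?thesis using assms finE by (simp add: card_Diff_subset)
    qed
    also have "real z powr - a * ((C * real z) ^ (card E - 1) * real N ^ (card I - card E))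
       = C ^ (card E - 1) * real N ^ (card I - card E) * (real z ^ (card E - 1) * real z powr - a)"
      by (simp add: power_mult_distrib mult_ac)
    also have "real z ^ (card E - 1) * real z powr - a = real z powr (real (card E) - 1 - a)"
    proof -
      have "card E \<ge> 1" using assms finE by (simp add: Suc_le_eq card_gt_0_iff) auto
      then have "real z ^ (card E - 1) = real z powr (real (card E) - 1)"
        using z by (subst powr_realpow[symmetric]) (auto simp: of_nat_diff)
      then show ?thesis by (simp flip: powr_add)
    qed
    finally show ?thesis .
  qed
  then show ?thesis
    unfolding C_def[symmetric] using iI assms(1)
    by (subst sum_PiE_split[where j = i]) (auto simp: sum_distrib_left intro!: sum_mono)
qed

lemma sum_prod_int_weight_le:
  assumes "finite F" "finite T" "N \<ge> 1"
  shows "(\<Sum>w\<in>PiE F (\<lambda>_. T). \<Prod>i\<in>F. int_weight N (w i)) \<le> (3 * N) ^ card F"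
proof -
  have "(\<Sum>w\<in>PiE F (\<lambda>_. T). \<Prod>i\<in>F. int_weight N (w i)) = (\<Prod>i\<in>F. \<Sum>t\<in>T. int_weight N t)"
    using assms by (subst prod_sum_PiE) auto
  also have "\<dots> \<le> (\<Prod>i\<in>F. 3 * N)"
    using assms by (intro prod_mono conjI sum_nonneg sum_int_weight_le int_weight_bounds) auto
  finally show ?thesis by simp
qed

text \<open>For fixed w j = s the linear form is w i shifted by \<open>e * s\<close>, and the bound
  for shifted sums does not see the shift. Only the coordinate \<open>i\<close> gains N^(-\<theta>);
  the others give 3N each.\<close>

lemma sum_prod_int_weight_linear_le:
  assumes "finite F" "finite T" "N \<ge> 1" "i \<in> F" "j \<in> F" "i \<noteq> j" "0 \<le> \<theta>" "\<theta> < 1"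
  shows "(\<Sum>w\<in>PiE F (\<lambda>_. T). (\<Prod>l\<in>F. int_weight (real N) (w l)) * \<bar>real_of_int (w i + e * w j)\<bar> powr - \<theta>)
           \<le> (3 + 2 / (1 - \<theta>)) * real N powr (1 - \<theta>) * (3 * real N) ^ (card F - 1)"
proof -
  let ?w = "int_weight (real N)"
  define D where "D = (3 + 2 / (1 - \<theta>)) * real N powr (1 - \<theta>)"
  have D: "D \<ge> 0" unfolding D_def using assms by auto
  note wb = int_weight_bounds[of "real N"]
  define S where "S = (\<Sum>t\<in>T. ?w t)"
  have S: "0 \<le> S" "S \<le> 3 * real N" unfolding S_def using assms wb sum_int_weight_le[of "real N" T]
      by (auto intro!: sum_nonneg)
  have "(\<Sum>w\<in>PiE F ((\<lambda>_. T)(j := {s})). (\<Prod>l\<in>F. ?w (w l)) * \<bar>real_of_int (w i + e * w j)\<bar> powr - \<theta>)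
      \<le> ?w s * (D * S ^ (card F - 2))" for s
  proof -
    define H where "H = (\<lambda>l t. ?w t * (if l = i then \<bar>real_of_int (t + e * s)\<bar> powr - \<theta> else 1))"
    have Hnn: "H l t \<ge> 0" for l t unfolding H_def using wb assms by auto
    have "(\<Sum>w\<in>PiE F ((\<lambda>_. T)(j := {s})). (\<Prod>l\<in>F. ?w (w l)) * \<bar>real_of_int (w i + e * w j)\<bar> powr - \<theta>)
       = (\<Sum>w\<in>PiE F ((\<lambda>_. T)(j := {s})). \<Prod>l\<in>F. H l (w l))"
    proof (rule sum.cong[OF refl])
      fix w assume "w \<in> PiE F ((\<lambda>_. T)(j := {s}))"
      then have "w j = s" using assms by (force simp: PiE_iff)
      then show "(\<Prod>l\<in>F. ?w (w l)) * \<bar>real_of_int (w i + e * w j)\<bar> powr - \<theta> = (\<Prod>l\<in>F. H l (w l))"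
        unfolding H_def prod.distrib using assms by (simp add: prod.delta)
    qed
    also have "\<dots> = (\<Prod>l\<in>F. \<Sum>t\<in>((\<lambda>_. T)(j := {s})) l. H l t)"
      using assms by (subst prod_sum_PiE) auto
    also have "\<dots> \<le> (\<Prod>l\<in>F. if l = j then ?w s else if l = i then D else S)"
    proof (rule prod_mono)
      fix l assume "l \<in> F"
      have "(\<Sum>t\<in>T. H i t) \<le> D" unfolding H_def D_def
          using sum_int_weight_shifted_le[of N T \<theta> "e * s"] assms by auto
      then show "0 \<le> (\<Sum>t\<in>((\<lambda>_. T)(j := {s})) l. H l t) \<and> (\<Sum>t\<in>((\<lambda>_. T)(j := {s})) l. H l t) \<le> (if l
          = j then ?w s else if l = i then D else S)"
        using Hnn wb(1)[of s] assms by (auto intro!: sum_nonneg) (auto simp: H_def S_def)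
    qed
    also have "\<dots> = ?w s * (\<Prod>l\<in>F - {j}. if l = i then D else S)"
      using assms by (subst prod.remove[of F j]) (auto intro!: prod.cong)
    also have "(\<Prod>l\<in>F - {j}. if l = i then D else S) = D * (\<Prod>l\<in>F - {j} - {i}. if l = i then D else S)"
      using assms by (subst prod.remove[of "F - {j}" i]) auto
    also have "(\<Prod>l\<in>F - {j} - {i}. if l = i then D else S) = (\<Prod>l\<in>F - {j} - {i}. S)"
      by (intro prod.cong) auto
    also have "\<dots> = S ^ (card F - 2)" using assms by (simp add: card_Diff_singleton numeral_2_eq_2)
    finally show ?thesis .
  qed
  then have "(\<Sum>w\<in>PiE F (\<lambda>_. T). (\<Prod>l\<in>F. ?w (w l)) * \<bar>real_of_int (w i + e * w j)\<bar> powr - \<theta>)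
      \<le> S * (D * S ^ (card F - 2))"
    using assms by (subst sum_PiE_split[where j = j]) (auto simp: S_def sum_distrib_right intro!:
        sum_mono)
  also have "\<dots> = D * S ^ (card F - 1)"
  proof -
    have "card {i, j} \<le> card F" using assms by (intro card_mono) auto
    then have "card F - 1 = Suc (card F - 2)" using assms by simp
    then show ?thesis by simp
  qed
  also have "\<dots> \<le> D * (3 * real N) ^ (card F - 1)" using D S by (intro mult_left_mono power_mono) auto
  finally show ?thesis by (simp add: D_def)
qed

section \<open>Counting cancellation patterns\<close>

definition net_coeff :: "'i set \<Rightarrow> ('i \<Rightarrow> int) \<Rightarrow> ('i \<Rightarrow> nat) \<Rightarrow> nat \<Rightarrow> int" where
  "net_coeff I w p z = (\<Sum>i\<in>{i \<in> I. p i = z}. w i)"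

definition active :: "'i set \<Rightarrow> ('i \<Rightarrow> int) \<Rightarrow> ('i \<Rightarrow> nat) \<Rightarrow> 'i set" where
  "active I w p = {i \<in> I. net_coeff I w p (p i) \<noteq> 0}"

definition phase_integral :: "real \<Rightarrow> 'i set \<Rightarrow> ('i \<Rightarrow> int) \<Rightarrow> ('i \<Rightarrow> nat) \<Rightarrow> real" where
  "phase_integral A I w p =
     norm (integral {A..A + 1} (\<lambda>\<alpha>. cis (2 * pi * (\<Sum>i\<in>I. of_int (w i) * real (p i) powr \<alpha>))))"

lemma phase_integral_bounds:
  assumes "\<forall>i\<in>I. p i \<ge> 1"
  shows "0 \<le> phase_integral A I w p" "phase_integral A I w p \<le> 1"
proof -
  have "phase_integral A I w p \<le> 1 * (A + 1 - A)" unfolding phase_integral_def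
    by (rule integral_bound) (use assms in \<open>auto intro!: continuous_intros simp: Suc_le_eq\<close>)
  then show "phase_integral A I w p \<le> 1" by simp
qed (simp add: phase_integral_def)

text \<open>Several indices may carry the same base. With factors at least 1, counting a factor once
  per index instead of once per base only enlarges the product.\<close>

lemma prod_image_le_prod:
  fixes f :: "'b \<Rightarrow> real"
  assumes "finite S" "\<And>z. f z \<ge> 1"
  shows "(\<Prod>z\<in>g ` S. f z) \<le> (\<Prod>j\<in>S. f (g j))"
  using assms(1)
proof (induction S rule: finite_induct)
  case (insert x S)
  have nn: "0 \<le> f z" for z using assms(2)[of z] by linarith
  have "(\<Prod>z\<in>g ` insert x S. f z) \<le> f (g x) * (\<Prod>z\<in>g ` S. f z)"
  proof (cases "g x \<in> g ` S")
    case True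
    then have "g ` insert x S = g ` S" by auto
    moreover have "1 * (\<Prod>z\<in>g ` S. f z) \<le> f (g x) * (\<Prod>z\<in>g ` S. f z)"
      using assms(2) nn by (intro mult_right_mono prod_nonneg) auto
    ultimately show ?thesis by simp
  qed (use insert in simp)
  also have "\<dots> \<le> f (g x) * (\<Prod>j\<in>S. f (g j))" using insert nn by (intro mult_left_mono) auto
  finally show ?case using insert by simp
qed simp

text \<open>The exponent -1/(card V + 1) depends on the number of distinct surviving bases and is
  weakened to the uniform -\<theta>. The sum over \<open>i\<close> contains an index at which the
  largest surviving base is attained, whichever it is. The constant 8 is 4 times the bound 2 for (ln
  2)^(-\<theta>).\<close>

lemma phase_integral_le_top_weight:
  fixes I :: "'i set" and A :: real
  assumes fin: "finite I" and p1: "\<forall>i\<in>I. p i \<ge> 1" and sum0: "(\<Sum>i\<in>I. w i) = 0"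
    and ne: "active I w p \<noteq> {}"
  defines "\<theta> \<equiv> 1 / real (card I)"
  shows "phase_integral A I w p \<le> 8 * 6 ^ card I *
     (\<Sum>i\<in>active I w p. \<bar>real_of_int (net_coeff I w p (p i))\<bar> powr - \<theta> * top_weight \<theta> (A
         * \<theta>) (active I w p) p i)"
proof -
  define E where "E = active I w p"
  define H where "H = net_coeff I w p"
  have E: "E \<subseteq> I" "finite E" "E \<noteq> {}" using fin ne by (auto simp: E_def active_def)
  have HE: "i \<in> E \<longleftrightarrow> i \<in> I \<and> H (p i) \<noteq> 0" for i by (simp add: E_def active_def H_def)
  define L where "L = Max (p ` E)"
  define V where "V = p ` E - {L}"
  have L: "L \<in> p ` E" "\<forall>j\<in>E. p j \<le> L" using E by (auto simp: L_def)
  have V: "finite V" "insert L V = p ` E" "L \<notin> V" using L E by (auto simp: V_def)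
  have Vlt: "\<forall>z\<in>V. 1 \<le> z \<and> z < L" using p1 L E by (fastforce simp: V_def)
  have sumH: "(\<Sum>i\<in>I. of_int (w i) * g (p i)) = (\<Sum>z\<in>p ` E. of_int (H z) * g z)" for g :: "nat \<Rightarrow> real"
  proof -
    have "(\<Sum>i\<in>I. of_int (w i) * g (p i)) = (\<Sum>z\<in>p ` I. \<Sum>i\<in>{i \<in> I. p i = z}. of_int (w i) * g (p i))"
      using fin by (rule sum.image_gen)
    also have "\<dots> = (\<Sum>z\<in>p ` I. of_int (H z) * g z)"
      by (intro sum.cong) (auto simp: H_def net_coeff_def sum_distrib_right)
    also have "\<dots> = (\<Sum>z\<in>p ` E. of_int (H z) * g z)"
      using fin E HE by (intro sum.mono_neutral_right) auto
    finally show ?thesis .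
  qed
  have L1: "L \<ge> 1" using L p1 E by auto
  \<comment> \<open>If 1 were the largest surviving base it would be the only one, and its
    coefficient would be the total sum of \<open>w\<close>, which is zero.\<close>
  have "L \<noteq> 1"
  proof
    assume "L = 1"
    then have "p ` E = {1}" using L Vlt V by fastforce
    moreover have "(\<Sum>z\<in>p ` E. real_of_int (H z)) = 0"
      using sumH[of "\<lambda>_. 1"] sum0 by (simp flip: of_int_sum)
    ultimately have "H 1 = 0" by simp
    then show False using HE L \<open>L = 1\<close> by auto
  qed
  then have L2: "L \<ge> 2" using L1 by simp
  have HL: "H L \<noteq> 0" using L HE by auto
  have cardI: "card I \<ge> 1" using E fin by (metis One_nat_def Suc_leI card_gt_0_iff subset_empty)
  have cardV: "card V + 1 \<le> card I"
  proof -
    have "card V + 1 = card (p ` E)" using V by (metis card_insert_disjoint Suc_eq_plus1)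
    also have "\<dots> \<le> card I" using card_image_le[of E p] card_mono[of I E] E fin by simp
    finally show ?thesis .
  qed
  have \<theta>: "\<theta> > 0" "\<theta> \<le> 1" using cardI by (auto simp: \<theta>_def)
  define \<Lambda> where "\<Lambda> = \<bar>real_of_int (H L)\<bar> * ln 2 * real L powr A * (\<Prod>z\<in>V. 1 - real z / real L)"
  have \<Lambda>: "\<Lambda> > 0" unfolding \<Lambda>_def using HL L2 Vlt by (auto intro!: mult_pos_pos prod_pos)
  have J1: "phase_integral A I w p \<le> 4 * 6 ^ card I * \<Lambda> powr (- 1 / real (card V + 1))"
  proof -
    have "phase_integral A I w p \<le> 4 * 6 ^ (card V + 1) * \<Lambda> powr (- 1 / real (card V + 1))"
      unfolding phase_integral_def sumH[of "\<lambda>z. real z powr _"] V(2)[symmetric] \<Lambda>_def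
      by (rule power_phase_integral_bound) (use V Vlt L2 HL in auto)
    also have "\<dots> \<le> 4 * 6 ^ card I * \<Lambda> powr (- 1 / real (card V + 1))"
      using cardV by (intro mult_right_mono mult_left_mono power_increasing) auto
    finally show ?thesis .
  qed
  \<comment> \<open>For \<Lambda> \<ge> 1 the exponent closer to zero is the weaker one; for
    \<Lambda> < 1 the power is at least 1 and the trivial bound for the integral suffices.\<close>
  have J: "phase_integral A I w p \<le> 4 * 6 ^ card I * \<Lambda> powr - \<theta>"
  proof (cases "\<Lambda> \<ge> 1")
    case True
    have "\<Lambda> powr (- 1 / real (card V + 1)) \<le> \<Lambda> powr - \<theta>"
      using True cardV by (intro powr_mono) (auto simp: \<theta>_def field_simps)
    then show ?thesis using J1 by (smt (verit) mult_left_mono zero_le_power zero_le_mult_iff)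
  next
    case False
    have "phase_integral A I w p \<le> 1 * 1" using phase_integral_bounds[OF p1] by simp
    also have "\<dots> \<le> 4 * 6 ^ card I * \<Lambda> powr - \<theta>"
    proof (rule mult_mono)
      have "(1::real) \<le> 6 ^ card I" by (rule one_le_power) simp
      then show "(1::real) \<le> 4 * 6 ^ card I" by linarith
      have "1 powr - \<theta> \<le> \<Lambda> powr - \<theta>" using False \<Lambda> \<theta> by (intro powr_mono2') auto
      then show "1 \<le> \<Lambda> powr - \<theta>" by simp
    qed auto
    finally show ?thesis .
  qed
  obtain i where i: "i \<in> E" "p i = L" using L by auto
  have gap: "(\<Prod>z\<in>V. 1 - real z / real L) powr - \<theta> \<le> (\<Prod>j\<in>E - {i}. gap_weight \<theta> (p i) (p j))"
  proof -
    have "(\<Prod>z\<in>V. 1 - real z / real L) powr - \<theta> = (\<Prod>z\<in>V. gap_weight \<theta> L z)"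
      using Vlt by (subst prod_powr_distrib) (auto simp: gap_weight_def)
    also have "\<dots> \<le> (\<Prod>z\<in>p ` (E - {i}). gap_weight \<theta> L z)"
      using E V i \<theta> order_trans[OF zero_le_one gap_weight_ge_1]
      by (intro prod_mono2 gap_weight_ge_1) (auto simp: V_def)
    also have "\<dots> \<le> (\<Prod>j\<in>E - {i}. gap_weight \<theta> L (p j))"
      using E \<theta> by (intro prod_image_le_prod gap_weight_ge_1) auto
    finally show ?thesis using i by simp
  qed
  have ln2: "ln 2 powr - \<theta> \<le> (2 :: real)"
  proof -
    have l: "1 / 2 \<le> ln (2::real)" using ln_le_minus_one[of "1 / 2 :: real"] by (simp add: ln_div)
    have "ln 2 powr - \<theta> \<le> (1 / 2 :: real) powr - \<theta>" using l \<theta> by (intro powr_mono2') auto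
    also have "\<dots> = 2 powr \<theta>" by (simp add: powr_divide powr_minus)
    also have "\<dots> \<le> 2 powr 1" using \<theta> by (intro powr_mono) auto
    finally show ?thesis by simp
  qed
  have "\<Lambda> powr - \<theta> = \<bar>real_of_int (H L)\<bar> powr - \<theta> * ln 2 powr - \<theta> * real L powr - (A * \<theta>) * (\<Prod>z\<in>V. 1
      - real z / real L) powr - \<theta>"
    unfolding \<Lambda>_def using Vlt L2 by (simp add: powr_mult powr_powr prod_nonneg)
  also have "\<dots> \<le> \<bar>real_of_int (H L)\<bar> powr - \<theta> * 2 * real L powr - (A * \<theta>) * (\<Prod>j\<in>E
      - {i}. gap_weight \<theta> (p i) (p j))"
    using gap ln2 by (intro mult_mono mult_nonneg_nonneg) auto
  also have "\<dots> = 2 * (\<bar>real_of_int (H (p i))\<bar> powr - \<theta> * top_weight \<theta> (A * \<theta>) E p i)"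
    using i L by (simp add: top_weight_def)
  also have "\<dots> \<le> 2 * (\<Sum>i\<in>E. \<bar>real_of_int (H (p i))\<bar> powr - \<theta> * top_weight \<theta> (A * \<theta>) E p i)"
    using i E \<theta> by (intro mult_left_mono member_le_sum[of i]) (auto intro!: mult_nonneg_nonneg
        top_weight_nonneg)
  finally have "4 * 6 ^ card I * \<Lambda> powr - \<theta> \<le> 4 * 6 ^ card I * (2
      * (\<Sum>i\<in>E. \<bar>real_of_int (H (p i))\<bar> powr - \<theta> * top_weight \<theta> (A * \<theta>) E p i))"
    by (intro mult_left_mono) auto
  note order_trans[OF J this]
  also have "4 * 6 ^ card I * (2 * S) = 8 * 6 ^ card I * S" for S :: real by simp
  finally show ?thesis by (simp only: E_def H_def)
qed

lemma top_weight_restrict: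
  assumes "E \<subseteq> R" "i \<in> E"
  shows "top_weight \<theta> a E (restrict p R) i = top_weight \<theta> a E p i"
proof -
  have "restrict p R j = p j" if "j \<in> E" for j using that assms by auto
  then have "(\<Prod>j\<in>E - {i}. gap_weight \<theta> (p i) (restrict p R j)) = (\<Prod>j\<in>E - {i}. gap_weight \<theta> (p i) (p j))"
    "(\<forall>j\<in>E. restrict p R j \<le> p i) \<longleftrightarrow> (\<forall>j\<in>E. p j \<le> p i)" "restrict p R i = p i"
    using assms(2) by (auto intro!: prod.cong)
  then show ?thesis by (simp only: top_weight_def)
qed

text \<open>The abstract shape of a term of the expanded square: \<open>hlf\<close> separates the
  two factors, each having coefficients of sum zero and distinct bases. The last clause says that
  the frequency vector of the factor \<open>\<not> hlf\<close> is nonzero.\<close>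

definition tuple_pairs :: "'i set \<Rightarrow> ('i \<Rightarrow> bool) \<Rightarrow> int set \<Rightarrow> nat \<Rightarrow> (('i \<Rightarrow> int) \<times> ('i \<Rightarrow> nat)) set" where
  "tuple_pairs I hlf T N = {(w, p). w \<in> I \<rightarrow>\<^sub>E T \<and> p \<in> I \<rightarrow>\<^sub>E {1..N} \<and>
     (\<forall>b. (\<Sum>i\<in>{i \<in> I. hlf i = b}. w i) = 0 \<and> inj_on p {i \<in> I. hlf i = b}) \<and> (\<exists>i\<in>I. \<not> hlf i \<and> w i \<noteq> 0)}"

text \<open>A base occurs at most once in each half, so a nonzero coefficient can only cancel
  against one index of the other half. Such a pair is recorded once, at its member in the half
  \<open>hlf\<close>.\<close>

definition paired :: "'i set \<Rightarrow> ('i \<Rightarrow> bool) \<Rightarrow> ('i \<Rightarrow> int) \<Rightarrow> ('i \<Rightarrow> nat) \<Rightarrow> 'i set" where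
  "paired I hlf w p = {i \<in> I - active I w p. hlf i \<and> (\<exists>j\<in>I. \<not> hlf j \<and> p j = p i)}"

text \<open>Extended by the identity on the rest of \<open>I\<close>, so that it maps
  \<open>I\<close> to \<open>I\<close> and only finitely many such maps can arise.\<close>

definition partner :: "'i set \<Rightarrow> ('i \<Rightarrow> bool) \<Rightarrow> ('i \<Rightarrow> int) \<Rightarrow> ('i \<Rightarrow> nat) \<Rightarrow> 'i \<Rightarrow> 'i" where
  "partner I hlf w p =
     (\<lambda>i\<in>I. if i \<in> paired I hlf w p then SOME j. j \<in> I \<and> \<not> hlf j \<and> p j = p i else i)"

section \<open>Structure of cancelling indices\<close>

context
  fixes I :: "'i set" and hlf :: "'i \<Rightarrow> bool" and T :: "int set" and N :: nat
    and w :: "'i \<Rightarrow> int" and p :: "'i \<Rightarrow> nat"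
  assumes fin: "finite I" and mem: "(w, p) \<in> tuple_pairs I hlf T N"
begin

lemma net_coeff_single:
  assumes "i \<in> I" "\<And>j. j \<in> I \<Longrightarrow> p j = p i \<Longrightarrow> j = i"
  shows "net_coeff I w p (p i) = w i"
proof -
  have "{j \<in> I. p j = p i} = {i}" using assms by auto
  then show ?thesis by (simp add: net_coeff_def)
qed

lemma same_half_inj:
  assumes "i \<in> I" "j \<in> I" "hlf i = hlf j" "p i = p j"
  shows "i = j"
  using mem assms by (auto simp: tuple_pairs_def inj_on_def)

lemma net_coeff_double:
  assumes "i \<in> I" "j \<in> I" "hlf i \<noteq> hlf j" "p i = p j"
  shows "net_coeff I w p (p i) = w i + w j"
proof -
  have "l = i \<or> l = j" if "l \<in> I" "p l = p i" for l
    using same_half_inj[of l i] same_half_inj[of l j] that assms by auto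
  then have "{l \<in> I. p l = p i} = {i, j}" using assms by auto
  moreover have "i \<noteq> j" using assms by auto
  ultimately show ?thesis by (simp add: net_coeff_def)
qed

lemma partner_props:
  assumes "i \<in> paired I hlf w p"
  shows "partner I hlf w p i \<in> I - active I w p" "\<not> hlf (partner I hlf w p i)"
    "p (partner I hlf w p i) = p i" "w (partner I hlf w p i) = - w i"
proof -
  have i: "i \<in> I" "hlf i" "net_coeff I w p (p i) = 0" "\<exists>j. j \<in> I \<and> \<not> hlf j \<and> p j = p i"
    using assms by (auto simp: paired_def active_def)
  define j where "j = partner I hlf w p i"
  have "j = (SOME j. j \<in> I \<and> \<not> hlf j \<and> p j = p i)" using i assms by (simp add: j_def partner_def)
  then have j: "j \<in> I" "\<not> hlf j" "p j = p i" using someI_ex[OF i(4)] by auto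
  then show "partner I hlf w p i \<in> I - active I w p" "\<not> hlf (partner I hlf w p i)"
    "p (partner I hlf w p i) = p i" "w (partner I hlf w p i) = - w i"
    using net_coeff_double[of i j] i unfolding j_def[symmetric] by (auto simp: active_def)
qed

text \<open>A coefficient alone on its base is the net coefficient, so a nonzero one that vanishes
  in the net needs an index of the other half with the same base. As \<open>i\<close> itself is not
  recorded in \<open>paired\<close>, that index is, and \<open>i\<close> is its partner.\<close>

lemma inactive_unpaired:
  assumes "i \<in> I" "i \<notin> active I w p" "i \<notin> paired I hlf w p" "w i \<noteq> 0"
  shows "\<exists>i'\<in>paired I hlf w p. partner I hlf w p i' = i"
proof -
  have z: "net_coeff I w p (p i) = 0" using assms by (simp add: active_def)
  obtain j where j: "j \<in> I" "p j = p i" "j \<noteq> i" using net_coeff_single[of i] assms z by metis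
  then have h: "hlf j \<noteq> hlf i" using same_half_inj[of j i] assms by auto
  have "\<not> hlf i" using assms j h by (auto simp: paired_def)
  then have jp: "j \<in> paired I hlf w p" using j h assms z
      by (auto simp: paired_def active_def intro!: bexI[of _ i])
  have "partner I hlf w p j = i"
    using partner_props[OF jp] \<open>\<not> hlf i\<close> j assms by (intro same_half_inj) auto
  then show ?thesis using jp by auto
qed

text \<open>At most two indices share a base, so the net coefficient is \<open>w i\<close> or
  \<open>w i + w j\<close> with \<open>j\<close> in the other half. Summing over all possibilities
  makes the right side independent of \<open>p\<close>, so that coefficients and bases can be summed
  separately.\<close>

lemma net_coeff_powr_le:
  assumes "i \<in> I" "\<exists>j\<in>I. hlf j \<noteq> hlf i"
  shows "\<bar>real_of_int (net_coeff I w p (p i))\<bar> powr - \<theta>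
    \<le> (\<Sum>j\<in>{j \<in> I. hlf j \<noteq> hlf i}. \<Sum>e\<in>{0, 1 :: int}. \<bar>real_of_int (w i + e * w j)\<bar> powr - \<theta>)"
proof -
  have "\<exists>j\<in>{j \<in> I. hlf j \<noteq> hlf i}. \<exists>e\<in>{0, 1 :: int}. net_coeff I w p (p i) = w i + e * w j"
  proof (cases "\<exists>j\<in>I. p j = p i \<and> j \<noteq> i")
    case True
    then obtain j where j: "j \<in> I" "p j = p i" "j \<noteq> i" by auto
    then have h: "hlf i \<noteq> hlf j" using same_half_inj[of j i] assms by auto
    then show ?thesis using net_coeff_double[of i j] assms j by (auto intro!: bexI[of _ j])
  next
    case False
    then have "net_coeff I w p (p i) = w i" using net_coeff_single assms by metis
    then show ?thesis using assms by auto
  qed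
  then obtain j e where je: "j \<in> {j \<in> I. hlf j \<noteq> hlf i}" "e \<in> {0, 1 :: int}"
    "net_coeff I w p (p i) = w i + e * w j" by blast
  have "\<bar>real_of_int (w i + e * w j)\<bar> powr - \<theta> \<le> (\<Sum>e\<in>{0, 1 :: int}. \<bar>real_of_int (w i + e
      * w j)\<bar> powr - \<theta>)"
    using je(2) by (intro member_le_sum[of e]) auto
  also have "\<dots> \<le> (\<Sum>j\<in>{j \<in> I. hlf j \<noteq> hlf i}. \<Sum>e\<in>{0, 1 :: int}. \<bar>real_of_int (w i + e * w j)\<bar> powr - \<theta>)"
    using je(1) fin by (intro member_le_sum[of j "{j \<in> I. hlf j \<noteq> hlf i}" "\<lambda>j. \<Sum>e\<in>{0, 1 :: int}.
        \<bar>real_of_int (w i + e * w j)\<bar> powr - \<theta>"]) (auto intro!: sum_nonneg)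
  finally show ?thesis using je(3) by simp
qed

end

text \<open>With \<open>E\<close>, \<open>M\<close> and \<open>\<tau>\<close> fixed, the
  cancellations become linear relations common to the whole class, and one choice of free
  coordinates serves all its members.\<close>

definition pattern_class where
  "pattern_class I hlf T N E M \<tau> = {(w, p) \<in> tuple_pairs I hlf T N.
     active I w p = E \<and> paired I hlf w p = M \<and> partner I hlf w p = \<tau>}"

text \<open>A coefficient outside \<open>E\<close> and \<open>M\<close> is zero or minus the
  coefficient of its partner in \<open>M\<close>; a base with index in \<open>M\<close> equals the
  base at its partner, which lies in the other half and hence outside \<open>M\<close>. A cancelling
  pair thus accounts for one coefficient and one base instead of two of each.\<close>

lemma pattern_class_inj:
  assumes fin: "finite I" and "F \<subseteq> E \<union> M"
    and det: "\<And>w p w' p'. (w, p) \<in> pattern_class I hlf T N E M \<tau>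
        \<Longrightarrow> (w', p') \<in> pattern_class I hlf T N E M \<tau> \<Longrightarrow>
      (\<And>i. i \<in> F \<Longrightarrow> w i = w' i) \<Longrightarrow> (\<And>i. i \<in> E \<union> M \<Longrightarrow> w i = w' i)"
  shows "inj_on (\<lambda>(w, p). (restrict w F, restrict p (I - M))) (pattern_class I hlf T N E M \<tau>)"
proof (rule inj_onI, clarify)
  fix w p w' p'
  assume c: "(w, p) \<in> pattern_class I hlf T N E M \<tau>" "(w', p') \<in> pattern_class I hlf T N E M \<tau>"
    and eqF: "restrict w F = restrict w' F" and eqp: "restrict p (I - M) = restrict p' (I - M)"
  have m: "(w, p) \<in> tuple_pairs I hlf T N" "(w', p') \<in> tuple_pairs I hlf T N"
    and E: "active I w p = E" "active I w' p' = E" and M: "paired I hlf w p = M" "paired I hlf w' p' = M"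
    and \<tau>: "partner I hlf w p = \<tau>" "partner I hlf w' p' = \<tau>" using c by (auto simp: pattern_class_def)
  note P = partner_props[OF fin m(1), unfolded M \<tau> E] and P' = partner_props[OF fin m(2), unfolded M \<tau> E]
  have wEM: "w i = w' i" if "i \<in> E \<union> M" for i
    using det[OF c _ that] eqF by (metis restrict_apply')
  have "w i = w' i" if "i \<in> I" for i
  proof (cases "i \<in> E \<union> M")
    case False
    show ?thesis
    proof (cases "\<exists>i'\<in>M. \<tau> i' = i")
      case True
      then show ?thesis using P P' wEM by force
    next
      case F: False
      have "w i = 0" "w' i = 0"
        using inactive_unpaired[OF fin m(1), of i] inactive_unpaired[OF fin m(2), of i] that False F
        unfolding M \<tau> E by blast+
      then show ?thesis by simp
    qed
  qed (use wEM in auto)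
  moreover have "p i = p' i" if "i \<in> I" for i
  proof -
    have *: "p j = p' j" if "j \<in> I - M" for j using eqp that by (metis restrict_apply')
    show ?thesis
    proof (cases "i \<in> M")
      case True
      have "\<tau> i \<notin> M" using P(2)[OF True] M(1) by (auto simp: paired_def)
      then show ?thesis using P[OF True] P'[OF True] *[of "\<tau> i"] by auto
    qed (use * that in auto)
  qed
  moreover have "w \<in> extensional I" "w' \<in> extensional I" "p \<in> extensional I" "p' \<in> extensional I"
    using m by (auto simp: tuple_pairs_def PiE_iff)
  ultimately show "w = w' \<and> p = p'" by (auto intro!: extensionalityI)
qed

lemma sum_agree_except_one:
  fixes f g :: "'i \<Rightarrow> int"
  assumes "finite S" "q \<in> S" "sum f S = sum g S" "\<And>i. i \<in> S \<Longrightarrow> i \<noteq> q \<Longrightarrow> f i = g i"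
  shows "f q = g q"
proof -
  have "sum f (S - {q}) = sum g (S - {q})" using assms by (intro sum.cong) auto
  then show ?thesis using assms by (simp add: sum.remove[of S q])
qed

lemma tuple_pairs_sum: "(w, p) \<in> tuple_pairs I hlf T N \<Longrightarrow> (\<Sum>i\<in>{i \<in> I. hlf i = b}. w i) = 0"
  by (simp add: tuple_pairs_def)

lemma tuple_pairs_sum_all:
  assumes "finite I" "(w, p) \<in> tuple_pairs I hlf T N"
  shows "(\<Sum>i\<in>I. w i) = 0"
proof -
  have "(\<Sum>i\<in>I. w i) = (\<Sum>i\<in>{i \<in> I. hlf i = True}. w i) + (\<Sum>i\<in>{i \<in> I. hlf i = False}. w i)"
    using assms(1) by (subst sum.union_disjoint[symmetric]) (auto intro!: sum.cong)
  then show ?thesis by (simp only: tuple_pairs_sum[OF assms(2)])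
qed

text \<open>With at least two inactive indices, one linear constraint is enough.\<close>

lemma pattern_class_few_active:
  assumes fin: "finite I" and ne: "pattern_class I hlf T N E M \<tau> \<noteq> {}"
  shows "\<exists>F\<subseteq>E \<union> M. card F + 1 = card E + card M \<and>
    inj_on (\<lambda>(w, p). (restrict w F, restrict p (I - M))) (pattern_class I hlf T N E M \<tau>)"
proof -
  define X where "X = pattern_class I hlf T N E M \<tau>"
  have facts: "(w, p) \<in> tuple_pairs I hlf T N" "active I w p = E" "paired I hlf w p
      = M" "partner I hlf w p = \<tau>"
    if "(w, p) \<in> X" for w p using that by (auto simp: X_def pattern_class_def)
  have off: "w i = 0 \<or> (\<exists>i'\<in>M. \<tau> i' = i)" if "(w, p) \<in> X" "i \<in> I" "i \<notin> E" "\<not> hlf i" for w p i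
    using inactive_unpaired[OF fin facts(1)[OF that(1)], of i] facts[OF that(1)] that
        by (auto simp: paired_def)
  have neg: "w (\<tau> i) = - w i" "\<not> hlf (\<tau> i)" "\<tau> i \<in> I" if "(w, p) \<in> X" "i \<in> M" for w p i
    using partner_props[OF fin facts(1)[OF that(1)], of i] facts[OF that(1)] that by auto
  have sum0: "(\<Sum>i\<in>{i \<in> I. \<not> hlf i}. w i) = 0" if "(w, p) \<in> X" for w p
    using tuple_pairs_sum[OF facts(1)[OF that], of False] by simp
  obtain w0 p0 where X0: "(w0, p0) \<in> X" using ne by (auto simp: X_def)
  have sub: "E \<subseteq> I" "M \<subseteq> I" "E \<inter> M = {}" using facts[OF X0] by (auto simp: active_def paired_def)
  have finEM: "finite E" "finite M" using sub fin by (auto intro: finite_subset)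
  have agree: "w i = w' i" if "(w, p) \<in> X" "(w', p') \<in> X" "i \<in> I" "i \<notin> E" "\<not> hlf i"
    "\<And>i'. i' \<in> M \<Longrightarrow> \<tau> i' = i \<Longrightarrow> w i' = w' i'" for w p w' p' i
  proof (cases "\<exists>i'\<in>M. \<tau> i' = i")
    case True
    then obtain i' where i': "i' \<in> M" "i = \<tau> i'" by auto
    show ?thesis using neg(1)[OF that(1) i'(1)] neg(1)[OF that(2) i'(1)] that(6)[of i'] i' by simp
  next
    case False
    then show ?thesis using off[OF that(1,3-5)] off[OF that(2,3-5)] by simp
  qed
  \<comment> \<open>The coordinate \<open>q\<close> is eliminated by the sum over the half
    \<open>\<not> hlf\<close>. If that half has an active index, the sum is solved for it
    directly.\<close>
  have "\<exists>q\<in>E \<union> M. \<forall>w p w' p'. (w, p) \<in> X \<longrightarrow> (w', p') \<in> X \<longrightarrow> (\<forall>i\<in>E \<union> M - {q}. w i = w' i) \<longrightarrow> w q = w' q"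
  proof (cases "\<exists>q\<in>E. \<not> hlf q")
    case True
    then obtain q where q: "q \<in> E" "\<not> hlf q" by auto
    show ?thesis
    proof (intro bexI[of _ q] allI impI)
      fix w p w' p' assume X: "(w, p) \<in> X" "(w', p') \<in> X" and eq: "\<forall>i\<in>E \<union> M - {q}. w i = w' i"
      show "w q = w' q"
      proof (rule sum_agree_except_one[of "{i \<in> I. \<not> hlf i}"])
        fix i assume i: "i \<in> {i \<in> I. \<not> hlf i}" "i \<noteq> q"
        show "w i = w' i"
        proof (cases "i \<in> E")
          case False
          then show ?thesis using agree[OF X, of i] i eq q sub by blast
        qed (use i eq in auto)
      qed (use fin q sub sum0 X in auto)
    qed (use q in auto)
  next
    case False
    \<comment> \<open>Without an active index in this half, its nonzero coefficient at
      \<open>i\<close> is cancelled by some \<open>q \<in> M\<close>. The sum then yields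
      \<open>w i\<close>, and \<open>w q = - w i\<close>. The choice made for one member is valid
      for the whole class, since \<open>\<tau>\<close> is common.\<close>
    obtain i where i: "i \<in> I" "\<not> hlf i" "w0 i \<noteq> 0" using facts(1)[OF X0] by (auto simp: tuple_pairs_def)
    then obtain q where q: "q \<in> M" "\<tau> q = i" using off[OF X0, of i] False by auto
    show ?thesis
    proof (intro bexI[of _ q] allI impI)
      fix w p w' p' assume X: "(w, p) \<in> X" "(w', p') \<in> X" and eq: "\<forall>i\<in>E \<union> M - {q}. w i = w' i"
      have "w i = w' i"
      proof (rule sum_agree_except_one[of "{i \<in> I. \<not> hlf i}"])
        fix l assume l: "l \<in> {i \<in> I. \<not> hlf i}" "l \<noteq> i"
        have "l \<notin> E" using False l by auto
        moreover have "w i' = w' i'" if "i' \<in> M" "\<tau> i' = l" for i'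
          using eq that q l by auto
        ultimately show "w l = w' l" using agree[OF X, of l] l by blast
      qed (use fin i sum0 X in auto)
      then show "w q = w' q" using neg(1)[OF X(1) q(1)] neg(1)[OF X(2) q(1)] q by simp
    qed (use q in auto)
  qed
  then obtain q where q: "q \<in> E \<union> M" and det: "\<And>w p w' p'. (w, p) \<in> X \<Longrightarrow> (w', p') \<in> X
      \<Longrightarrow> (\<forall>i\<in>E \<union> M - {q}. w i = w' i) \<Longrightarrow> w q = w' q"
    by blast
  have "inj_on (\<lambda>(w, p). (restrict w (E \<union> M - {q}), restrict p (I - M))) X"
    unfolding X_def
  proof (rule pattern_class_inj[OF fin])
    fix w p w' p' i
    assume "(w, p) \<in> pattern_class I hlf T N E M \<tau>" "(w', p') \<in> pattern_class I hlf T N E M \<tau>"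
      "\<And>i. i \<in> E \<union> M - {q} \<Longrightarrow> w i = w' i" "i \<in> E \<union> M"
    then show "w i = w' i" using det[of w p w' p'] by (cases "i = q") (auto simp: X_def)
  qed auto
  moreover have "card (E \<union> M - {q}) + 1 = card E + card M"
  proof -
    have "card (E \<union> M) = card E + card M" using finEM sub by (intro card_Un_disjoint) auto
    moreover have "card (E \<union> M) > 0" using q finEM by (auto simp: card_gt_0_iff)
    ultimately show ?thesis using q finEM by (simp add: card_Diff_singleton)
  qed
  moreover have "E \<union> M - {q} \<subseteq> E \<union> M" by auto
  ultimately show ?thesis unfolding X_def by (intro exI[of _ "E \<union> M - {q}"] conjI)
qed

text \<open>A cancelling pair would make two indices inactive, so there is none and inactive
  coefficients are zero. The two sum constraints then involve disjoint sets of active coordinates,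
  and each eliminates one.\<close>

lemma pattern_class_many_active:
  assumes fin: "finite I" and ne: "pattern_class I hlf T N E M \<tau> \<noteq> {}" and card: "card I \<le> card E + 1"
    and q: "q \<in> E" "q' \<in> E" "hlf q \<noteq> hlf q'"
  shows "M = {}" "card (E - {q, q'}) + 2 = card E"
    "inj_on (\<lambda>(w, p). (restrict w (E - {q, q'}), restrict p I)) (pattern_class I hlf T N E M \<tau>)"
proof -
  define X where "X = pattern_class I hlf T N E M \<tau>"
  have facts: "(w, p) \<in> tuple_pairs I hlf T N" "active I w p = E" "paired I hlf w p
      = M" "partner I hlf w p = \<tau>"
    if "(w, p) \<in> X" for w p using that by (auto simp: X_def pattern_class_def)
  obtain w0 p0 where X0: "(w0, p0) \<in> X" using ne by (auto simp: X_def)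
  have sub: "E \<subseteq> I" using facts[OF X0] by (auto simp: active_def)
  have finE: "finite E" using sub fin finite_subset by auto
  show M: "M = {}"
  proof (rule ccontr)
    assume "M \<noteq> {}"
    then obtain i where i: "i \<in> M" by auto
    then have "hlf i" "i \<in> I - E" using facts[OF X0] by (auto simp: paired_def)
    moreover have "\<tau> i \<in> I - E" "\<not> hlf (\<tau> i)"
      using partner_props[OF fin facts(1)[OF X0], of i] facts[OF X0] i by auto
    ultimately have "{i, \<tau> i} \<subseteq> I - E" "i \<noteq> \<tau> i" by auto
    then have "2 \<le> card (I - E)" using card_mono[of "I - E" "{i, \<tau> i}"] fin by simp
    then show False using card sub fin finE by (simp add: card_Diff_subset)
  qed
  have qq: "q \<noteq> q'" using q by auto
  then have "card {q, q'} \<le> card E" using q finE by (intro card_mono) auto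
  then show "card (E - {q, q'}) + 2 = card E" using q qq finE by (simp add: card_Diff_subset)
  have off: "w i = 0" if "(w, p) \<in> X" "i \<in> I" "i \<notin> E" for w p i
    using inactive_unpaired[OF fin facts(1)[OF that(1)], of i] facts[OF that(1)] that M by auto
  have sum0: "(\<Sum>i\<in>{i \<in> I. hlf i = b}. w i) = 0" if "(w, p) \<in> X" for w p b
    by (rule tuple_pairs_sum[OF facts(1)[OF that]])
  have "inj_on (\<lambda>(w, p). (restrict w (E - {q, q'}), restrict p (I - M))) X"
    unfolding X_def
  proof (rule pattern_class_inj[OF fin])
    fix w p w' p' i
    assume X: "(w, p) \<in> pattern_class I hlf T N E M \<tau>" "(w', p') \<in> pattern_class I hlf T N E M \<tau>"
      and eq: "\<And>i. i \<in> E - {q, q'} \<Longrightarrow> w i = w' i" and i: "i \<in> E \<union> M"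
    note X = X[folded X_def]
    have "w r = w' r" if r: "r \<in> {q, q'}" for r
    proof (rule sum_agree_except_one[of "{i \<in> I. hlf i = hlf r}"])
      fix l assume l: "l \<in> {i \<in> I. hlf i = hlf r}" "l \<noteq> r"
      then have "l \<notin> {q, q'}" using r q by auto
      then show "w l = w' l" using off[OF X(1), of l] off[OF X(2), of l] eq[of l] l
          by (cases "l \<in> E") auto
    qed (use fin r q sub sum0 X in auto)
    then show "w i = w' i" using eq[of i] i M by (cases "i \<in> {q, q'}") auto
  qed auto
  then show "inj_on (\<lambda>(w, p). (restrict w (E - {q, q'}), restrict p I)) (pattern_class I hlf T N E M \<tau>)"
    using M by (simp add: X_def)
qed

section \<open>The weighted sum over one cancellation pattern\<close>

lemma prod_int_weight_subset_le:
  assumes "finite I" "F \<subseteq> I" "N > 0"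
  shows "(\<Prod>i\<in>I. int_weight N (w i)) \<le> (\<Prod>i\<in>F. int_weight N (w i))"
proof -
  have "(\<Prod>i\<in>I. int_weight N (w i)) = (\<Prod>i\<in>F. int_weight N (w i)) * (\<Prod>i\<in>I - F. int_weight N (w i))"
    using assms by (metis prod.subset_diff mult.commute)
  also have "\<dots> \<le> (\<Prod>i\<in>F. int_weight N (w i)) * 1"
    using assms int_weight_bounds[of N] by (intro mult_left_mono prod_le_1 prod_nonneg) auto
  finally show ?thesis by simp
qed

lemma tuple_pairs_subset: "tuple_pairs I hlf T N \<subseteq> PiE I (\<lambda>_. T) \<times> PiE I (\<lambda>_. {1..N})"
  by (auto simp: tuple_pairs_def)

lemma finite_tuple_pairs: "finite I \<Longrightarrow> finite T \<Longrightarrow> finite (tuple_pairs I hlf T N)"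
  by (rule finite_subset[OF tuple_pairs_subset]) (auto intro!: finite_PiE)

text \<open>The power of the net coefficient is bounded by 1 here. There remain N for each
  coefficient in \<open>F\<close>, N for each base outside \<open>E\<close> and \<open>M\<close>,
  and the sum over the largest active base; without active indices the integral is bounded by 1. The
  constant 9 = 3 * 3 collects the weight sums and the gap averages.\<close>

lemma pattern_sum_le:
  fixes I :: "'i set" and A :: real
  assumes fin: "finite I" "finite T" and N: "N \<ge> 1" and I: "card I \<ge> 2"
    and F: "F \<subseteq> E \<union> M" and inj: "inj_on (\<lambda>(w, p). (restrict w F, restrict p (I
        - M))) (pattern_class I hlf T N E M \<tau>)"
    and ne: "pattern_class I hlf T N E M \<tau> \<noteq> {}"
  defines "n \<equiv> card I" and "\<theta> \<equiv> 1 / real (card I)"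
  shows "(\<Sum>(w, p)\<in>pattern_class I hlf T N E M \<tau>. (\<Prod>i\<in>I. int_weight (real N) (w i))
      * phase_integral A I w p)
     \<le> 8 * 6 ^ n * real n * 9 ^ n * (real N ^ (card F + n - card M - card E) *
         (if E = {} then 1 else \<Sum>z=1..N. real z powr (real (card E) - 1 - A * \<theta>)))"
proof -
  let ?Z = "if E = {} then 1 else \<Sum>z=1..N. real z powr (real (card E) - 1 - A * \<theta>)"
  let ?t = "top_weight \<theta> (A * \<theta>) E"
  define X where "X = pattern_class I hlf T N E M \<tau>"
  have facts: "(w, p) \<in> tuple_pairs I hlf T N" "active I w p = E" "paired I hlf w p = M"
    if "(w, p) \<in> X" for w p using that by (auto simp: X_def pattern_class_def)
  obtain w0 p0 where X0: "(w0, p0) \<in> X" using ne by (auto simp: X_def)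
  have sub: "E \<subseteq> I" "M \<subseteq> I" "E \<inter> M = {}" using facts[OF X0] by (auto simp: active_def paired_def)
  have finEM: "finite E" "finite M" using sub fin(1) by (auto intro: finite_subset)
  have FI: "F \<subseteq> I" and finF: "finite F" using F sub finEM finite_subset[of F "E \<union> M"] by auto
  have \<theta>: "0 \<le> \<theta>" "\<theta> \<le> 1 / 2" using I by (auto simp: \<theta>_def field_simps)
  define K :: real where "K = 8 * 6 ^ n"
  have K: "K \<ge> 1"
  proof -
    have "(1::real) \<le> 6 ^ n" by (rule one_le_power) simp
    then show ?thesis unfolding K_def by linarith
  qed
  define B where "B = (\<lambda>p. if E = {} then K else K * (\<Sum>i\<in>E. ?t p i))"
  have Bnn: "B p \<ge> 0" for p using K \<theta> by (auto simp: B_def intro!: mult_nonneg_nonneg sum_nonneg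
      top_weight_nonneg)
  define G where "G = (\<lambda>w. \<Prod>i\<in>F. int_weight (real N) (w i))"
  have Gnn: "G w \<ge> 0" for w unfolding G_def using int_weight_bounds[of "real N"] N
      by (intro prod_nonneg) auto
  have "(\<Sum>(w, p)\<in>X. (\<Prod>i\<in>I. int_weight (real N) (w i)) * phase_integral A I w p)
      \<le> (\<Sum>(w, p)\<in>X. G (restrict w F) * B (restrict p (I - M)))"
  proof (rule sum_mono, clarify)
    fix w p assume wp: "(w, p) \<in> X"
    have p1: "\<forall>i\<in>I. p i \<ge> 1" using facts(1)[OF wp] by (auto simp: tuple_pairs_def PiE_iff)
    have w0: "(\<Sum>i\<in>I. w i) = 0" by (rule tuple_pairs_sum_all[OF fin(1) facts(1)[OF wp]])
    have "phase_integral A I w p \<le> B p"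
    proof (cases "E = {}")
      case True
      then show ?thesis using phase_integral_bounds(2)[OF p1, of A w] K by (simp add: B_def)
    next
      case False
      have "phase_integral A I w p \<le> K *
         (\<Sum>i\<in>E. \<bar>real_of_int (net_coeff I w p (p i))\<bar> powr - \<theta> * ?t p i)"
        using phase_integral_le_top_weight[OF fin(1) p1 w0, of A] facts(2)[OF wp] False
            by (simp add: K_def \<theta>_def n_def)
      also have "\<dots> \<le> K * (\<Sum>i\<in>E. 1 * ?t p i)"
      proof (intro mult_left_mono sum_mono mult_right_mono)
        fix i assume "i \<in> E"
        then have "net_coeff I w p (p i) \<noteq> 0" using facts(2)[OF wp] by (auto simp: active_def)
        then have "1 \<le> \<bar>real_of_int (net_coeff I w p (p i))\<bar>" by linarith
        then show "\<bar>real_of_int (net_coeff I w p (p i))\<bar> powr - \<theta> \<le> 1"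
          using powr_mono2'[of "- \<theta>" 1] \<theta> by simp
      qed (use K \<theta> in \<open>auto intro!: top_weight_nonneg\<close>)
      finally show ?thesis using False by (simp add: B_def)
    qed
    also have "B p = B (restrict p (I - M))"
    proof -
      have "(\<Sum>i\<in>E. top_weight \<theta> (A * \<theta>) E (restrict p (I - M)) i) = (\<Sum>i\<in>E. ?t p i)"
        using sub by (intro sum.cong top_weight_restrict) auto
      then show ?thesis by (simp add: B_def)
    qed
    finally have "phase_integral A I w p \<le> B (restrict p (I - M))" .
    moreover have "(\<Prod>i\<in>I. int_weight (real N) (w i)) \<le> G (restrict w F)"
      using prod_int_weight_subset_le[OF fin(1) FI, of "real N" w] N by (simp add: G_def)
    ultimately show "(\<Prod>i\<in>I. int_weight (real N) (w i)) * phase_integral A I w p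
        \<le> G (restrict w F) * B (restrict p (I - M))"
      using Gnn phase_integral_bounds(1)[OF p1] by (intro mult_mono) auto
  qed
  also have "\<dots> \<le> (\<Sum>w\<in>PiE F (\<lambda>_. T). G w) * (\<Sum>p\<in>PiE (I - M) (\<lambda>_. {1..N}). B p)"
  proof (rule sum_restrict_pair_le[OF fin(1) fin(2)])
    show "X \<subseteq> PiE I (\<lambda>_. T) \<times> PiE I (\<lambda>_. {1..N})" using facts(1) tuple_pairs_subset by fast
  qed (use FI inj Gnn Bnn in \<open>auto simp: X_def\<close>)
  also have "\<dots> \<le> (3 * real N) ^ card F * (K * real n * (3 ^ n * (real N ^ (n - card M - card E) *
         ?Z)))"
  proof (rule mult_mono)
    show "(\<Sum>w\<in>PiE F (\<lambda>_. T). G w) \<le> (3 * real N) ^ card F"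
      unfolding G_def using finF fin N by (intro sum_prod_int_weight_le) auto
    have cIM: "card (I - M) = n - card M" using finEM sub by (simp add: card_Diff_subset n_def)
    show "(\<Sum>p\<in>PiE (I - M) (\<lambda>_. {1..N}). B p) \<le> K * real n * (3 ^ n * (real N ^ (n - card M - card E) *
         ?Z))"
    proof (cases "E = {}")
      case True
      have "1 * 1 * 1 \<le> real n * 3 ^ n * (1 :: real)"
        using I unfolding n_def by (intro mult_mono) auto
      then have "K * real N ^ (n - card M) * (1 * 1 * 1)
          \<le> K * real N ^ (n - card M) * (real n * 3 ^ n * 1)"
        using K by (intro mult_left_mono) auto
      then show ?thesis using True fin cIM by (simp add: B_def card_PiE mult_ac)
    next
      case False
      define Z where "Z = (\<Sum>z=1..N. real z powr (real (card E) - 1 - A * \<theta>))"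
      have Z: "Z \<ge> 0" by (auto simp: Z_def intro!: sum_nonneg)
      have cE: "card E \<le> n" using sub fin by (simp add: n_def card_mono)
      have b3: "1 + 1 / (1 - \<theta>) \<le> 3" "0 \<le> 1 + 1 / (1 - \<theta>)" using \<theta> by (auto simp: field_simps)
      have "(\<Sum>p\<in>PiE (I - M) (\<lambda>_. {1..N}). ?t p i) \<le> 3 ^ n * (real N ^ (n - card M - card E) * Z)"
        if "i \<in> E" for i
      proof -
        have "(\<Sum>p\<in>PiE (I - M) (\<lambda>_. {1..N}). ?t p i)
          \<le> (1 + 1 / (1 - \<theta>)) ^ (card E - 1) * real N ^ (card (I - M) - card E) * Z"
          unfolding Z_def using fin sub \<theta> that by (intro sum_top_weight_le) auto
        also have "\<dots> = (1 + 1 / (1 - \<theta>)) ^ (card E - 1) * (real N ^ (n - card M - card E) * Z)"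
            by (simp add: cIM)
        also have "\<dots> \<le> 3 ^ n * (real N ^ (n - card M - card E) * Z)"
        proof (rule mult_right_mono)
          have "(1 + 1 / (1 - \<theta>)) ^ (card E - 1) \<le> 3 ^ (card E - 1)" using b3 by (intro power_mono) auto
          also have "\<dots> \<le> 3 ^ n" using cE by (intro power_increasing) auto
          finally show "(1 + 1 / (1 - \<theta>)) ^ (card E - 1) \<le> 3 ^ n" .
        qed (use Z in auto)
        finally show ?thesis .
      qed
      then have "(\<Sum>i\<in>E. \<Sum>p\<in>PiE (I - M) (\<lambda>_. {1..N}). ?t p i)
         \<le> real (card E) * (3 ^ n * (real N ^ (n - card M - card E) * Z))"
        by (intro sum_bounded_above) auto
      also have "\<dots> \<le> real n * (3 ^ n * (real N ^ (n - card M - card E) * Z))"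
        using cE Z by (intro mult_right_mono) auto
      finally have "K * (\<Sum>i\<in>E. \<Sum>p\<in>PiE (I - M) (\<lambda>_. {1..N}). ?t p i)
         \<le> K * (real n * (3 ^ n * (real N ^ (n - card M - card E) * Z)))" using K
             by (intro mult_left_mono) auto
      then show ?thesis using False unfolding B_def Z_def
        by (subst (asm) sum.swap) (simp add: sum_distrib_left mult.assoc)
    qed
  qed (use Bnn in \<open>auto intro!: sum_nonneg\<close>)
  also have "\<dots> \<le> 8 * 6 ^ n * real n * 9 ^ n * (real N ^ (card F + n - card M - card E) *
         ?Z)"
  proof -
    define Z where "Z = ?Z"
    have Z: "Z \<ge> 0" by (auto simp: Z_def intro!: sum_nonneg)
    have cF: "card F \<le> n" using FI fin by (simp add: n_def card_mono)
    have cEM: "card E + card M \<le> n"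
      using card_Un_disjoint[of E M] card_mono[of I "E \<union> M"] sub finEM fin by (simp add: n_def)
    have "real N ^ (card F + n - card M - card E) = real N ^ card F * real N ^ (n - card M - card E)"
      using cEM by (simp flip: power_add)
    then have "(3 * real N) ^ card F * (K * real n * (3 ^ n * (real N ^ (n - card M - card E) * Z)))
      = (K * real n * (real N ^ (card F + n - card M - card E) * Z)) * (3 ^ card F * 3 ^ n)"
      by (simp add: power_mult_distrib mult_ac)
    also have "\<dots> \<le> (K * real n * (real N ^ (card F + n - card M - card E) * Z)) * (3 ^ n * 3 ^ n)"
      using cF Z K by (intro mult_left_mono mult_right_mono power_increasing mult_nonneg_nonneg) auto
    also have "(3 ^ n * 3 ^ n :: real) = 9 ^ n" by (simp flip: power_mult_distrib)
    finally show ?thesis unfolding Z_def K_def by (simp add: mult_ac)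
  qed
  finally show ?thesis by (simp add: X_def)
qed

text \<open>The case that decides the range of A, so the average over the net coefficient is
  exploited too. For an index \<open>i\<close> and a possible companion \<open>j\<close>, the
  eliminated \<open>q\<close> and \<open>q'\<close> are taken from the halves of \<open>i\<close>
  and \<open>j\<close> but different from them, which keeps \<open>w i + e * w j\<close> a form in
  free coordinates. The constant 7 bounds 3 + 2/(1 - \<theta>) for \<theta> \<le> 1/2, and 2 counts
  the values of \<open>e\<close>.\<close>

lemma pattern_sum_le_all_active:
  fixes I :: "'i set" and A :: real
  assumes fin: "finite I" "finite T" and N: "N \<ge> 1"
    and half: "\<And>b. card {i \<in> I. hlf i = b} \<ge> 2" and ne: "pattern_class I hlf T N I M \<tau> \<noteq> {}"
  defines "n \<equiv> card I" and "\<theta> \<equiv> 1 / real (card I)"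
  shows "(\<Sum>(w, p)\<in>pattern_class I hlf T N I M \<tau>. (\<Prod>i\<in>I. int_weight (real N) (w i))
      * phase_integral A I w p)
     \<le> 8 * 6 ^ n * real n * real n * 2 * 7 * 9 ^ n * (real N powr (real n - 2 - \<theta>) *
         (\<Sum>z=1..N. real z powr (real n - 1 - A * \<theta>)))"
proof -
  let ?W = "\<lambda>w. \<Prod>l\<in>I. int_weight (real N) (w l)"
  let ?d = "\<lambda>w i j e. \<bar>real_of_int (w i + e * w j)\<bar> powr - \<theta>"
  let ?t = "top_weight \<theta> (A * \<theta>) I"
  let ?opp = "\<lambda>i. {j \<in> I. hlf j \<noteq> hlf i}"
  define X where "X = pattern_class I hlf T N I M \<tau>"
  have facts: "(w, p) \<in> tuple_pairs I hlf T N" "active I w p = I" if "(w, p) \<in> X" for w p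
    using that by (auto simp: X_def pattern_class_def)
  have finX: "finite X" unfolding X_def
    by (rule finite_subset[OF _ finite_tuple_pairs[OF fin, of hlf N]]) (auto simp: pattern_class_def)
  have other: "\<exists>r\<in>I. hlf r = hlf i \<and> r \<noteq> i" for i
  proof (rule ccontr)
    assume "\<not> ?thesis"
    then have "{r \<in> I. hlf r = hlf i} \<subseteq> {i}" by auto
    then have "card {r \<in> I. hlf r = hlf i} \<le> 1" using card_mono[of "{i}"] by fastforce
    then show False using half[of "hlf i"] by simp
  qed
  have opp: "\<exists>j\<in>I. hlf j \<noteq> hlf i" for i
  proof (rule ccontr)
    assume "\<not> ?thesis"
    then have *: "{r \<in> I. hlf r = (\<not> hlf i)} = {}" by auto
    show False using half[of "\<not> hlf i"] unfolding * by simp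
  qed
  have n2: "n \<ge> 2" using half[of True] card_mono[of I "{i \<in> I. hlf i = True}"] fin by (simp add: n_def)
  have \<theta>: "0 \<le> \<theta>" "\<theta> \<le> 1 / 2" "\<theta> < 1" using n2 by (auto simp: \<theta>_def n_def field_simps)
  define Z where "Z = (\<Sum>z=1..N. real z powr (real n - 1 - A * \<theta>))"
  have Z: "Z \<ge> 0" by (auto simp: Z_def intro!: sum_nonneg)
  define Y where "Y = 7 * 9 ^ n * (real N powr (real n - 2 - \<theta>) * Z)"
  have Y: "Y \<ge> 0" using Z by (auto simp: Y_def)
  have term_le: "(\<Sum>(w, p)\<in>X. ?W w * (?d w i j e * ?t p i)) \<le> Y"
    if ij: "i \<in> I" "j \<in> I" "hlf j \<noteq> hlf i" for i j e
  proof -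
    obtain q where q: "q \<in> I" "hlf q = hlf i" "q \<noteq> i" using other by blast
    obtain q' where q': "q' \<in> I" "hlf q' = hlf j" "q' \<noteq> j" using other by blast
    define F where "F = I - {q, q'}"
    have F: "F \<subseteq> I" "finite F" "i \<in> F" "j \<in> F" "i \<noteq> j" using q q' ij fin by (auto simp: F_def)
    note many = pattern_class_many_active[OF fin(1) ne, of q q', folded F_def X_def]
    have inj: "inj_on (\<lambda>(w, p). (restrict w F, restrict p I)) X" and cF: "card F + 2 = n"
      using many q q' ij by (auto simp: n_def)
    define f where "f = (\<lambda>w. (\<Prod>l\<in>F. int_weight (real N) (w l)) * ?d w i j e)"
    have fnn: "f w \<ge> 0" for w unfolding f_def using int_weight_bounds[of "real N"] N
      by (intro mult_nonneg_nonneg prod_nonneg) auto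
    have "(\<Sum>(w, p)\<in>X. ?W w * (?d w i j e * ?t p i))
       \<le> (\<Sum>(w, p)\<in>X. f (restrict w F) * top_weight \<theta> (A * \<theta>) I (restrict p I) i)"
    proof (rule sum_mono, clarify)
      fix w p
      have "?W w \<le> (\<Prod>l\<in>F. int_weight (real N) (restrict w F l))"
        using prod_int_weight_subset_le[OF fin(1) F(1), of "real N" w] N by simp
      then have "?W w * (?d w i j e * ?t p i)
        \<le> (\<Prod>l\<in>F. int_weight (real N) (restrict w F l)) * (?d w i j e * ?t p i)"
        using \<theta> by (intro mult_right_mono mult_nonneg_nonneg top_weight_nonneg) auto
      then show "?W w * (?d w i j e * ?t p i)
        \<le> f (restrict w F) * top_weight \<theta> (A * \<theta>) I (restrict p I) i"
        using F ij by (simp add: f_def top_weight_restrict mult.assoc)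
    qed
    also have "\<dots> \<le> (\<Sum>w\<in>PiE F (\<lambda>_. T). f w) * (\<Sum>p\<in>PiE I (\<lambda>_. {1..N}). ?t p i)"
    proof (rule sum_restrict_pair_le[OF fin])
      show "X \<subseteq> PiE I (\<lambda>_. T) \<times> PiE I (\<lambda>_. {1..N})" using facts(1) tuple_pairs_subset by fast
    qed (use F inj fnn \<theta> in \<open>auto intro: top_weight_nonneg\<close>)
    also have "\<dots> \<le> (7 * real N powr (1 - \<theta>) * (3 * real N) ^ (card F - 1)) * (3 ^ (n - 1) * Z)"
    proof (rule mult_mono)
      have "(\<Sum>w\<in>PiE F (\<lambda>_. T). f w) \<le> (3 + 2 / (1 - \<theta>)) * real N powr (1 - \<theta>) * (3
          * real N) ^ (card F - 1)"
        unfolding f_def using F fin N \<theta> by (intro sum_prod_int_weight_linear_le) auto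
      also have "\<dots> \<le> 7 * real N powr (1 - \<theta>) * (3 * real N) ^ (card F - 1)"
        using \<theta> by (intro mult_right_mono) (auto simp: field_simps)
      finally show "(\<Sum>w\<in>PiE F (\<lambda>_. T). f w) \<le> 7 * real N powr (1 - \<theta>) * (3 * real N) ^ (card F - 1)" .
      have "(\<Sum>p\<in>PiE I (\<lambda>_. {1..N}). ?t p i)
         \<le> (1 + 1 / (1 - \<theta>)) ^ (card I - 1) * real N ^ (card I - card I) * Z"
        unfolding Z_def n_def using fin \<theta> ij by (intro sum_top_weight_le) auto
      also have "\<dots> \<le> 3 ^ (n - 1) * Z"
        unfolding n_def using \<theta> Z by (simp, intro mult_right_mono power_mono) (auto simp: field_simps)
      finally show "(\<Sum>p\<in>PiE I (\<lambda>_. {1..N}). ?t p i) \<le> 3 ^ (n - 1) * Z" .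
    qed (use \<theta> in \<open>auto intro!: sum_nonneg top_weight_nonneg\<close>)
    also have "\<dots> = 7 * (3 ^ (n - 3) * 3 ^ (n - 1)) * (real N powr (real n - 2 - \<theta>) * Z)"
    proof -
      \<comment> \<open>\<open>F\<close> contains \<open>i\<close> and \<open>j\<close>, so n \<ge>
        4 and the truncated subtractions are exact.\<close>
      have "card {i, j} \<le> card F" using F by (intro card_mono) auto
      then have n4: "n \<ge> 4" "card F - 1 = n - 3" using cF F by auto
      then have "real N ^ (card F - 1) = real N powr (real n - 3)" using N
          by (simp add: powr_realpow[symmetric] of_nat_diff)
      then have "real N powr (1 - \<theta>) * real N ^ (card F - 1) = real N powr (real n - 2 - \<theta>)"
        by (simp flip: powr_add) (simp add: algebra_simps)
      then show ?thesis using n4 by (simp add: power_mult_distrib mult_ac)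
    qed
    also have "\<dots> \<le> 7 * (3 ^ n * 3 ^ n) * (real N powr (real n - 2 - \<theta>) * Z)"
      using Z by (intro mult_right_mono mult_left_mono mult_mono power_increasing) auto
    also have "\<dots> = Y" unfolding Y_def by (simp flip: power_mult_distrib)
    finally show ?thesis .
  qed
  have "(\<Sum>(w, p)\<in>X. ?W w * phase_integral A I w p)
     \<le> (\<Sum>(w, p)\<in>X. \<Sum>i\<in>I. \<Sum>j\<in>?opp i. \<Sum>e\<in>{0, 1 :: int}. 8 * 6 ^ n *
          (?W w * (?d w i j e * ?t p i)))"
  proof (rule sum_mono, clarify)
    fix w p assume wp: "(w, p) \<in> X"
    have p1: "\<forall>i\<in>I. p i \<ge> 1" using facts(1)[OF wp] by (auto simp: tuple_pairs_def PiE_iff)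
    have w0: "(\<Sum>i\<in>I. w i) = 0" by (rule tuple_pairs_sum_all[OF fin(1) facts(1)[OF wp]])
    have Ine: "I \<noteq> {}" using n2 by (auto simp: n_def)
    have "phase_integral A I w p \<le> 8 * 6 ^ n *
         (\<Sum>i\<in>I. \<bar>real_of_int (net_coeff I w p (p i))\<bar> powr - \<theta> * ?t p i)"
      using phase_integral_le_top_weight[OF fin(1) p1 w0, of A] facts(2)[OF wp] Ine
          by (simp add: \<theta>_def n_def)
    also have "\<dots> \<le> 8 * 6 ^ n * (\<Sum>i\<in>I. (\<Sum>j\<in>?opp i. \<Sum>e\<in>{0, 1 :: int}. ?d w i j e) * ?t p i)"
      using opp \<theta> by (intro mult_left_mono sum_mono mult_right_mono net_coeff_powr_le[OF fin(1)
          facts(1)[OF wp]] top_weight_nonneg) auto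
    finally have "?W w * phase_integral A I w p \<le> ?W w *
       (8 * 6 ^ n * (\<Sum>i\<in>I. (\<Sum>j\<in>?opp i. \<Sum>e\<in>{0, 1 :: int}. ?d w i j e) * ?t p i))"
      using int_weight_bounds[of "real N"] N by (intro mult_left_mono prod_nonneg) auto
    also have "\<dots> = (\<Sum>i\<in>I. \<Sum>j\<in>?opp i. \<Sum>e\<in>{0, 1 :: int}. 8 * 6 ^ n *
          (?W w * (?d w i j e * ?t p i)))"
      unfolding sum_distrib_left sum_distrib_right by (simp only: mult_ac)
    finally show "?W w * phase_integral A I w p \<le> \<dots>" .
  qed
  also have "\<dots> = (\<Sum>i\<in>I. \<Sum>j\<in>?opp i. \<Sum>e\<in>{0, 1 :: int}. 8 * 6 ^ n * (\<Sum>(w, p)\<in>X.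
          ?W w * (?d w i j e * ?t p i)))"
    unfolding case_prod_unfold sum_distrib_left
    by (subst sum.swap, rule sum.cong[OF refl], subst sum.swap, rule sum.cong[OF refl], subst
        sum.swap, rule refl)
  also have "\<dots> \<le> (\<Sum>i\<in>I. \<Sum>j\<in>?opp i. \<Sum>e\<in>{0, 1 :: int}. 8 * 6 ^ n * Y)"
    by (intro sum_mono mult_left_mono term_le) auto
  also have "\<dots> \<le> (\<Sum>i\<in>I. real n * (2 * (8 * 6 ^ n * Y)))"
  proof (rule sum_mono)
    fix i
    have "card (?opp i) \<le> n" unfolding n_def using fin by (intro card_mono) auto
    then have "real (card (?opp i)) * (2 * (8 * 6 ^ n * Y)) \<le> real n * (2 * (8 * 6 ^ n * Y))"
      using Y by (intro mult_right_mono) auto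
    then show "(\<Sum>j\<in>?opp i. \<Sum>e\<in>{0, 1 :: int}. 8 * 6 ^ n * Y) \<le> real n * (2 * (8 * 6 ^ n * Y))" by simp
  qed
  also have "\<dots> = 8 * 6 ^ n * real n * real n * 2 * 7 * 9 ^ n * (real N powr (real n - 2 - \<theta>) * Z)"
    by (simp add: n_def Y_def)
  finally show ?thesis by (simp add: X_def Z_def)
qed

text \<open>Free coordinates times the sum over the largest base: with at least two inactive indices
  N^(n-1) times N^\<theta>, with one N^(n-2) times N^(1+\<theta>), with none N^(n-2-\<theta>) times
  N^(1+\<gamma>). The first two are N^(n-1+\<theta>), the last is the larger of N^(n-1-\<theta>) and
  N^(n-\<delta>), up to constants. Hence the choice of \<rho> as the minimum of \<delta> and 1 -
  \<theta>.\<close>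

lemma weighted_phase_sum_bound:
  fixes I :: "'i set" and A :: real
  assumes fin: "finite I" and half: "\<And>b. card {i \<in> I. hlf i = b} = k" and k: "k \<ge> 2"
    and A: "A > 4 * real k ^ 2 - 4 * real k - 1"
  shows "\<exists>\<rho>>0. \<exists>C\<ge>0. \<forall>N\<ge>1. \<forall>T. finite T \<longrightarrow>
     (\<Sum>(w, p)\<in>tuple_pairs I hlf T N. (\<Prod>i\<in>I. int_weight (real N) (w i)) * phase_integral A I w p)
       \<le> C * real N powr (2 * real k - \<rho>)"
proof -
  define n where "n = card I"
  have n: "n = 2 * k"
  proof -
    have "I = {i \<in> I. hlf i = True} \<union> {i \<in> I. hlf i = False}" by auto
    then have "card I = card {i \<in> I. hlf i = True} + card {i \<in> I. hlf i = False}"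
      using fin by (metis (no_types, lifting) card_Un_disjoint finite_Un disjoint_iff mem_Collect_eq)
    then show ?thesis using half[of True] half[of False] by (simp add: n_def)
  qed
  define \<theta> where "\<theta> = 1 / real n"
  \<comment> \<open>The distance of A from the threshold, measured in A \<theta>: it makes A
    \<theta> = n - 2 - \<theta> + \<delta>.\<close>
  define \<delta> where "\<delta> = (A - (4 * real k ^ 2 - 4 * real k - 1)) / real n"
  have \<theta>: "\<theta> > 0" "\<theta> < 1" using n k by (auto simp: \<theta>_def)
  let ?Z = "\<lambda>N E. if E = {} then 1 else \<Sum>z=1..N. real z powr (real (card E) - 1 - A * \<theta>)"
  let ?S = "\<lambda>T N E M \<tau>. \<Sum>(w, p)\<in>pattern_class I hlf T N E M \<tau>.
    (\<Prod>i\<in>I. int_weight (real N) (w i)) * phase_integral A I w p"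
  have \<delta>: "\<delta> > 0" using A n k by (auto simp: \<delta>_def)
  have A\<theta>: "A * \<theta> = real n - 2 - \<theta> + \<delta>"
    using n k by (simp add: \<theta>_def \<delta>_def field_simps power2_eq_square)
  define \<rho> where "\<rho> = min \<delta> (1 - \<theta>)"
  have \<rho>: "\<rho> > 0" "\<rho> \<le> \<delta>" "\<rho> \<le> 1 - \<theta>" using \<delta> \<theta> by (auto simp: \<rho>_def)
  define C1 :: real where "C1 = 8 * 6 ^ n * real n * 9 ^ n"
  define C2 :: real where "C2 = 8 * 6 ^ n * real n * real n * 2 * 7 * 9 ^ n"
  have C: "C1 \<ge> 0" "C2 \<ge> 0" by (auto simp: C1_def C2_def)
  define P where "P = Pow I \<times> Pow I \<times> PiE I (\<lambda>_. I)"
  have finP: "finite P" unfolding P_def using fin by (auto intro!: finite_PiE)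
  have cls: "?S T N E M \<tau>
       \<le> (C1 * real n + C2) * real N powr (real n - \<rho>)"
    if N: "N \<ge> 1" and T: "finite T" for N T E M \<tau>
  proof (cases "pattern_class I hlf T N E M \<tau> = {}")
    case True
    then show ?thesis using C by simp
  next
    case ne: False
    then obtain w0 p0 where "(w0, p0) \<in> pattern_class I hlf T N E M \<tau>" by auto
    then have sub: "E \<subseteq> I" "M \<subseteq> I" "E \<inter> M = {}" by (auto simp: pattern_class_def active_def paired_def)
    have fEM: "finite E" "finite M" using sub fin by (auto intro: finite_subset)
    have cEM: "card E + card M \<le> n"
      using card_Un_disjoint[of E M] card_mono[of I "E \<union> M"] sub fEM fin by (simp add: n_def)
    have small: "?S T N E M \<tau>
       \<le> (C1 * real n + C2) * real N powr (real n - \<rho>)"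
      if F: "F \<subseteq> E \<union> M" "inj_on (\<lambda>(w, p). (restrict w F, restrict p (I
          - M))) (pattern_class I hlf T N E M \<tau>)"
        and bound: "real N ^ (card F + n - card M - card E) * ?Z N E
            \<le> real n * real N powr (real n - 1 + \<theta>)" for F
    proof -
      have "?S T N E M \<tau>
         \<le> C1 * (real N ^ (card F + n - card M - card E) * ?Z N E)"
        using pattern_sum_le[OF fin T N _ F ne, of A] n k unfolding C1_def \<theta>_def n_def by simp
      also have "\<dots> \<le> C1 * (real n * real N powr (real n - 1 + \<theta>))" using bound C
          by (intro mult_left_mono) auto
      also have "\<dots> \<le> C1 * (real n * real N powr (real n - \<rho>))"
        using C \<rho> N by (intro mult_left_mono powr_mono) auto
      also have "\<dots> \<le> (C1 * real n + C2) * real N powr (real n - \<rho>)" using C by (simp add: algebra_simps)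
      finally show ?thesis .
    qed
    consider (few) "card E + 2 \<le> n" | (one) "card E + 1 = n" | (all) "card E = n" using cEM by linarith
    then show ?thesis
    proof cases
      case few
      obtain F where F: "F \<subseteq> E \<union> M" "card F + 1 = card E + card M"
        "inj_on (\<lambda>(w, p). (restrict w F, restrict p (I - M))) (pattern_class I hlf T N E M \<tau>)"
        using pattern_class_few_active[OF fin ne] by blast
      have e: "card F + n - card M - card E = n - 1" using F(2) cEM by linarith
      have Z: "?Z N E \<le> real n * real N powr \<theta>"
      proof (cases "E = {}")
        case True
        have "1 * 1 \<le> real n * real N powr \<theta>" using n k N \<theta> by (intro mult_mono ge_one_powr_ge_zero) auto
        then show ?thesis using True by simp
      next
        case False
        have "(\<Sum>z=1..N. real z powr (real (card E) - 1 - A * \<theta>)) \<le> (\<Sum>z=1..N. real z powr - (1 - \<theta>))"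
        proof (intro sum_mono powr_mono)
          have "real (card E) + 2 \<le> real n" using few by linarith
          then show "real (card E) - 1 - A * \<theta> \<le> - (1 - \<theta>)" using A\<theta> \<delta> by linarith
        qed auto
        also have "\<dots> \<le> real N powr (1 - (1 - \<theta>)) / (1 - (1 - \<theta>))" using \<theta>
            by (intro sum_powr_minus_le) auto
        also have "\<dots> = real n * real N powr \<theta>" using n k by (simp add: \<theta>_def)
        finally show ?thesis using False by simp
      qed
      have "real N ^ (n - 1) * ?Z N E
         \<le> real N ^ (n - 1) * (real n * real N powr \<theta>)" using Z by (intro mult_left_mono) auto
      also have "\<dots> = real N powr (real n - 1) * (real n * real N powr \<theta>)"
        using N n k by (simp add: powr_realpow[symmetric] of_nat_diff)
      also have "\<dots> = real n * real N powr (real n - 1 + \<theta>)" by (simp add: powr_add)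
      finally have b: "real N ^ (n - 1) * ?Z N E
         \<le> real n * real N powr (real n - 1 + \<theta>)" .
      show ?thesis by (rule small[OF F(1,3)], unfold e, rule b)
    next
      case one
      \<comment> \<open>Only one index is inactive and each half has k \<ge> 2 indices, so both
        halves contain active ones.\<close>
      have ex: "\<exists>q\<in>E. hlf q = b" for b
      proof (rule ccontr)
        assume "\<not> ?thesis"
        then have "{i \<in> I. hlf i = b} \<subseteq> I - E" by auto
        then have "k \<le> card (I - E)" using card_mono[of "I - E" "{i \<in> I. hlf i = b}"] fin half by simp
        then show False using one k sub fEM by (simp add: card_Diff_subset n_def)
      qed
      obtain q q' where q: "q \<in> E" "hlf q = True" "q' \<in> E" "hlf q' = False" using ex by metis
      define F where "F = E - {q, q'}"
      have many: "M = {}" "card F + 2 = card E" "inj_on (\<lambda>(w, p). (restrict w F, restrict p I))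
          (pattern_class I hlf T N E M \<tau>)"
        using pattern_class_many_active[OF fin ne, of q q'] q one by (auto simp: F_def n_def)
      have e: "card F + n - card M - card E = n - 2" using many(1,2) cEM by simp
      have "(\<Sum>z=1..N. real z powr (real (card E) - 1 - A * \<theta>)) \<le> real N powr (\<theta> + 1)"
      proof (rule sum_powr_le)
        have "real (card E) + 1 = real n" using one by linarith
        then show "real (card E) - 1 - A * \<theta> \<le> \<theta>" using A\<theta> \<delta> by linarith
      qed (use \<theta> in auto)
      moreover have "E \<noteq> {}" using q by auto
      ultimately have "real N ^ (n - 2) * ?Z N E
         \<le> real N ^ (n - 2) * real N powr (\<theta> + 1)" by (simp add: mult_left_mono)
      also have "\<dots> = real N powr (real n - 2) * real N powr (\<theta> + 1)"
        using N n k by (simp add: powr_realpow[symmetric] of_nat_diff)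
      also have "\<dots> = 1 * real N powr (real n - 1 + \<theta>)"
        by (simp flip: powr_add) (simp add: algebra_simps)
      also have "\<dots> \<le> real n * real N powr (real n - 1 + \<theta>)" using n k by (intro mult_right_mono) auto
      finally have b: "real N ^ (n - 2) * ?Z N E
         \<le> real n * real N powr (real n - 1 + \<theta>)" .
      show ?thesis
      proof (rule small[of F])
        show "inj_on (\<lambda>(w, p). (restrict w F, restrict p (I - M))) (pattern_class I hlf T N E M \<tau>)"
          using many(1,3) by simp
        show "real N ^ (card F + n - card M - card E) * ?Z N E
         \<le> real n * real N powr (real n - 1 + \<theta>)" unfolding e by (rule b)
      qed (auto simp: F_def)
    next
      case all
      then have EI: "E = I" using sub fin card_subset_eq[of I E] by (simp add: n_def)
      \<comment> \<open>The exponent 1 + \<theta> - \<delta> of z is negative for large A. The sum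
        over z is then bounded by N, which still leaves a saving of N^(1+\<theta>).\<close>
      define \<gamma> where "\<gamma> = max 0 (1 + \<theta> - \<delta>)"
      have "?S T N E M \<tau>
         \<le> C2 * (real N powr (real n - 2 - \<theta>) * (\<Sum>z=1..N. real z powr (real n - 1 - A * \<theta>)))"
        unfolding C2_def \<theta>_def n_def EI
        by (rule pattern_sum_le_all_active) (use fin T N half k ne EI in auto)
      also have "\<dots> \<le> C2 * (real N powr (real n - 2 - \<theta>) * real N powr (\<gamma> + 1))"
        using C A\<theta> by (intro mult_left_mono sum_powr_le) (auto simp: \<gamma>_def)
      also have "real N powr (real n - 2 - \<theta>) * real N powr (\<gamma> + 1) = real N powr (real n - 1 - \<theta> + \<gamma>)"
        by (simp flip: powr_add) (simp add: algebra_simps)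
      also have "C2 * \<dots> \<le> C2 * real N powr (real n - \<rho>)"
        using C N \<rho> \<theta> by (intro mult_left_mono powr_mono) (auto simp: \<gamma>_def)
      also have "\<dots> \<le> (C1 * real n + C2) * real N powr (real n - \<rho>)" using C by (simp add: algebra_simps)
      finally show ?thesis .
    qed
  qed
  show ?thesis
  proof (rule exI[of _ \<rho>], rule conjI[OF \<rho>(1)],
      rule exI[of _ "real (card P) * (C1 * real n + C2)"], intro conjI allI impI)
    show "0 \<le> real (card P) * (C1 * real n + C2)" using C by simp
    fix N :: nat and T :: "int set" assume N: "1 \<le> N" and T: "finite T"
    \<comment> \<open>Grouping by pattern costs the number of patterns, which depends on
      \<open>I\<close> only and goes into the constant.\<close>
    define pat where "pat = (\<lambda>(w, p). (active I w p, paired I hlf w p, partner I hlf w p))"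
    define g where "g = (\<lambda>(w, p). (\<Prod>i\<in>I. int_weight (real N) (w i)) * phase_integral A I w p)"
    have patP: "pat ` tuple_pairs I hlf T N \<subseteq> P"
    proof (rule image_subsetI)
      fix x assume "x \<in> tuple_pairs I hlf T N"
      then obtain w p where x: "x = (w, p)" and wp: "(w, p) \<in> tuple_pairs I hlf T N" by (cases x) auto
      have "partner I hlf w p i \<in> I" if "i \<in> I" for i
        using partner_props(1)[OF fin wp, of i] that
            by (cases "i \<in> paired I hlf w p") (auto simp: partner_def)
      moreover have "partner I hlf w p \<in> extensional I" by (simp add: partner_def)
      ultimately show "pat x \<in> P" by (auto simp: x pat_def P_def active_def paired_def PiE_iff)
    qed
    have "(\<Sum>x\<in>tuple_pairs I hlf T N. g x) = (\<Sum>y\<in>P. \<Sum>x\<in>{x \<in> tuple_pairs I hlf T N. pat x = y}. g x)"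
      by (rule sum.group[symmetric, OF finite_tuple_pairs[OF fin T] finP patP])
    also have "\<dots> \<le> (\<Sum>y\<in>P. (C1 * real n + C2) * real N powr (real n - \<rho>))"
    proof (rule sum_mono)
      fix y :: "'i set \<times> 'i set \<times> ('i \<Rightarrow> 'i)"
      obtain E M \<tau> where y: "y = (E, M, \<tau>)" by (cases y) auto
      have "{x \<in> tuple_pairs I hlf T N. pat x = y} = pattern_class I hlf T N E M \<tau>"
        by (auto simp: y pat_def pattern_class_def)
      then show "(\<Sum>x\<in>{x \<in> tuple_pairs I hlf T N. pat x = y}. g x)
          \<le> (C1 * real n + C2) * real N powr (real n - \<rho>)"
        using cls[OF N T, of E M \<tau>] by (simp add: g_def)
    qed
    finally show "(\<Sum>(w, p)\<in>tuple_pairs I hlf T N. (\<Prod>i\<in>I. int_weight (real N) (w i))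
        * phase_integral A I w p)
       \<le> real (card P) * (C1 * real n + C2) * real N powr (2 * real k - \<rho>)"
      by (simp add: g_def n mult.assoc)
  qed
qed

section \<open>Fourier expansion of smooth functions with compact support\<close>

lemma Cc_infinity_continuous: "f \<in> Cc_infinity \<Longrightarrow> continuous_on S f"
  using C_diff.simps(1)[of f] by (auto simp: Cc_infinity_def simp del: C_diff.simps intro:
      continuous_on_subset)

lemma Cc_infinity_differentiable: "f \<in> Cc_infinity \<Longrightarrow> f differentiable (at x)"
  unfolding Cc_infinity_def using C_diff.simps(2)[of 0 f] by blast

lemma Cc_infinity_derivative:
  assumes "f \<in> Cc_infinity"
  shows "(\<lambda>x. frechet_derivative f (at x) v) \<in> Cc_infinity"
proof -
  have "C_diff n (\<lambda>x. frechet_derivative f (at x) v)" for n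
    using assms C_diff.simps(2)[of n f] unfolding Cc_infinity_def by blast
  moreover have "{x. frechet_derivative f (at x) v \<noteq> 0} \<subseteq> closure {x. f x \<noteq> 0}"
  proof (intro subsetI CollectI, rule ccontr)
    fix x assume x: "x \<in> {x. frechet_derivative f (at x) v \<noteq> 0}" "x \<notin> closure {x. f x \<noteq> 0}"
    have "((\<lambda>_. 0) has_derivative (\<lambda>_. 0)) (at x)" by simp
    then have "(f has_derivative (\<lambda>_. 0)) (at x)"
      by (rule has_derivative_transform_within_open[where s = "- closure {x. f x \<noteq> 0}"])
         (use x(2) closure_subset[of "{x. f x \<noteq> 0}"] in auto)
    then have "frechet_derivative f (at x) = (\<lambda>_. 0)" by (metis frechet_derivative_at)
    then show False using x(1) by simp
  qed
  ultimately show ?thesis using assms unfolding Cc_infinity_def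
    by (auto simp: compact_closure intro: bounded_subset[OF bounded_closure])
qed

lemma Cc_infinity_bounded_support:
  assumes "f \<in> Cc_infinity"
  obtains R where "R > 0" "\<And>x. f x \<noteq> 0 \<Longrightarrow> norm x < R"
proof -
  have "bounded (closure {x. f x \<noteq> 0})" using assms by (simp add: Cc_infinity_def compact_imp_bounded)
  then obtain R where R: "R > 0" "\<And>x. x \<in> closure {x. f x \<noteq> 0} \<Longrightarrow> norm x < R"
    using bounded_pos_less[of "closure {x. f x \<noteq> 0}"] by blast
  then show ?thesis using that[of R] closure_subset[of "{x. f x \<noteq> 0}"] by blast
qed

lemma Cc_infinity_bounded:
  assumes "f \<in> Cc_infinity"
  obtains B where "B > 0" "\<And>x. \<bar>f x\<bar> \<le> B"
proof -
  obtain R where R: "R > 0" "\<And>x. f x \<noteq> 0 \<Longrightarrow> norm x < R" using Cc_infinity_bounded_support[OF assms]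
      by blast
  have "bounded (f ` cball 0 R)"
    by (intro compact_imp_bounded compact_continuous_image Cc_infinity_continuous assms compact_cball)
  then obtain B where B: "B > 0" "\<And>x. x \<in> cball 0 R \<Longrightarrow> \<bar>f x\<bar> \<le> B" unfolding bounded_pos by auto
  have "\<bar>f x\<bar> \<le> B" for x using B R(2)[of x] by (cases "f x = 0") force+
  then show ?thesis using that B by blast
qed

lemma integrable_Cc_infinity_mult:
  assumes "f \<in> Cc_infinity" "continuous_on UNIV g"
  shows "integrable lborel (\<lambda>x. complex_of_real (f x) * g x)"
proof -
  obtain R where R: "R > 0" "\<And>x. f x \<noteq> 0 \<Longrightarrow> norm x < R"
      using Cc_infinity_bounded_support[OF assms(1)] by blast
  have "integrable lborel (\<lambda>x. indicator (cball 0 R) x *\<^sub>R (complex_of_real (f x) * g x))"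
    using assms by (intro borel_integrable_compact continuous_intros Cc_infinity_continuous) (auto
        intro: continuous_on_subset)
  moreover have "indicator (cball 0 R) x *\<^sub>R (complex_of_real (f x) * g x)
      = complex_of_real (f x) * g x" for x
    using R(2)[of x] by (cases "f x = 0") (auto simp: indicator_def)
  ultimately show ?thesis by simp
qed

section \<open>The Fourier transform and its decay\<close>

definition fourier :: "('a::euclidean_space \<Rightarrow> real) \<Rightarrow> 'a \<Rightarrow> complex" where
  "fourier f \<xi> = (LINT x|lborel. complex_of_real (f x) * cis (- 2 * pi * (\<xi> \<bullet> x)))"

lemma integrable_fourier:
  assumes "f \<in> Cc_infinity"
  shows "integrable lborel (\<lambda>x. complex_of_real (f x) * cis (a * (\<xi> \<bullet> x)))"
  by (intro integrable_Cc_infinity_mult assms continuous_intros)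

lemma fourier_0: "fourier f 0 = complex_of_real (LINT x|lborel. f x)"
  by (simp add: fourier_def)

lemma fourier_norm_le:
  assumes "f \<in> Cc_infinity"
  shows "norm (fourier f \<xi>) \<le> (LINT x|lborel. \<bar>f x\<bar>)"
proof -
  have "norm (fourier f \<xi>) \<le> (LINT x|lborel. norm (complex_of_real (f x) * cis (- 2 * pi * (\<xi> \<bullet> x))))"
    unfolding fourier_def by (rule integral_norm_bound)
  then show ?thesis by (simp add: norm_mult)
qed

lemma fourier_translate:
  assumes "f \<in> Cc_infinity"
  shows "(LINT x|lborel. complex_of_real (f (x + v)) * cis (- 2 * pi * (\<xi> \<bullet> x)))
      = cis (2 * pi * (\<xi> \<bullet> v)) * fourier f \<xi>"
    "integrable lborel (\<lambda>x. complex_of_real (f (x + v)) * cis (- 2 * pi * (\<xi> \<bullet> x)))"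
proof -
  let ?c = "\<lambda>x. cis (- 2 * pi * (\<xi> \<bullet> x))"
  define h where "h = (\<lambda>y. cis (2 * pi * (\<xi> \<bullet> v)) * (complex_of_real (f y) * cis (- 2 * pi * (\<xi> \<bullet> y))))"
  have int: "integrable lborel h" unfolding h_def by (intro integrable_mult_right integrable_fourier
      assms)
  have hm: "h \<in> borel_measurable borel"
    unfolding h_def by (intro borel_measurable_continuous_onI continuous_intros
        Cc_infinity_continuous assms)
  have eq: "complex_of_real (f (x + v)) * ?c x = h (v + x)" for x
    by (simp add: h_def cis_mult add.commute inner_add_right algebra_simps)
  have "integrable (distr lborel borel ((+) v)) h" using int by (simp add: lborel_distr_plus)
  then show "integrable lborel (\<lambda>x. complex_of_real (f (x + v)) * ?c x)"
    unfolding eq using hm by (subst (asm) integrable_distr_eq) auto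
  have "(LINT x|lborel. h (v + x)) = (LINT x|distr lborel borel ((+) v). h x)"
    using hm by (subst integral_distr) auto
  also have "\<dots> = (LINT x|lborel. h x)" by (simp add: lborel_distr_plus)
  also have "\<dots> = cis (2 * pi * (\<xi> \<bullet> v)) * fourier f \<xi>" unfolding h_def fourier_def by simp
  finally show "(LINT x|lborel. complex_of_real (f (x + v)) * ?c x)
      = cis (2 * pi * (\<xi> \<bullet> v)) * fourier f \<xi>"
    unfolding eq .
qed

text \<open>The Fourier transform of a directional derivative is the limit of those of the difference
  quotients; this avoids integration by parts in several variables.\<close>

lemma fourier_derivative:
  assumes f: "f \<in> Cc_infinity"
  shows "fourier (\<lambda>x. frechet_derivative f (at x) v) \<xi> = 2 * pi * (\<xi> \<bullet> v) * \<i> * fourier f \<xi>"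
proof -
  let ?c = "\<lambda>x. cis (- 2 * pi * (\<xi> \<bullet> x))"
  define D where "D = (\<lambda>x. frechet_derivative f (at x) v)"
  have DC: "D \<in> Cc_infinity" unfolding D_def by (rule Cc_infinity_derivative[OF f])
  define h where "h = (\<lambda>n. inverse (real (Suc n)))"
  have h: "h n > 0" "h n \<le> 1" for n by (auto simp: h_def field_simps)
  have h0: "filterlim h (at 0) sequentially"
    using LIMSEQ_inverse_real_of_nat h(1) unfolding filterlim_at h_def by (auto intro: always_eventually)
  define q where "q = (\<lambda>n x. (f (x + h n *\<^sub>R v) - f x) / h n)"
  have line: "((\<lambda>t. f (x + t *\<^sub>R v)) has_real_derivative D (x + t *\<^sub>R v)) (at t)" for x t
  proof -
    have "(f has_derivative frechet_derivative f (at (x + t *\<^sub>R v))) (at (x + t *\<^sub>R v))"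
      using Cc_infinity_differentiable[OF f] by (simp add: frechet_derivative_works)
    then have "((\<lambda>t. f (x + t *\<^sub>R v)) has_derivative (\<lambda>s. frechet_derivative f (at (x
        + t *\<^sub>R v)) (s *\<^sub>R v))) (at t)"
      by (rule has_derivative_compose[rotated]) (auto intro!: derivative_eq_intros)
    moreover have "linear (frechet_derivative f (at (x + t *\<^sub>R v)))"
      using Cc_infinity_differentiable[OF f] by (rule linear_frechet_derivative)
    then have "(\<lambda>s. frechet_derivative f (at (x + t *\<^sub>R v)) (s *\<^sub>R v)) = (*) (D (x + t *\<^sub>R v))"
      by (auto simp: linear_cmul D_def mult.commute)
    ultimately show ?thesis unfolding has_field_derivative_def by simp
  qed
  have q_lim: "(\<lambda>n. q n x) \<longlonglongrightarrow> D x" for x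
  proof -
    have "((\<lambda>t. (f (x + t *\<^sub>R v) - f x) / t) \<longlongrightarrow> D x) (at 0)"
      using line[of x 0] by (simp add: DERIV_def)
    from filterlim_compose[OF this h0] show ?thesis by (simp add: q_def)
  qed
  obtain B where B: "B > 0" "\<And>x. \<bar>D x\<bar> \<le> B" using Cc_infinity_bounded[OF DC] by blast
  obtain R where R: "R > 0" "\<And>x. f x \<noteq> 0 \<Longrightarrow> norm x < R" using Cc_infinity_bounded_support[OF f] by blast
  \<comment> \<open>The dominating function: inside the ball the mean value theorem along the line
    bounds the quotient, and outside it both points lie off the support, since the step has length
    at most \<open>norm v\<close>.\<close>
  have q_bound: "\<bar>q n x\<bar> \<le> indicator (cball 0 (R + norm v)) x *\<^sub>R B" for n x
  proof (cases "norm x \<le> R + norm v")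
    case True
    have "\<exists>t>0. t < h n \<and> f (x + h n *\<^sub>R v) - f (x + 0 *\<^sub>R v) = (h n - 0) * D (x + t *\<^sub>R v)"
      using h by (intro MVT2) (auto intro: line)
    then have "\<bar>q n x\<bar> \<le> B" using B(2) h(1)[of n] by (auto simp: q_def abs_mult)
    then show ?thesis using True by simp
  next
    case False
    have "f x = 0" using R(2)[of x] False norm_ge_zero[of v] by (smt (verit))
    moreover have "norm x \<le> norm (x + h n *\<^sub>R v) + norm v"
    proof -
      have "norm x \<le> norm (x + h n *\<^sub>R v) + norm (h n *\<^sub>R v)"
        using norm_triangle_ineq4[of "x + h n *\<^sub>R v" "h n *\<^sub>R v"] by simp
      also have "norm (h n *\<^sub>R v) \<le> 1 * norm v" using h[of n] by (simp add: mult_left_le_one_le)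
      finally show ?thesis by simp
    qed
    then have "f (x + h n *\<^sub>R v) = 0" using R(2)[of "x + h n *\<^sub>R v"] False by (smt (verit))
    ultimately show ?thesis using B by (simp add: q_def)
  qed
  have int_q: "(LINT x|lborel. complex_of_real (q n x) * ?c x)
      = (cis (2 * pi * (\<xi> \<bullet> v) * h n) - 1) / h n * fourier f \<xi>" for n
  proof -
    have "(LINT x|lborel. complex_of_real (q n x) * ?c x)
      = (LINT x|lborel. (complex_of_real (f (x + h n *\<^sub>R v)) * ?c x - complex_of_real (f x)
          * ?c x) / h n)"
      by (intro Bochner_Integration.integral_cong) (auto simp: q_def field_simps)
    also have "\<dots> = ((LINT x|lborel. complex_of_real (f (x + h n *\<^sub>R v)) * ?c x) - fourier f \<xi>) / h n"
      unfolding fourier_def using fourier_translate(2)[OF f] integrable_fourier[OF f, of "- 2 * pi" \<xi>]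
      by (subst Bochner_Integration.integral_diff[symmetric]) auto
    also have "\<dots> = (cis (2 * pi * (\<xi> \<bullet> v) * h n) - 1) / h n * fourier f \<xi>"
      unfolding fourier_translate(1)[OF f] by (simp add: algebra_simps)
    finally show ?thesis .
  qed
  have "(\<lambda>n. (LINT x|lborel. complex_of_real (q n x) * ?c x)) \<longlonglongrightarrow> fourier D \<xi>"
    unfolding fourier_def
  proof (rule integral_dominated_convergence[where w = "\<lambda>x. indicator (cball 0 (R + norm v)) x *\<^sub>R B"])
    have cont: "continuous_on UNIV f" by (rule Cc_infinity_continuous[OF f])
    have cf: "continuous_on UNIV (\<lambda>x. f (x + h n *\<^sub>R v))" for n
      by (rule continuous_on_compose2[OF cont]) (auto intro!: continuous_intros)
    show "(\<lambda>x. complex_of_real (q n x) * ?c x) \<in> borel_measurable lborel" for n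
      unfolding q_def using h(1)[of n]
      by (simp, intro borel_measurable_continuous_onI continuous_intros cf cont) auto
    show "(\<lambda>x. complex_of_real (D x) * ?c x) \<in> borel_measurable lborel"
      using integrable_fourier[OF DC, of "- 2 * pi" \<xi>] by (rule borel_measurable_integrable)
    show "integrable lborel (\<lambda>x::'a. indicator (cball 0 (R + norm v)) x *\<^sub>R B)"
      by (rule borel_integrable_compact) auto
    show "AE x in lborel. (\<lambda>n. complex_of_real (q n x) * ?c x) \<longlonglongrightarrow> complex_of_real (D x) * ?c x"
      by (intro AE_I2 tendsto_intros q_lim)
    show "AE x in lborel. norm (complex_of_real (q n x) * ?c x)
        \<le> indicator (cball 0 (R + norm v)) x *\<^sub>R B" for n
      using q_bound[of n] by (intro AE_I2) (simp add: norm_mult)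
  qed
  moreover have "(\<lambda>n. (cis (2 * pi * (\<xi> \<bullet> v) * h n) - 1) / h n * fourier f \<xi>) \<longlonglongrightarrow> (2 * pi * (\<xi> \<bullet> v)
      * \<i>) * fourier f \<xi>"
  proof (intro tendsto_mult tendsto_const)
    define a where "a = complex_of_real (2 * pi * (\<xi> \<bullet> v))"
    have "((\<lambda>z. exp (\<i> * a * z)) has_field_derivative \<i> * a) (at 0)"
      by (auto intro!: derivative_eq_intros)
    then have "((\<lambda>z. (exp (\<i> * a * z) - 1) / z) \<longlongrightarrow> \<i> * a) (at 0)" by (simp add: DERIV_def)
    moreover have "filterlim (\<lambda>n. complex_of_real (h n)) (at 0) sequentially"
      using h0 tendsto_of_real[of h 0 sequentially, where 'a = complex] by (simp add: filterlim_at)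
    ultimately have "(\<lambda>n. (exp (\<i> * a * complex_of_real (h n)) - 1) / complex_of_real (h n)) \<longlonglongrightarrow> \<i> * a"
      by (rule filterlim_compose)
    then show "(\<lambda>n. (cis (2 * pi * (\<xi> \<bullet> v) * h n) - 1) / h n) \<longlonglongrightarrow> 2 * pi * (\<xi> \<bullet> v) * \<i>"
      by (simp add: a_def cis_conv_exp mult_ac)
  qed
  ultimately show ?thesis unfolding int_q D_def by (rule LIMSEQ_unique)
qed

text \<open>Each derivative along \<open>v\<close> supplies a factor of modulus 2 \<pi> times that
  of \<open>\<xi> \<bullet> v\<close> and stays in \<open>Cc_infinity\<close>; the factor 2 \<pi>
  \<ge> 1 is given away.\<close>

lemma fourier_decay_direction:
  assumes "f \<in> Cc_infinity"
  shows "\<exists>C. \<forall>\<xi>. \<bar>\<xi> \<bullet> v\<bar> ^ m * norm (fourier f \<xi>) \<le> C"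
  using assms
proof (induction m arbitrary: f)
  case 0
  then show ?case using fourier_norm_le by auto
next
  case (Suc m)
  obtain C where C: "\<And>\<xi>. \<bar>\<xi> \<bullet> v\<bar> ^ m * norm (fourier (\<lambda>x. frechet_derivative f (at x) v) \<xi>) \<le> C"
    using Suc.IH[OF Cc_infinity_derivative[OF Suc.prems]] by blast
  have "\<bar>\<xi> \<bullet> v\<bar> ^ Suc m * norm (fourier f \<xi>) \<le> C" for \<xi>
  proof -
    have "\<bar>\<xi> \<bullet> v\<bar> ^ Suc m * norm (fourier f \<xi>) = \<bar>\<xi> \<bullet> v\<bar> ^ m * (1 * (\<bar>\<xi> \<bullet> v\<bar> * norm (fourier f \<xi>)))"
        by simp
    also have "\<dots> \<le> \<bar>\<xi> \<bullet> v\<bar> ^ m * ((2 * pi) * (\<bar>\<xi> \<bullet> v\<bar> * norm (fourier f \<xi>)))"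
      using pi_ge_two by (intro mult_left_mono mult_right_mono) auto
    also have "(2 * pi) * (\<bar>\<xi> \<bullet> v\<bar> * norm (fourier f \<xi>))
        = norm (fourier (\<lambda>x. frechet_derivative f (at x) v) \<xi>)"
      by (simp add: fourier_derivative[OF Suc.prems] norm_mult)
    also have "\<bar>\<xi> \<bullet> v\<bar> ^ m * \<dots> \<le> C" by (rule C)
    finally show ?thesis .
  qed
  then show ?case by blast
qed

text \<open>Decay in all coordinates at once follows from decay in the largest one: a product of
  \<open>CARD('n)\<close> factors to the power r is at most the largest factor to the power r times
  \<open>CARD('n)\<close>. So repeated derivatives along single axes suffice.\<close>

lemma fourier_decay:
  fixes f :: "real ^ 'n \<Rightarrow> real"
  assumes f: "f \<in> Cc_infinity"
  shows "\<exists>C\<ge>0. \<forall>\<xi>. norm (fourier f \<xi>) \<le> C * (\<Prod>i\<in>UNIV. 1 / (1 + \<bar>\<xi> $ i\<bar>) ^ r)"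
proof -
  define m where "m = r * CARD('n)"
  have "\<forall>i::'n. \<exists>C. \<forall>\<xi>. \<bar>\<xi> \<bullet> axis i 1\<bar> ^ m * norm (fourier f \<xi>) \<le> C"
    using fourier_decay_direction[OF f] by blast
  then obtain C where C: "\<And>(i::'n) \<xi>. \<bar>\<xi> $ i\<bar> ^ m * norm (fourier f \<xi>) \<le> C i"
    by (metis (no_types, lifting) inner_axis real_inner_1_right)
  define C0 where "C0 = (LINT x|lborel. \<bar>f x\<bar>)"
  have C0: "norm (fourier f \<xi>) \<le> C0" for \<xi> unfolding C0_def by (rule fourier_norm_le[OF f])
  have C0nn: "C0 \<ge> 0" using C0[of 0] norm_ge_zero order_trans by blast
  have Cnn: "C i \<ge> 0" for i using C[where i = i and \<xi> = 0]
      by (smt (verit) mult_nonneg_nonneg norm_ge_zero zero_le_power abs_ge_zero)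
  define K where "K = (\<Sum>i\<in>UNIV. 2 ^ m * (C0 + C i))"
  have "norm (fourier f \<xi>) \<le> K * (\<Prod>i\<in>UNIV. 1 / (1 + \<bar>\<xi> $ i\<bar>) ^ r)" for \<xi>
  proof -
    define a where "a = (\<lambda>i. 1 + \<bar>\<xi> $ i\<bar>)"
    have a1: "a i \<ge> 1" for i by (simp add: a_def)
    obtain i0 where "a i0 = Max (range a)" using Max_in[of "range a"]
        by (metis finite finite_imageI UNIV_not_empty empty_is_image imageE)
    then have i0: "\<And>i. a i \<le> a i0" by simp
    have "(\<Prod>i\<in>UNIV. a i ^ r) \<le> (\<Prod>i\<in>(UNIV::'n set). a i0 ^ r)"
      using i0 a1 by (intro prod_mono conjI power_mono) (auto intro: order_trans[OF zero_le_one])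
    also have "\<dots> = a i0 ^ m" by (simp add: m_def power_mult)
    finally have le: "(\<Prod>i\<in>UNIV. a i ^ r) \<le> a i0 ^ m" .
    have "a i0 ^ m \<le> (2 * max 1 \<bar>\<xi> $ i0\<bar>) ^ m" using a1[of i0] by (intro power_mono) (auto simp: a_def)
    also have "\<dots> \<le> 2 ^ m * (1 + \<bar>\<xi> $ i0\<bar> ^ m)"
      by (auto simp: power_mult_distrib max_def)
    finally have "a i0 ^ m * norm (fourier f \<xi>) \<le> 2 ^ m * (1 + \<bar>\<xi> $ i0\<bar> ^ m) * norm (fourier f \<xi>)"
      by (intro mult_right_mono) auto
    also have "\<dots> = 2 ^ m * (norm (fourier f \<xi>) + \<bar>\<xi> $ i0\<bar> ^ m * norm (fourier f \<xi>))"
        by (simp add: algebra_simps)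
    also have "\<dots> \<le> 2 ^ m * (C0 + C i0)" using C0[of \<xi>] C[of \<xi> i0] by (intro mult_left_mono add_mono) auto
    also have "\<dots> \<le> K" unfolding K_def using C0nn Cnn by (intro member_le_sum) auto
    finally have "(\<Prod>i\<in>UNIV. a i ^ r) * norm (fourier f \<xi>) \<le> K"
      using le by (smt (verit) mult_right_mono norm_ge_zero)
    moreover have "(\<Prod>i\<in>UNIV. a i ^ r) > 0" using a1
        by (intro prod_pos zero_less_power) (auto intro: less_le_trans[OF zero_less_one])
    ultimately have "norm (fourier f \<xi>) \<le> K / (\<Prod>i\<in>UNIV. a i ^ r)"
        by (simp add: pos_le_divide_eq mult.commute)
    then show ?thesis by (simp add: a_def prod_dividef)
  qed
  moreover have "K \<ge> 0" unfolding K_def using C0nn Cnn by (intro sum_nonneg) auto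
  ultimately show ?thesis by blast
qed

lemma integral_lborel_prod_Basis:
  fixes h :: "'a::euclidean_space \<Rightarrow> real \<Rightarrow> complex"
  assumes "\<And>b. b \<in> Basis \<Longrightarrow> integrable lborel (h b)"
  shows "(LINT x|lborel. (\<Prod>b\<in>Basis. h b (x \<bullet> b))) = (\<Prod>b\<in>Basis. (LINT t|lborel. h b t))"
proof -
  interpret product_sigma_finite "\<lambda>_::'a. lborel :: real measure" by standard
  have m: "h b \<in> borel_measurable borel" if "b \<in> Basis" for b
    using borel_measurable_integrable[OF assms[OF that]] by simp
  have "(\<lambda>x. \<Prod>b\<in>Basis. h b (x \<bullet> b)) \<in> borel_measurable borel"
    by (intro borel_measurable_prod measurable_compose[OF _ m] borel_measurable_inner) auto
  then have "(LINT x|lborel. (\<Prod>b\<in>Basis. h b (x \<bullet> b)))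
     = (LINT x|(\<Pi>\<^sub>M b\<in>Basis. lborel). (\<Prod>b\<in>Basis. h b ((\<Sum>b\<in>Basis. x b *\<^sub>R b) \<bullet> b)))"
    by (subst lborel_eq, subst integral_distr) auto
  also have "\<dots> = (LINT x|(\<Pi>\<^sub>M b\<in>Basis. lborel). (\<Prod>b\<in>Basis. h b (x b)))"
    by (intro Bochner_Integration.integral_cong refl prod.cong) (auto simp: inner_sum_left_Basis)
  also have "\<dots> = (\<Prod>b\<in>Basis. (LINT t|lborel. h b t))"
    by (rule product_integral_prod) (use assms in auto)
  finally show ?thesis .
qed

lemma integral_lborel_prod_vec:
  fixes h :: "'n::finite \<Rightarrow> real \<Rightarrow> complex"
  assumes "\<And>i. integrable lborel (h i)"
  shows "(LINT x|lborel. (\<Prod>i\<in>UNIV. h i ((x :: real ^ 'n) $ i))) = (\<Prod>i\<in>UNIV. (LINT t|lborel. h i t))"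
proof -
  define ax :: "'n \<Rightarrow> real ^ 'n" where "ax = (\<lambda>i. axis i 1)"
  have inj: "inj ax" by (auto simp: ax_def inj_on_def axis_eq_axis)
  have B: "(Basis :: (real ^ 'n) set) = range ax" by (auto simp: Basis_vec_def ax_def)
  have "(LINT x|lborel. (\<Prod>b\<in>Basis. h (inv ax b) ((x :: real ^ 'n) \<bullet> b)))
      = (\<Prod>b\<in>Basis. (LINT t|lborel. h (inv ax b) t))"
    by (rule integral_lborel_prod_Basis) (rule assms)
  moreover have "x \<bullet> ax i = x $ i" for x i by (simp add: ax_def inner_axis)
  ultimately show ?thesis
    unfolding B prod.reindex[OF inj] by (simp add: inv_f_f[OF inj] o_def)
qed

section \<open>Integer frequencies and characters of the cube\<close>

definition int_vec :: "int ^ 'n \<Rightarrow> real ^ 'n" where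
  "int_vec n = (\<chi> i. real_of_int (n $ i))"

lemma int_vec_add: "int_vec (n + m) = int_vec n + int_vec m"
  and int_vec_minus: "int_vec (- n) = - int_vec n"
  and int_vec_eq_0: "int_vec n = 0 \<longleftrightarrow> n = 0"
  by (auto simp: int_vec_def vec_eq_iff)

definition cube :: "real \<Rightarrow> (real ^ 'n) set" where
  "cube N = cbox (\<chi> i. - N / 2) (\<chi> i. N / 2)"

lemma mem_cube: "x \<in> cube N \<longleftrightarrow> (\<forall>i. \<bar>x $ i\<bar> \<le> N / 2)"
proof -
  have "\<bar>y\<bar> \<le> N / 2 \<longleftrightarrow> - N / 2 \<le> y \<and> y \<le> N / 2" for y by auto
  then show ?thesis by (simp only: cube_def mem_box_cart vec_lambda_beta)
qed

definition character :: "real \<Rightarrow> int ^ 'n \<Rightarrow> real ^ 'n \<Rightarrow> complex" where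
  "character N n x = cis (2 * pi * (int_vec n \<bullet> x) / N)"

lemma character_continuous: "continuous_on S (character N n)"
  unfolding character_def by (cases "N = 0") (auto intro!: continuous_intros)

lemma norm_character [simp]: "norm (character N n x) = 1"
  by (simp add: character_def)

lemma character_mult: "character N n x * character N m x = character N (n + m) x"
  by (simp add: character_def cis_mult int_vec_add inner_add_left add_divide_distrib distrib_left)

lemma integral_cis_period:
  fixes N :: real and m :: int
  assumes "N > 0"
  shows "integral {- N / 2..N / 2} (\<lambda>t. cis (2 * pi * (real_of_int m * t) / N)) = (if m
      = 0 then of_real N else 0)"
proof (cases "m = 0")
  case False
  define a where "a = 2 * pi * real_of_int m / N"
  have a: "a \<noteq> 0" using assms False by (simp add: a_def)
  have "((\<lambda>t. cis (a * t)) has_integral (cis (a * (N / 2)) / (\<i> * a) - cis (a * (- N / 2)) / (\<i>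
      * a))) {- N / 2..N / 2}"
  proof (rule fundamental_theorem_of_calculus)
    fix t
    have "((\<lambda>z. exp (\<i> * a * z) / (\<i> * a)) has_field_derivative exp (\<i> * a
        * of_real t)) (at (of_real t))"
      using a by (auto intro!: derivative_eq_intros)
    then have "((\<lambda>t. exp (\<i> * a * of_real t) / (\<i> * a)) has_vector_derivative exp (\<i> * a
        * of_real t)) (at t within {- N / 2..N / 2})"
      using field_vector_diff_chain_within[of of_real 1 t "{- N / 2..N / 2}" "\<lambda>z. exp (\<i> * a
          * z) / (\<i> * a)" "exp (\<i> * a * of_real t)"]
        has_vector_derivative_of_real[where 'a = complex, OF DERIV_ident]
      by (auto simp: o_def intro: has_field_derivative_at_within)
    then show "((\<lambda>t. cis (a * t) / (\<i> * a)) has_vector_derivative cis (a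
        * t)) (at t within {- N / 2..N / 2})"
      by (simp add: cis_conv_exp mult_ac)
  qed (use assms in auto)
  moreover have "cis (a * (N / 2)) = cis (a * (- N / 2))"
  proof -
    have e: "a * (N / 2) = a * (- N / 2) + 2 * pi * real_of_int m" using assms
        by (simp add: a_def field_simps)
    show ?thesis unfolding e cis_mult[symmetric] by (simp add: cis_multiple_2pi)
  qed
  ultimately have "((\<lambda>t. cis (a * t)) has_integral 0) {- N / 2..N / 2}" by simp
  moreover have "(\<lambda>t. cis (a * t)) = (\<lambda>t. cis (2 * pi * (real_of_int m * t) / N))"
      by (simp add: a_def mult.assoc)
  ultimately show ?thesis using False by (simp add: integral_unique)
qed (use assms in \<open>simp add: scaleR_conv_of_real\<close>)

text \<open>Orthogonality on the cube: indicator and character both split into factors of one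
  variable, each integrated over a full period.\<close>

lemma integral_character:
  fixes n :: "int ^ 'n"
  assumes N: "N > 0"
  shows "integral (cube N) (character N n) = (if n = 0 then of_real N ^ CARD('n) else 0)"
proof -
  define h where "h = (\<lambda>i t. indicator {- N / 2..N / 2} t *\<^sub>R cis (2 * pi * (real_of_int (n $ i)
      * t) / N))"
  have sint: "set_integrable lborel {- N / 2..N / 2} (\<lambda>t. cis (2 * pi * (real_of_int (n $ i)
      * t) / N))" for i
    unfolding set_integrable_def using N by (intro borel_integrable_compact continuous_intros) auto
  have hint: "integrable lborel (h i)" for i
    using sint[of i] unfolding set_integrable_def h_def .
  have hval: "(LINT t|lborel. h i t) = (if n $ i = 0 then of_real N else 0)" for i
    using set_borel_integral_eq_integral(2)[OF sint[of i]] integral_cis_period[OF N, of "n $ i"]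
    by (simp add: h_def set_lebesgue_integral_def)
  have cint: "set_integrable lborel (cube N) (character N n)"
    unfolding set_integrable_def by (intro borel_integrable_compact character_continuous) (simp add:
        cube_def)
  have "indicator (cube N) x *\<^sub>R character N n x = (\<Prod>i\<in>UNIV. h i (x $ i))" for x
  proof -
    have cis_sum: "cis (sum g S) = (\<Prod>i\<in>S. cis (g i))" if "finite S" for g and S :: "'n set"
      using that by (induction S rule: finite_induct) (simp_all add: cis_mult[symmetric])
    have "2 * pi * (int_vec n \<bullet> x) / N = (\<Sum>i\<in>UNIV. 2 * pi * (real_of_int (n $ i) * x $ i) / N)"
      by (simp add: inner_vec_def int_vec_def sum_distrib_left sum_divide_distrib)
    then have "character N n x = (\<Prod>i\<in>UNIV. cis (2 * pi * (real_of_int (n $ i) * x $ i) / N))"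
      by (simp add: character_def cis_sum)
    moreover have "(indicator (cube N) x :: real) = (\<Prod>i\<in>UNIV. indicator {- N / 2..N / 2} (x $ i))"
    proof -
      have "x \<in> cube N \<longleftrightarrow> (\<forall>i. x $ i \<in> {- N / 2..N / 2})" by (simp add: cube_def mem_box_cart)
      then show ?thesis
        by (cases "x \<in> cube N") (auto simp: indicator_def)
    qed
    ultimately show ?thesis
      by (simp add: h_def scaleR_conv_of_real prod.distrib flip: of_real_prod)
  qed
  then have "(LINT x:cube N|lborel. character N n x) = (LINT x|lborel. (\<Prod>i\<in>UNIV. h i (x $ i)))"
    by (simp add: set_lebesgue_integral_def)
  also have "\<dots> = (\<Prod>i\<in>UNIV. if n $ i = 0 then of_real N else 0)"
    by (simp add: integral_lborel_prod_vec[OF hint] hval)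
  also have "\<dots> = (if n = 0 then of_real N ^ CARD('n) else 0)"
    by (auto simp: vec_eq_iff prod_zero_iff)
  finally show ?thesis using set_borel_integral_eq_integral(2)[OF cint] by simp
qed

text \<open>Testing against powers of a trigonometric polynomial with a strict maximum at a point isolates
  the value of \<open>D\<close> there.\<close>

lemma fourier_uniqueness:
  fixes D :: "real ^ 'n \<Rightarrow> complex"
  assumes N: "N > 0" and cont: "continuous_on (cube N) D"
    and zero: "\<And>n. integral (cube N) (\<lambda>x. D x * character N n x) = 0"
    and x0: "\<And>i. \<bar>x0 $ i\<bar> < N / 2"
  shows "D x0 = 0"
proof (rule ccontr)
  assume nz: "D x0 \<noteq> 0"
  let ?box = "box (\<chi> i. - N / 2) (\<chi> i. N / 2) :: (real ^ 'n) set"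
  let ?u = "\<lambda>i. cis (- 2 * pi * x0 $ i / N) / 2"
  let ?v = "\<lambda>i. cis (2 * pi * x0 $ i / N) / 2"
  define d where "d = real CARD('n)"
  have d: "d > 0" by (simp add: d_def)
  \<comment> \<open>A nonnegative trigonometric polynomial with maximum \<open>2 * d\<close>. Since
    \<open>x0\<close> is interior, differences to points of the cube stay below one period N, so the
    maximum is attained at \<open>x0\<close> alone.\<close>
  define q where "q = (\<lambda>x. \<Sum>i\<in>(UNIV :: 'n set). 1 + cos (2 * pi * (x $ i - x0 $ i) / N))"
  \<comment> \<open>The factor \<open>cnj (D x0)\<close> turns the value at \<open>x0\<close> into
    the positive number |D x0|^2.\<close>
  define E where "E = (\<lambda>x. Re (cnj (D x0) * D x))"
  have cq: "continuous_on S q" for S unfolding q_def using N by (intro continuous_intros) auto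
  have cE: "continuous_on (cube N) E" unfolding E_def by (intro continuous_intros cont)
  have comp: "compact (cube N :: (real ^ 'n) set)" by (simp add: cube_def)
  have q_le: "0 \<le> q x" "q x \<le> 2 * d" for x
  proof -
    show "0 \<le> q x" unfolding q_def by (intro sum_nonneg) (smt (verit) cos_ge_minus_one)
    have "q x \<le> (\<Sum>i\<in>(UNIV :: 'n set). 2)" unfolding q_def by (intro sum_mono) (smt (verit) cos_le_one)
    then show "q x \<le> 2 * d" by (simp add: d_def)
  qed
  have q0: "q x0 = 2 * d" by (simp add: q_def d_def)
  have q_max: "x = x0" if "x \<in> cube N" "q x = 2 * d" for x
  proof (rule ccontr)
    assume "x \<noteq> x0"
    then obtain i where i: "x $ i \<noteq> x0 $ i" by (auto simp: vec_eq_iff)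
    define u where "u = 2 * pi * (x $ i - x0 $ i) / N"
    have "\<bar>x $ i - x0 $ i\<bar> < N" using that(1) x0[of i] unfolding mem_cube
        by (smt (verit) field_sum_of_halves)
    then have "2 * pi * (\<bar>x $ i - x0 $ i\<bar> / N) < 2 * pi * 1" using N
        by (intro mult_strict_left_mono) auto
    moreover have "\<bar>u\<bar> = 2 * pi * (\<bar>x $ i - x0 $ i\<bar> / N)" using N by (simp add: u_def abs_mult)
    ultimately have u: "\<bar>u\<bar> < 2 * pi" "u \<noteq> 0" using N i by (auto simp: u_def)
    have "cos u \<noteq> 1"
    proof
      assume "cos u = 1"
      then obtain k :: int where k: "u = real_of_int k * 2 * pi" using cos_one_2pi_int by blast
      then have "\<bar>real_of_int k\<bar> < 1" using u by (simp add: abs_mult)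
      then have "k = 0" by linarith
      then show False using k u by simp
    qed
    then have "cos u < 1" using cos_le_one[of u] by linarith
    have "q x < (\<Sum>j\<in>(UNIV :: 'n set). 2)"
      unfolding q_def by (rule sum_strict_mono_ex1) (use \<open>cos u < 1\<close> in \<open>auto simp: u_def intro!:
          exI[of _ i]\<close>)
    then show False using that by (simp add: d_def)
  qed
  \<comment> \<open>Multiplication by \<open>q\<close> shifts frequencies by unit vectors, so the
    induction has to run over all frequencies at once.\<close>
  have powers: "integral (cube N) (\<lambda>x. D x * of_real (q x) ^ M * character N n x) = 0" for M n
  proof (induction M arbitrary: n)
    case 0
    then show ?case using zero[of n] by simp
  next
    case (Suc M)
    define e where "e = (\<lambda>i::'n. axis i (1::int))"
    have cos_char: "complex_of_real (cos (2 * pi * (x $ i - x0 $ i) / N))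
       = ?u i * character N (e i) x + ?v i * character N (- e i) x" for x i
    proof -
      have iv: "int_vec (e i) \<bullet> x = x $ i"
      proof -
        have "int_vec (e i) = axis i 1" by (auto simp: int_vec_def e_def axis_def vec_eq_iff)
        then show ?thesis by (simp add: inner_axis')
      qed
      have "cis (- 2 * pi * x0 $ i / N) * character N (e i) x = cis (2 * pi * (x $ i - x0 $ i) / N)"
        unfolding character_def iv cis_mult by (simp add: diff_divide_distrib right_diff_distrib)
      moreover have "cis (2 * pi * x0 $ i / N) * character N (- e i) x
          = cis (- (2 * pi * (x $ i - x0 $ i) / N))"
        unfolding character_def int_vec_minus inner_minus_left iv cis_mult
            by (simp add: diff_divide_distrib right_diff_distrib)
      ultimately show ?thesis by (simp add: complex_eq_iff)
    qed
    define F where "F = (\<lambda>n x. D x * of_real (q x) ^ M * character N n x)"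
    have Fint: "F n integrable_on cube N" for n
      unfolding F_def cube_def
      by (intro integrable_continuous continuous_intros character_continuous cq cont[unfolded cube_def])
    have "D x * of_real (q x) ^ Suc M * character N n x
       = (\<Sum>i\<in>UNIV. F n x + ?u i * F (n + e i) x + ?v i * F (n - e i) x)" for x
    proof -
      have "complex_of_real (q x) = (\<Sum>i\<in>UNIV. 1 + ?u i * character N (e i) x + ?v i
          * character N (- e i) x)"
        unfolding q_def of_real_sum of_real_add cos_char by (simp add: add.assoc)
      then have "F n x * complex_of_real (q x) = (\<Sum>i\<in>UNIV. F n x *
          (1 + ?u i * character N (e i) x + ?v i * character N (- e i) x))"
        by (simp only: sum_distrib_left)
      moreover have "D x * of_real (q x) ^ Suc M * character N n x = F n x * complex_of_real (q x)"
        by (simp add: F_def mult_ac)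
      ultimately have "D x * of_real (q x) ^ Suc M * character N n x = (\<Sum>i\<in>UNIV. F n x *
          (1 + ?u i * character N (e i) x + ?v i * character N (- e i) x))"
        by simp
      also have "\<dots> = (\<Sum>i\<in>UNIV. F n x + ?u i * F (n + e i) x + ?v i * F (n - e i) x)"
        by (intro sum.cong refl) (simp add: F_def character_mult[symmetric] diff_conv_add_uminus
            algebra_simps del: add_uminus_conv_diff)
      finally show ?thesis .
    qed
    then have "integral (cube N) (\<lambda>x. D x * of_real (q x) ^ Suc M * character N n x)
       = integral (cube N) (\<lambda>x. \<Sum>i\<in>UNIV. F n x + ?u i * F (n + e i) x + ?v i * F (n - e i) x)"
      by simp
    also have "\<dots> = (\<Sum>i\<in>UNIV. integral (cube N) (F n) + ?u i * integral (cube N) (F (n + e i)) + ?v i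
        * integral (cube N) (F (n - e i)))"
      by (intro integral_unique has_integral_sum has_integral_add has_integral_mult_right
          integrable_integral Fint) auto
    also have "\<dots> = 0" using Suc.IH by (simp add: F_def)
    finally show ?case .
  qed
  have E_powers: "integral (cube N) (\<lambda>x. E x * q x ^ M) = 0" for M
  proof -
    have int: "(\<lambda>x. D x * of_real (q x) ^ M) integrable_on cube N"
      unfolding cube_def by (intro integrable_continuous continuous_intros cq cont[unfolded cube_def])
    have "integral (cube N) (\<lambda>x. D x * of_real (q x) ^ M) = 0"
      using powers[of M 0] by (simp add: character_def int_vec_eq_0[THEN iffD2])
    then have "((\<lambda>x. D x * of_real (q x) ^ M) has_integral 0) (cube N)" using int
        by (metis integrable_integral)
    from has_integral_Re[OF has_integral_mult_right[OF this, of "cnj (D x0)"]]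
    have "((\<lambda>x. Re (cnj (D x0) * (D x * of_real (q x) ^ M))) has_integral 0) (cube N)" by simp
    moreover have "Re (cnj (D x0) * (D x * of_real (q x) ^ M)) = E x * q x ^ M" for x
      by (simp add: E_def mult.assoc[symmetric] flip: of_real_power)
    ultimately show ?thesis by (simp add: integral_unique)
  qed
  define a where "a = E x0"
  have "cnj (D x0) * D x0 = complex_of_real ((cmod (D x0))\<^sup>2)"
      by (simp only: complex_norm_square mult.commute)
  then have "a = (cmod (D x0))\<^sup>2" by (simp only: a_def E_def Re_complex_of_real)
  then have a: "a > 0" using nz by simp
  have "- N / 2 < x0 $ i \<and> x0 $ i < N / 2" for i using x0[of i] by linarith
  then have x0Q: "x0 \<in> ?box" by (simp only: mem_box_cart vec_lambda_beta simp_thms)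
  have boxQ: "?box \<subseteq> (cube N :: (real ^ 'n) set)" unfolding cube_def by (rule box_subset_cbox)
  have cEbox: "continuous_on (?box) E" using cE boxQ continuous_on_subset by blast
  have "open {x \<in> ?box. E x \<in> {a / 2<..}}"
    using continuous_open_preimage[OF cEbox open_box, of "{a / 2<..}"] by (simp add: vimage_def Int_def)
  moreover have "x0 \<in> {x \<in> ?box. E x \<in> {a / 2<..}}"
    using x0Q a by (simp add: a_def)
  ultimately obtain \<delta> where \<delta>: "\<delta> > 0" "ball x0 \<delta> \<subseteq> {x \<in> ?box. E x \<in> {a / 2<..}}"
    by (meson open_contains_ball)
  have near: "x \<in> cube N" "E x > a / 2" if "x \<in> ball x0 \<delta>" for x using \<delta>(2) that boxQ by auto
  obtain p where p: "p < 2 * d" "p > 0" "\<And>x. x \<in> cube N \<Longrightarrow> x \<notin> ball x0 \<delta> \<Longrightarrow> q x \<le> p"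
  proof (cases "cube N - ball x0 \<delta> = {}")
    case True
    then show ?thesis using d by (intro that[of d]) auto
  next
    case False
    have "compact (cube N - ball x0 \<delta>)" using comp by (simp add: compact_diff)
    then obtain y where y: "y \<in> cube N - ball x0 \<delta>" "\<And>x. x \<in> cube N - ball x0 \<delta> \<Longrightarrow> q x \<le> q y"
      using continuous_attains_sup[OF _ False cq] by blast
    have "y \<noteq> x0" using y(1) \<delta>(1) by auto
    then have "q y < 2 * d" using q_max[of y] q_le(2)[of y] y(1) by fastforce
    then show ?thesis using y d by (intro that[of "max d (q y)"]) (auto simp: le_max_iff_disj)
  qed
  \<comment> \<open>A level strictly between the bound \<open>p\<close> away from \<open>x0\<close>
    and the maximum. On a box of positive volume near \<open>x0\<close> the integrand is at least of
    size p'^M, while elsewhere its negative part is at most of size p^M; this cannot balance to zero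
    for large M.\<close>
  define p' where "p' = (p + 2 * d) / 2"
  have p': "p < p'" "p' < 2 * d" using p by (auto simp: p'_def)
  have "open (q -` {p'<..})" using cq[of UNIV] by (simp add: continuous_on_open_vimage[OF open_UNIV])
  then have "open (ball x0 \<delta> \<inter> q -` {p'<..})" by auto
  moreover have "x0 \<in> ball x0 \<delta> \<inter> q -` {p'<..}" using \<delta> p' q0 by auto
  ultimately obtain l r where lr: "cbox l r \<subseteq> ball x0 \<delta> \<inter> q -` {p'<..}" "\<forall>i\<in>Basis. l \<bullet> i < r \<bullet> i"
    by (rule open_contains_cbox)
  have content: "measure lborel (cbox l r) > 0" using lr(2) by (simp add: content_pos_lt)
  obtain B where B: "B > 0" "\<And>x. x \<in> cube N \<Longrightarrow> \<bar>E x\<bar> \<le> B"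
    using compact_imp_bounded[OF compact_continuous_image[OF cE comp]] unfolding bounded_pos by auto
  have bound: "a / 2 * p' ^ M * measure lborel (cbox l r)
      \<le> B * p ^ M * measure lborel (cube N :: (real ^ 'n) set)" for M
  proof -
    have sub: "cbox l r \<subseteq> cube N" using lr near by auto
    have i1: "((\<lambda>x. a / 2 * p' ^ M) has_integral (a / 2 * p' ^ M
        * measure lborel (cbox l r))) (cbox l r)"
      using has_integral_const[of "a / 2 * p' ^ M" l r] by (simp add: mult.commute)
    have i1': "((\<lambda>x. if x \<in> cbox l r then a / 2 * p' ^ M else 0) has_integral (a / 2 * p' ^ M
        * measure lborel (cbox l r))) (cube N)"
      using i1 sub by (subst has_integral_restrict) auto
    have i2: "((\<lambda>x :: real ^ 'n. B * p ^ M) has_integral (B * p ^ M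
        * measure lborel (cube N :: (real ^ 'n) set))) (cube N)"
      unfolding cube_def using has_integral_const[of "B * p ^ M" "(\<chi> i.
          - N / 2) :: real ^ 'n" "\<chi> i. N / 2"] by (simp add: mult.commute)
    have "(\<lambda>x. E x * q x ^ M) integrable_on cube N"
      unfolding cube_def by (intro integrable_continuous continuous_intros cq cE[unfolded cube_def])
    from integrable_integral[OF this] have i3: "((\<lambda>x. E x * q x ^ M) has_integral 0) (cube N)"
      by (simp only: E_powers)
    have "a / 2 * p' ^ M * measure lborel (cbox l r) - B * p ^ M
        * measure lborel (cube N :: (real ^ 'n) set) \<le> 0"
    proof (rule has_integral_le[OF has_integral_diff[OF i1' i2] i3])
      fix x :: "real ^ 'n" assume x: "x \<in> cube N"
      show "(if x \<in> cbox l r then a / 2 * p' ^ M else 0) - B * p ^ M \<le> E x * q x ^ M"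
      proof (cases "x \<in> ball x0 \<delta>")
        case True
        have Ex: "E x > a / 2" using near[OF True] by simp
        have Bp: "0 \<le> B * p ^ M" using B p by simp
        show ?thesis
        proof (cases "x \<in> cbox l r")
          case in_box: True
          then have "p' ^ M \<le> q x ^ M" using lr(1) p p' by (intro power_mono) auto
          then have "a / 2 * p' ^ M \<le> E x * q x ^ M" using Ex a p p' by (intro mult_mono) auto
          then show ?thesis using in_box Bp by simp
        next
          case False
          have "0 \<le> E x * q x ^ M" using Ex a q_le by auto
          then show ?thesis using False Bp by simp
        qed
      next
        case False
        have "\<bar>E x * q x ^ M\<bar> \<le> B * p ^ M"
          unfolding abs_mult using B x p(3)[OF x False] q_le(1)[of x]
              by (intro mult_mono) (auto intro!: power_mono)
        moreover have "x \<notin> cbox l r" using lr False by auto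
        ultimately show ?thesis by simp
      qed
    qed
    then show ?thesis by simp
  qed
  have "(\<lambda>M. (p / p') ^ M) \<longlonglongrightarrow> 0" using p p' by (intro LIMSEQ_realpow_zero) auto
  then have "(\<lambda>M. B * measure lborel (cube N :: (real ^ 'n) set) * (p / p') ^ M) \<longlonglongrightarrow> B
      * measure lborel (cube N :: (real ^ 'n) set) * 0"
    by (intro tendsto_mult tendsto_const)
  moreover have "a / 2 * measure lborel (cbox l r)
      \<le> B * measure lborel (cube N :: (real ^ 'n) set) * (p / p') ^ M" for M
  proof -
    have pp: "p' > 0" using p p' by simp
    then have pm: "p' ^ M > 0" by simp
    have "a / 2 * measure lborel (cbox l r) = a / 2 * p' ^ M * measure lborel (cbox l r) / p' ^ M"
        using pp by simp
    also have "\<dots> \<le> B * p ^ M * measure lborel (cube N :: (real ^ 'n) set) / p' ^ M"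
        using bound[of M] pm by (intro divide_right_mono) auto
    finally show ?thesis by (simp add: power_divide mult_ac)
  qed
  ultimately have "a / 2 * measure lborel (cbox l r) \<le> 0" using LIMSEQ_le_const by fastforce
  then show False using a content by (simp add: mult_le_0_iff)
qed

section \<open>Fourier series of functions supported in the cube\<close>

lemma sum_prod_int_weight_vec_le:
  fixes F :: "(int ^ 'n) set"
  assumes "finite F" "N \<ge> 1"
  shows "(\<Sum>n\<in>F. \<Prod>i\<in>UNIV. int_weight N (n $ i)) \<le> (3 * N) ^ CARD('n)"
proof -
  define T where "T = (\<Union>i. (\<lambda>n. n $ i) ` F)"
  have T: "finite T" using assms by (simp add: T_def)
  have inj: "inj_on vec_nth F" by (auto simp: inj_on_def vec_nth_inject)
  have "(\<Sum>n\<in>F. \<Prod>i\<in>UNIV. int_weight N (n $ i)) = (\<Sum>w\<in>vec_nth ` F. \<Prod>i\<in>UNIV. int_weight N (w i))"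
    by (simp add: sum.reindex[OF inj])
  also have "\<dots> \<le> (\<Sum>w\<in>PiE (UNIV :: 'n set) (\<lambda>_. T). \<Prod>i\<in>UNIV. int_weight N (w i))"
  proof (rule sum_mono2)
    show "finite (PiE (UNIV :: 'n set) (\<lambda>_. T))" by (intro finite_PiE T) auto
    show "vec_nth ` F \<subseteq> PiE UNIV (\<lambda>_. T)" by (auto simp: T_def)
  qed (use assms int_weight_bounds[of N] in \<open>auto intro!: prod_nonneg\<close>)
  also have "\<dots> \<le> (3 * N) ^ CARD('n)" using assms T by (intro sum_prod_int_weight_le) auto
  finally show ?thesis .
qed

lemma fourier_summable:
  fixes f :: "real ^ 'n \<Rightarrow> real"
  assumes f: "f \<in> Cc_infinity" and N: "N \<ge> 1"
  shows "(\<lambda>n. norm (fourier f ((1 / N) *\<^sub>R int_vec n))) summable_on UNIV"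
proof -
  obtain C where C: "C \<ge> 0" "\<And>\<xi>. norm (fourier f \<xi>) \<le> C * (\<Prod>i\<in>UNIV. 1 / (1 + \<bar>\<xi> $ i\<bar>) ^ 2)"
    using fourier_decay[OF f] by blast
  have le: "norm (fourier f ((1 / N) *\<^sub>R int_vec n)) \<le> C * (\<Prod>i\<in>UNIV. int_weight N (n $ i))" for n
    using C(2)[of "(1 / N) *\<^sub>R int_vec n"] N by (simp add: int_weight_def int_vec_def abs_mult)
  show ?thesis
  proof (rule nonneg_bdd_above_summable_on)
    show "bdd_above (sum (\<lambda>n. norm (fourier f ((1 / N) *\<^sub>R int_vec n))) ` {F. F \<subseteq> UNIV \<and> finite F})"
    proof (rule bdd_aboveI2)
      fix F :: "(int ^ 'n) set" assume "F \<in> {F. F \<subseteq> UNIV \<and> finite F}"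
      then have F: "finite F" by simp
      have "(\<Sum>n\<in>F. norm (fourier f ((1 / N) *\<^sub>R int_vec n))) \<le> C * (\<Sum>n\<in>F. \<Prod>i\<in>UNIV. int_weight N (n $ i))"
        unfolding sum_distrib_left by (intro sum_mono le)
      also have "\<dots> \<le> C * (3 * N) ^ CARD('n)" using C F N
          by (intro mult_left_mono sum_prod_int_weight_vec_le)
      finally show "(\<Sum>n\<in>F. norm (fourier f ((1 / N) *\<^sub>R int_vec n))) \<le> C * (3 * N) ^ CARD('n)" .
    qed
  qed auto
qed

text \<open>The series converges uniformly, so the difference \<open>D\<close> of the two sides is
  continuous with vanishing integrals against all characters; uniqueness gives zero inside the cube
  and continuity on its boundary. The support condition identifies Fourier coefficients over the
  cube with values of the Fourier transform.\<close>

lemma fourier_series: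
  fixes f :: "real ^ 'n \<Rightarrow> real"
  assumes f: "f \<in> Cc_infinity" and N: "N \<ge> 1" and supp: "\<And>x i. f x \<noteq> 0 \<Longrightarrow> \<bar>x $ i\<bar> < N / 2"
    and x: "x \<in> cube N"
  shows "(\<Sum>\<^sub>\<infinity>n. fourier f ((1 / N) *\<^sub>R int_vec n) * character N n x)
      = of_real N ^ CARD('n) * of_real (f x)"
proof -
  define c where "c = (\<lambda>n. fourier f ((1 / N) *\<^sub>R int_vec n))"
  define S where "S = (\<lambda>x. \<Sum>\<^sub>\<infinity>n. c n * character N n x)"
  define P where "P = (\<lambda>F x. \<Sum>n\<in>F. c n * character N n x)"
  have N0: "N > 0" using N by simp
  have ul: "uniform_limit UNIV P S (finite_subsets_at_top UNIV)"
    unfolding P_def S_def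
    by (rule Weierstrass_m_test_general[where M = "\<lambda>n. norm (c n)"])
       (use fourier_summable[OF f N] in \<open>auto simp: norm_mult c_def\<close>)
  have cP: "continuous_on A (P F)" for A F unfolding P_def
      by (intro continuous_intros character_continuous)
  have cS: "continuous_on A S" for A
  proof -
    have "continuous_on UNIV S"
      by (rule uniform_limit_theorem[OF _ ul]) (auto intro!: always_eventually cP)
    then show ?thesis by (rule continuous_on_subset) simp
  qed
  define D where "D = (\<lambda>x. of_real N ^ CARD('n) * of_real (f x) - S x)"
  have cD: "continuous_on A D" for A
    unfolding D_def by (intro continuous_intros cS Cc_infinity_continuous[OF f])
  define V where "V = measure lborel (cube N :: (real ^ 'n) set)"
  have V: "V \<ge> 0" by (simp add: V_def)
  have int_f: "integral (cube N) (\<lambda>x. of_real (f x) * character N m x) = c (- m)" for m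
  proof -
    have eq: "of_real (f x) * character N m x = (if x \<in> cube N then of_real (f x)
        * character N m x else 0)" for x
    proof (cases "f x = 0")
      case False
      then have "x \<in> cube N" unfolding mem_cube using supp[of x] by (auto intro: less_imp_le)
      then show ?thesis by simp
    qed simp
    have "integral (cube N) (\<lambda>x. of_real (f x) * character N m x)
        = integral UNIV (\<lambda>x. of_real (f x) * character N m x)"
      by (subst (2) eq) (rule integral_restrict_UNIV[symmetric])
    also have "\<dots> = (LINT x|lborel. of_real (f x) * character N m x)"
      by (intro integral_lborel integrable_Cc_infinity_mult f character_continuous)
    also have "\<dots> = c (- m)"
      unfolding c_def fourier_def by (simp add: character_def int_vec_minus mult_ac)
    finally show ?thesis .
  qed
  have int_P: "integral (cube N) (\<lambda>x. P F x * character N m x) = of_real N ^ CARD('n) * c (- m)"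
      if "finite F" "- m \<in> F" for F m
  proof -
    have "integral (cube N) (\<lambda>x. P F x * character N m x)
        = integral (cube N) (\<lambda>x. \<Sum>n\<in>F. c n * character N (n + m) x)"
      unfolding P_def sum_distrib_right by (simp add: mult.assoc character_mult)
    also have "\<dots> = (\<Sum>n\<in>F. c n * integral (cube N) (character N (n + m)))"
      unfolding cube_def
      by (intro integral_unique has_integral_sum has_integral_mult_right integrable_integral
          integrable_continuous character_continuous that)
    also have "\<dots> = (\<Sum>n\<in>F. if n = - m then c n * of_real N ^ CARD('n) else 0)"
      unfolding integral_character[OF N0] by (intro sum.cong) (auto simp: add_eq_0_iff)
    also have "\<dots> = of_real N ^ CARD('n) * c (- m)" using that by (simp add: sum.delta)
    finally show ?thesis .
  qed
  have zero: "integral (cube N) (\<lambda>x. D x * character N m x) = 0" for m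
  proof -
    \<comment> \<open>A finite partial sum containing the frequency \<open>- m\<close> has the same
      integral against this character as the multiple of \<open>f\<close> in \<open>D\<close>, so
      only the uniform error of the partial sum remains.\<close>
    have "norm (integral (cube N) (\<lambda>x. D x * character N m x)) \<le> 0 + e" if e: "e > 0" for e
    proof -
      define e' where "e' = e / (V + 1)"
      have e': "e' > 0" using e V by (simp add: e'_def)
      have ev1: "eventually (\<lambda>F. \<forall>x. dist (P F x) (S x) < e') (finite_subsets_at_top UNIV)"
        using ul e' by (auto simp: uniform_limit_iff)
      have ev2: "eventually (\<lambda>F. finite F \<and> - m \<in> F) (finite_subsets_at_top UNIV)"
        by (auto simp: eventually_finite_subsets_at_top intro!: exI[of _ "{- m}"])
      obtain F where F: "\<And>x. dist (P F x) (S x) < e'" "finite F" "- m \<in> F"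
        using eventually_happens[OF eventually_conj[OF ev1 ev2]] by auto
      have "integral (cube N) (\<lambda>x. (P F x - S x) * character N m x)
         = integral (cube N) (\<lambda>x. D x * character N m x)"
      proof -
        have "(\<lambda>x. P F x * character N m x) integrable_on cube N"
          unfolding cube_def by (intro integrable_continuous continuous_on_mult cP character_continuous)
        from integrable_integral[OF this]
        have iP: "((\<lambda>x. P F x * character N m x) has_integral of_real N ^ CARD('n) * c (- m)) (cube N)"
          by (simp only: int_P[OF F(2,3)])
        have iS: "((\<lambda>x. S x * character N m x) has_integral integral (cube N) (\<lambda>x. S x
            * character N m x)) (cube N)"
          unfolding cube_def by (intro integrable_integral integrable_continuous continuous_on_mult
              cS character_continuous)
        have "(\<lambda>x. of_real (f x) * character N m x) integrable_on cube N"
          unfolding cube_def by (intro integrable_continuous continuous_intros character_continuous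
              Cc_infinity_continuous[OF f])
        from integrable_integral[OF this]
        have "((\<lambda>x. of_real (f x) * character N m x) has_integral c (- m)) (cube N)"
            by (simp only: int_f)
        from has_integral_diff[OF has_integral_mult_right[OF this, of "of_real N ^ CARD('n)"] iS]
            has_integral_diff[OF iP iS]
        show ?thesis unfolding D_def
          by (simp add: integral_unique left_diff_distrib mult.assoc)
      qed
      moreover have "norm (integral (cube N) (\<lambda>x. (P F x - S x) * character N m x)) \<le> e' * V"
        unfolding V_def cube_def
      proof (rule has_integral_bound)
        show "((\<lambda>x. (P F x - S x) * character N m x) has_integral
            integral (cbox (\<chi> i. - N / 2) (\<chi> i. N / 2)) (\<lambda>x. (P F x - S x)
                * character N m x)) (cbox (\<chi> i. - N / 2) (\<chi> i. N / 2))"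
          by (intro integrable_integral integrable_continuous continuous_intros cP cS
              character_continuous)
        fix y show "norm ((P F y - S y) * character N m y) \<le> e'"
          using F(1)[of y] by (simp add: norm_mult dist_norm)
      qed (use e' in auto)
      moreover have "e' * V \<le> e" using e V by (simp add: e'_def field_simps)
      ultimately show ?thesis by simp
    qed
    then have "norm (integral (cube N) (\<lambda>x. D x * character N m x)) \<le> 0" by (rule field_le_epsilon)
    then show ?thesis by simp
  qed
  have "D x = 0"
  proof (rule continuous_constant_on_closure[of "box (\<chi> i. - N / 2) (\<chi> i. N / 2)" D])
    show "continuous_on (closure (box (\<chi> i. - N / 2) (\<chi> i. N / 2))) D" by (rule cD)
    have "box (\<chi> i. - N / 2) (\<chi> i. N / 2) \<noteq> ({} :: (real ^ 'n) set)"
      using N0 by (auto simp: set_eq_iff mem_box_cart intro!: exI[of _ 0])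
    then show "x \<in> closure (box (\<chi> i. - N / 2) (\<chi> i. N / 2))" using x by (simp add: cube_def)
    fix y :: "real ^ 'n" assume "y \<in> box (\<chi> i. - N / 2) (\<chi> i. N / 2)"
    then have y: "- N / 2 < y $ i" "y $ i < N / 2" for i by (simp_all add: mem_box_cart)
    have "\<bar>y $ i\<bar> < N / 2" for i using y[of i] by linarith
    then show "D y = 0" by (intro fourier_uniqueness[OF N0 cD zero])
  qed
  then show ?thesis by (simp add: D_def S_def c_def)
qed

section \<open>The variance\<close>

lemma card_injective_PiE:
  assumes "finite S" "finite T"
  shows "card {f \<in> S \<rightarrow>\<^sub>E T. inj_on f S} = (\<Prod>j<card S. card T - j)"
  using assms
proof (induction S arbitrary: T rule: finite_induct)
  case (insert x S)
  have "card {f \<in> insert x S \<rightarrow>\<^sub>E T. inj_on f (insert x S)}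
     = card {(y, g). y \<in> T \<and> g \<in> S \<rightarrow>\<^sub>E (T - {y}) \<and> inj_on g S}"
    unfolding extensional_funcset_extend_domain_inj_on_eq[OF insert(2)]
    by (rule card_image[OF extensional_funcset_extend_domain_inj_onI[OF insert(2)]])
  also have "{(y, g). y \<in> T \<and> g \<in> S \<rightarrow>\<^sub>E (T - {y}) \<and> inj_on g S}
      = (SIGMA y:T. {g \<in> S \<rightarrow>\<^sub>E (T - {y}). inj_on g S})"
    by auto
  also have "card \<dots> = (\<Sum>y\<in>T. card {g \<in> S \<rightarrow>\<^sub>E (T - {y}). inj_on g S})"
  proof (intro card_SigmaI ballI)
    fix y
    show "finite {g \<in> S \<rightarrow>\<^sub>E (T - {y}). inj_on g S}"
      by (rule finite_subset[of _ "S \<rightarrow>\<^sub>E (T - {y})"]) (use insert in \<open>auto intro!: finite_PiE\<close>)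
  qed (use insert in auto)
  also have "\<dots> = (\<Sum>y\<in>T. \<Prod>j<card S. card T - Suc j)"
    using insert by (intro sum.cong) (auto simp: card_Diff_singleton intro!: prod.cong)
  also have "\<dots> = (\<Prod>j<card (insert x S). card T - j)"
    unfolding card_insert_disjoint[OF insert(1,2)] prod.lessThan_Suc_shift by simp
  finally show ?case .
qed (simp add: PiE_empty_domain)

text \<open>\<open>C_factor\<close> is the proportion of distinct tuples among all tuples, which is
  why the zero frequency reproduces exactly the term subtracted in the variance.\<close>

lemma card_distinct_tuples:
  assumes "1 \<le> k" "k \<le> N"
  shows "real (card (distinct_tuples k N)) = real N ^ k * C_factor k N"
proof -
  obtain d where k: "k = Suc d" using assms(1) by (cases k) auto
  have "real (card (distinct_tuples k N)) = (\<Prod>j<k. real (N - j))"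
    unfolding distinct_tuples_def by (subst card_injective_PiE) auto
  also have "\<dots> = (\<Prod>j<k. real N * (1 - real j / real N))"
    using assms by (intro prod.cong) (auto simp: of_nat_diff field_simps)
  also have "\<dots> = real N ^ k * (\<Prod>j<k. 1 - real j / real N)" by (simp add: prod.distrib)
  also have "(\<Prod>j<k. 1 - real j / real N) = C_factor k N"
    unfolding k prod.lessThan_Suc_shift C_factor_def
    by (simp, rule prod.reindex_bij_witness[of _ "\<lambda>j. j - 1" Suc]) auto
  finally show ?thesis .
qed

lemma finite_distinct_tuples: "finite (distinct_tuples k N)"
  unfolding distinct_tuples_def by (rule finite_subset[of _ "PiE {1..k} (\<lambda>_. {1..N})"]) (auto
      intro!: finite_PiE)

text \<open>Once the support lies inside the cube of side N, only the integer vector nearest to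
  \<open>t\<close> can contribute to the sum over \<open>m\<close>. Poisson summation becomes the
  Fourier series at N (t - m0), since an integer shift of \<open>t\<close> does not affect the
  exponentials.\<close>

lemma poisson_summation_scaled:
  fixes f :: "real ^ 'n \<Rightarrow> real" and t :: "real ^ 'n"
  assumes f: "f \<in> Cc_infinity" and N: "N \<ge> 1" and supp: "\<And>x i. f x \<noteq> 0 \<Longrightarrow> \<bar>x $ i\<bar> < N / 2"
  shows "(\<Sum>\<^sub>\<infinity>n. fourier f ((1 / N) *\<^sub>R int_vec n) * cis (2 * pi * (int_vec n \<bullet> t)))
     = of_real N ^ CARD('n) * of_real (\<Sum>\<^sub>\<infinity>m. f (N *\<^sub>R (t - int_vec m)))"
proof -
  define m0 :: "int ^ 'n" where "m0 = (\<chi> i. round (t $ i))"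
  define y where "y = t - int_vec m0"
  have y: "\<bar>y $ i\<bar> \<le> 1 / 2" for i
    using of_int_round_abs_le[of "t $ i"] by (simp add: y_def m0_def int_vec_def abs_minus_commute)
  have N0: "N > 0" using N by simp
  have cube: "N *\<^sub>R y \<in> cube N"
    unfolding mem_cube using y N0 by (auto simp: abs_mult mult_left_mono[of _ "1 / 2" N, simplified])
  have off: "f (N *\<^sub>R (t - int_vec m)) = 0" if mm: "m \<noteq> m0" for m
  proof (rule ccontr)
    assume nz: "f (N *\<^sub>R (t - int_vec m)) \<noteq> 0"
    obtain i where i: "m $ i \<noteq> m0 $ i" using mm by (auto simp: vec_eq_iff)
    have "1 \<le> \<bar>m0 $ i - m $ i\<bar>" using i by linarith
    then have "1 \<le> \<bar>real_of_int (m0 $ i) - real_of_int (m $ i)\<bar>" by linarith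
    moreover have "(t - int_vec m) $ i = y $ i + (real_of_int (m0 $ i) - real_of_int (m $ i))"
      by (simp add: y_def int_vec_def)
    ultimately have "\<bar>(t - int_vec m) $ i\<bar> \<ge> 1 / 2" using y[of i] by linarith
    then have "N * \<bar>(t - int_vec m) $ i\<bar> \<ge> N * (1 / 2)" using N0 by (intro mult_left_mono) auto
    then show False using supp[OF nz, of i] N0 by (simp add: abs_mult)
  qed
  have "(\<Sum>\<^sub>\<infinity>m. f (N *\<^sub>R (t - int_vec m))) = (\<Sum>\<^sub>\<infinity>m\<in>{m0}. f (N *\<^sub>R (t - int_vec m)))"
    by (rule infsum_cong_neutral) (auto simp: off)
  then have sum_m: "(\<Sum>\<^sub>\<infinity>m. f (N *\<^sub>R (t - int_vec m))) = f (N *\<^sub>R y)" by (simp add: y_def)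
  have "cis (2 * pi * (int_vec n \<bullet> t)) = character N n (N *\<^sub>R y)" for n
  proof -
    have int: "int_vec n \<bullet> int_vec m0 = real_of_int (\<Sum>i\<in>UNIV. n $ i * m0 $ i)"
      by (simp add: inner_vec_def int_vec_def)
    have per: "cis (2 * pi * (int_vec n \<bullet> int_vec m0)) = 1"
      unfolding int by (intro cis_multiple_2pi Ints_of_int)
    have "int_vec n \<bullet> t = int_vec n \<bullet> y + int_vec n \<bullet> int_vec m0" by (simp add: y_def inner_diff_right)
    then have "cis (2 * pi * (int_vec n \<bullet> t)) = cis (2 * pi * (int_vec n \<bullet> y)) * cis (2 * pi
        * (int_vec n \<bullet> int_vec m0))"
      by (simp add: cis_mult distrib_left)
    then show ?thesis using N0 per by (simp add: character_def mult.assoc)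
  qed
  then show ?thesis using fourier_series[OF f N supp cube] by (simp add: sum_m)
qed

section \<open>From frequency vectors to coefficients of powers\<close>

context
  fixes k :: nat and pos :: "'n::finite \<Rightarrow> nat"
  assumes k: "k \<ge> 2" and pos: "bij_betw pos (UNIV :: 'n set) {1..k - 1}"
begin

text \<open>The zeros at positions 0 and k make the boundary terms of the summation by parts
  vanish.\<close>

definition padded :: "int ^ 'n \<Rightarrow> nat \<Rightarrow> int" where
  "padded n j = (if j \<in> {1..k - 1} then n $ (inv pos j) else 0)"

text \<open>Summation by parts turns \<open>n \<bullet> \<Delta>(x, \<alpha>)\<close> into a linear form in the powers \<open>x\<^sub>i\<^sup>\<alpha>\<close> whose
  coefficients sum to zero.\<close>

definition power_coeff :: "int ^ 'n \<Rightarrow> nat \<Rightarrow> int" where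
  "power_coeff n i = padded n i - padded n (i - 1)"

lemma inv_pos: "inv pos (pos i) = i"
  using pos by (simp add: bij_betw_def)

lemma sum_pos: "(\<Sum>i\<in>UNIV. g (pos i)) = (\<Sum>j=1..k - 1. g j)"
  using sum.reindex_bij_betw[OF pos, of g] by simp

lemma prod_pos_eq: "(\<Prod>i\<in>UNIV. g (pos i)) = (\<Prod>j=1..k - 1. g j)"
  using prod.reindex_bij_betw[OF pos, of g] by simp

lemma pos_mem: "pos i \<in> {1..k - 1}"
  using pos by (auto simp: bij_betw_def)

lemma padded_pos: "padded n (pos i) = n $ i"
  using pos_mem[of i] by (simp add: padded_def inv_pos)

lemma padded_0: "padded n 0 = 0" and padded_k: "padded n k = 0"
  using k by (auto simp: padded_def)

lemma CARD_eq: "CARD('n) = k - 1"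
  using bij_betw_same_card[OF pos] by simp

lemma summation_by_parts:
  fixes X :: "nat \<Rightarrow> real"
  shows "(\<Sum>i\<in>UNIV. real_of_int (n $ i) * (X (pos i) - X (pos i + 1)))
      = (\<Sum>i=1..k. real_of_int (power_coeff n i) * X i)"
proof -
  obtain d where d: "k = Suc d" using k by (cases k) auto
  then have kd: "k - 1 = d" "{1..k} = {1..Suc d}" by auto
  have "(\<Sum>i\<in>UNIV. real_of_int (n $ i) * (X (pos i) - X (pos i + 1)))
      = (\<Sum>j=1..d. real_of_int (padded n j) * (X j - X (j + 1)))"
    using sum_pos[of "\<lambda>j. real_of_int (padded n j) * (X j - X (j + 1))"] by (simp only: padded_pos kd)
  also have "\<dots> = (\<Sum>j=1..d. real_of_int (padded n j) * X j) - (\<Sum>j=1..d. real_of_int (padded n j)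
      * X (Suc j))"
    by (simp add: sum_subtractf right_diff_distrib)
  also have "(\<Sum>j=1..d. real_of_int (padded n j) * X j) = (\<Sum>j=1..Suc d. real_of_int (padded n j) * X j)"
    using padded_k[of n] d by simp
  also have "(\<Sum>j=1..d. real_of_int (padded n j) * X (Suc j))
      = (\<Sum>j=0..d. real_of_int (padded n j) * X (Suc j))"
    by (simp add: sum.atLeast_Suc_atMost[of 0 d] padded_0)
  also have "\<dots> = (\<Sum>i=1..Suc d. real_of_int (padded n (i - 1)) * X i)"
    using sum.atLeast_Suc_atMost_Suc_shift[of "\<lambda>i. real_of_int (padded n (i - 1)) * X i" 0 d]
        by (simp add: o_def)
  finally show ?thesis 
    unfolding kd power_coeff_def by (simp add: sum_subtractf left_diff_distrib del: sum.cl_ivl_Suc)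
qed

lemma inner_Delta:
  "int_vec n \<bullet> Delta pos x \<alpha> = (\<Sum>i=1..k. real_of_int (power_coeff n i) * real (x i) powr \<alpha>)"
  using summation_by_parts[of n "\<lambda>i. real (x i) powr \<alpha>"]
      by (simp add: inner_vec_def int_vec_def Delta_def)

lemma sum_power_coeff: "(\<Sum>i=1..k. power_coeff n i) = 0"
proof -
  have "real_of_int (\<Sum>i=1..k. power_coeff n i) = 0" using summation_by_parts[of n "\<lambda>_. 1"] by simp
  then show ?thesis by (simp only: of_int_eq_0_iff)
qed

text \<open>The coefficients are successive differences starting from \<open>padded n 0 = 0\<close>,
  so all entries can be recovered from them.\<close>

lemma power_coeff_eq_0_imp:
  assumes "\<And>i. i \<in> {1..k} \<Longrightarrow> power_coeff n i = 0"
  shows "n = 0"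
proof -
  have "padded n j = 0" if "j \<le> k" for j
    using that
  proof (induction j)
    case (Suc j)
    then show ?case using assms[of "Suc j"] by (simp add: power_coeff_def)
  qed (simp add: padded_0)
  then have "n $ i = 0" for i using pos_mem[of i] padded_pos[of n i] by auto
  then show ?thesis by (simp add: vec_eq_iff)
qed

lemma power_coeff_inj:
  assumes "\<And>i. i \<in> {1..k} \<Longrightarrow> power_coeff n i = power_coeff m i"
  shows "n = m"
proof -
  have "n - m = 0"
    by (rule power_coeff_eq_0_imp) (use assms in \<open>force simp: power_coeff_def padded_def\<close>)
  then show ?thesis by simp
qed

text \<open>Each entry of \<open>n\<close> occurs in two consecutive coefficients, so its decay of
  order 4 is shared as 2 + 2. The shares of neighbouring entries combine by 1 + |u - v| \<le> (1 +
  |u|) (1 + |v|).\<close>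

lemma prod_weight_power_coeff:
  assumes "N > 0"
  shows "(\<Prod>i\<in>UNIV. 1 / (1 + \<bar>((1 / N) *\<^sub>R int_vec n) $ i\<bar>) ^ 4)
      \<le> (\<Prod>i=1..k. int_weight N (power_coeff n i))"
proof -
  obtain d where d: "k = Suc d" using k by (cases k) auto
  define a where "a = (\<lambda>j. 1 + \<bar>real_of_int (padded n j)\<bar> / N)"
  have a1: "a j \<ge> 1" for j using assms by (simp add: a_def)
  have ap: "a j > 0" for j using a1[of j] by linarith
  have a0: "a 0 = 1" "a k = 1" by (simp_all add: a_def padded_0 padded_k)
  have "(\<Prod>i\<in>UNIV. 1 / (1 + \<bar>((1 / N) *\<^sub>R int_vec n) $ i\<bar>) ^ 4) = (\<Prod>i\<in>UNIV. 1 / a (pos i) ^ 4)"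
    using assms by (simp add: a_def padded_pos int_vec_def abs_mult)
  also have "\<dots> = (\<Prod>j=1..d. 1 / a j ^ 4)" using prod_pos_eq[of "\<lambda>j. 1 / a j ^ 4"] by (simp add: d)
  also have "\<dots> = (\<Prod>j=1..d. 1 / a j ^ 2) * (\<Prod>j=1..d. 1 / a j ^ 2)"
    by (simp add: prod.distrib[symmetric] flip: power_add)
  also have "(\<Prod>j=1..d. 1 / a j ^ 2) * (\<Prod>j=1..d. 1 / a j ^ 2)
      = (\<Prod>i=1..k. 1 / a i ^ 2) * (\<Prod>i=1..k. 1 / a (i - 1) ^ 2)"
  proof -
    have "(\<Prod>i=1..k. 1 / a i ^ 2) = (\<Prod>j=1..d. 1 / a j ^ 2)" using a0 by (simp add: d)
    moreover have "(\<Prod>i=1..k. 1 / a (i - 1) ^ 2) = (\<Prod>j=0..d. 1 / a j ^ 2)"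
      using prod.atLeast_Suc_atMost_Suc_shift[of "\<lambda>i. 1 / a (i - 1) ^ 2" 0 d] by (simp add: d o_def)
    moreover have "(\<Prod>j=0..d. 1 / a j ^ 2) = (\<Prod>j=1..d. 1 / a j ^ 2)"
      using a0 by (simp add: prod.atLeast_Suc_atMost[of 0 d])
    ultimately show ?thesis by simp
  qed
  also have "\<dots> = (\<Prod>i=1..k. 1 / (a i * a (i - 1)) ^ 2)"
    by (simp add: prod.distrib[symmetric] power_mult_distrib)
  also have "\<dots> \<le> (\<Prod>i=1..k. int_weight N (power_coeff n i))"
  proof (rule prod_mono, rule conjI)
    fix i
    have pos2: "0 < a i * a (i - 1)" using ap by (intro mult_pos_pos)
    show "0 \<le> 1 / (a i * a (i - 1)) ^ 2" by simp
    have "1 + \<bar>real_of_int (power_coeff n i)\<bar> / N \<le> 1 + (\<bar>real_of_int (padded n i)\<bar>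
        + \<bar>real_of_int (padded n (i - 1))\<bar>) / N"
      using assms by (intro add_left_mono divide_right_mono) (auto simp: power_coeff_def)
    also have "\<dots> \<le> a i * a (i - 1)"
      using assms by (simp add: a_def algebra_simps add_divide_distrib)
    finally have "1 + \<bar>real_of_int (power_coeff n i)\<bar> / N \<le> a i * a (i - 1)" .
    moreover have "0 < 1 + \<bar>real_of_int (power_coeff n i)\<bar> / N" using assms
        by (intro add_pos_nonneg) auto
    ultimately show "1 / (a i * a (i - 1)) ^ 2 \<le> int_weight N (power_coeff n i)"
      unfolding int_weight_def using pos2 by (intro divide_left_mono power_mono mult_pos_pos
          zero_less_power) (auto simp: ap)
  qed
  finally show ?thesis .
qed

section \<open>Encoding a term of the square as a pair of tuples\<close>

definition index_pairs :: "(nat \<times> bool) set" where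
  "index_pairs = {1..k} \<times> UNIV"

text \<open>The second factor of the square is a complex conjugate, hence the minus sign in the half
  \<open>True\<close>.\<close>

definition encode :: "((int ^ 'n) \<times> (nat \<Rightarrow> nat)) \<times> ((int ^ 'n) \<times> (nat \<Rightarrow> nat)) \<Rightarrow> (nat \<times> bool \<Rightarrow> int) \<times>
    (nat \<times> bool \<Rightarrow> nat)" where
  "encode = (\<lambda>((n, x), (m, y)). (\<lambda>(i, b)\<in>index_pairs. if b then - power_coeff m i else power_coeff n i,
                                 \<lambda>(i, b)\<in>index_pairs. if b then y i else x i))"

lemma index_pairs_half: "{ib \<in> index_pairs. snd ib = b} = (\<lambda>i. (i, b)) ` {1..k}"
  by (auto simp: index_pairs_def)

lemma sum_index_pairs: "(\<Sum>ib\<in>index_pairs. g ib) = (\<Sum>i=1..k. g (i, False)) + (\<Sum>i=1..k. g (i, True))"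
  unfolding index_pairs_def by (simp add: sum.cartesian_product' UNIV_bool sum.distrib)

lemma prod_index_pairs: "(\<Prod>ib\<in>index_pairs. g ib) = (\<Prod>i=1..k. g (i, False)) * (\<Prod>i=1..k. g (i, True))"
  unfolding index_pairs_def by (simp add: prod.cartesian_product' UNIV_bool prod.distrib)

lemma encode_apply:
  assumes "i \<in> {1..k}"
  shows "fst (encode ((n, x), (m, y))) (i, b) = (if b then - power_coeff m i else power_coeff n i)"
    "snd (encode ((n, x), (m, y))) (i, b) = (if b then y i else x i)"
  using assms by (simp_all add: encode_def index_pairs_def)

lemma encode_inj:
  "inj_on encode ((UNIV \<times> distinct_tuples k N) \<times> (UNIV \<times> distinct_tuples k N))"
proof (rule inj_onI)
  fix v v'
  assume v: "v \<in> (UNIV \<times> distinct_tuples k N) \<times> (UNIV \<times> distinct_tuples k N)"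
    and v': "v' \<in> (UNIV \<times> distinct_tuples k N) \<times> (UNIV \<times> distinct_tuples k N)"
    and enc: "encode v = encode v'"
  obtain n x m y where vs: "v = ((n, x), (m, y))" by (metis prod.exhaust)
  obtain n' x' m' y' where vs': "v' = ((n', x'), (m', y'))" by (metis prod.exhaust)
  have mem: "x \<in> distinct_tuples k N" "y \<in> distinct_tuples k N" "x' \<in> distinct_tuples k N" "y' \<in>
      distinct_tuples k N"
    and eq: "encode ((n, x), (m, y)) = encode ((n', x'), (m', y'))" using v v' enc by (auto simp: vs vs')
  have c: "power_coeff n i = power_coeff n' i \<and> power_coeff m i = power_coeff m' i \<and> x i = x' i
      \<and> y i = y' i" if "i \<in> {1..k}" for i
    using encode_apply[OF that, of n x m y True] encode_apply[OF that, of n' x' m' y' True]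
      encode_apply[OF that, of n x m y False] encode_apply[OF that, of n' x' m' y' False] eq by simp
  have "x = x'" "y = y'"
    using mem c by (auto simp: distinct_tuples_def intro!: PiE_ext[where k = "{1..k}" and s
        = "\<lambda>_. {1..N}"])
  moreover have "n = n'" "m = m'" using c by (auto intro!: power_coeff_inj)
  ultimately show "v = v'" by (simp add: vs vs')
qed

lemma encode_mem:
  assumes n: "n \<noteq> 0" and xy: "x \<in> distinct_tuples k N" "y \<in> distinct_tuples k N"
    and T: "\<And>i. i \<in> {1..k} \<Longrightarrow> power_coeff n i \<in> T" "\<And>i. i \<in> {1..k} \<Longrightarrow> - power_coeff m i \<in> T"
  shows "encode ((n, x), (m, y)) \<in> tuple_pairs index_pairs snd T N"
proof -
  define w p where "w = fst (encode ((n, x), (m, y)))" and "p = snd (encode ((n, x), (m, y)))"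
  have w: "w (i, b) = (if b then - power_coeff m i else power_coeff n i)"
    and p: "p (i, b) = (if b then y i else x i)" if "i \<in> {1..k}" for i b
    using that by (simp_all only: w_def p_def encode_apply)
  have "w \<in> index_pairs \<rightarrow>\<^sub>E T" unfolding w_def encode_def using T by (auto simp: index_pairs_def)
  moreover have "p \<in> index_pairs \<rightarrow>\<^sub>E {1..N}"
    unfolding p_def encode_def using xy by (auto simp: index_pairs_def distinct_tuples_def PiE_iff)
  moreover have "(\<Sum>ib\<in>{ib \<in> index_pairs. snd ib = b}. w ib) = 0" for b
  proof -
    have "(\<Sum>ib\<in>{ib \<in> index_pairs. snd ib = b}. w ib) = (\<Sum>i=1..k. w (i, b))"
      unfolding index_pairs_half by (subst sum.reindex) (auto simp: inj_on_def)
    also have "\<dots> = (\<Sum>i=1..k. if b then - power_coeff m i else power_coeff n i)"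
      by (intro sum.cong refl w)
    also have "\<dots> = 0" by (cases b) (simp_all add: sum_negf sum_power_coeff[unfolded One_nat_def])
    finally show ?thesis .
  qed
  moreover have "inj_on p {ib \<in> index_pairs. snd ib = b}" for b
    unfolding index_pairs_half
  proof (rule inj_onI)
    fix u v assume "u \<in> (\<lambda>i. (i, b)) ` {1..k}" "v \<in> (\<lambda>i. (i, b)) ` {1..k}" and eq: "p u = p v"
    then obtain i j where ij: "i \<in> {1..k}" "j \<in> {1..k}" and u: "u = (i, b)" and v: "v = (j, b)" by blast
    have "inj_on x {1..k}" "inj_on y {1..k}" using xy by (auto simp: distinct_tuples_def)
    moreover have "(if b then y i else x i) = (if b then y j else x j)" using eq p ij by (simp add: u v)
    ultimately have "i = j" using ij by (cases b) (auto dest: inj_onD)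
    then show "u = v" by (simp add: u v)
  qed
  moreover have "\<exists>ib\<in>index_pairs. \<not> snd ib \<and> w ib \<noteq> 0"
  proof -
    obtain i where "i \<in> {1..k}" "power_coeff n i \<noteq> 0" using power_coeff_eq_0_imp[of n] n by blast
    then show ?thesis by (intro bexI[of _ "(i, False)"]) (auto simp: w index_pairs_def)
  qed
  ultimately have "(w, p) \<in> tuple_pairs index_pairs snd T N" by (simp add: tuple_pairs_def)
  then show ?thesis by (simp add: w_def p_def)
qed

lemma encode_phase:
  "phase_integral A index_pairs (fst (encode ((n, x), (m, y)))) (snd (encode ((n, x), (m, y))))
     = norm (integral {A..A + 1} (\<lambda>\<alpha>. cis (2 * pi * (int_vec n \<bullet> Delta pos x \<alpha>
         - int_vec m \<bullet> Delta pos y \<alpha>))))"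
proof -
  have "(\<Sum>ib\<in>index_pairs. of_int (fst (encode ((n, x), (m, y))) ib)
      * real (snd (encode ((n, x), (m, y))) ib) powr \<alpha>)
     = int_vec n \<bullet> Delta pos x \<alpha> - int_vec m \<bullet> Delta pos y \<alpha>" for \<alpha>
    unfolding sum_index_pairs inner_Delta
    by (simp add: encode_def index_pairs_def sum_negf)
  then show ?thesis by (simp add: phase_integral_def)
qed

lemma encode_weight:
  "(\<Prod>ib\<in>index_pairs. int_weight N (fst (encode ((n, x), (m, y))) ib))
     = (\<Prod>i=1..k. int_weight N (power_coeff n i)) * (\<Prod>i=1..k. int_weight N (power_coeff m i))"
  unfolding prod_index_pairs by (simp add: encode_def index_pairs_def int_weight_def)

section \<open>Mean square of the truncated expansion\<close>

abbreviation fourier_coeff :: "(real ^ 'n \<Rightarrow> real) \<Rightarrow> nat \<Rightarrow> int ^ 'n \<Rightarrow> complex" where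
  "fourier_coeff f N n \<equiv> fourier f ((1 / real N) *\<^sub>R int_vec n)"

abbreviation tuple_exp_sum :: "nat \<Rightarrow> int ^ 'n \<Rightarrow> real \<Rightarrow> complex" where
  "tuple_exp_sum N n \<alpha> \<equiv> \<Sum>x\<in>distinct_tuples k N. cis (2 * pi * (int_vec n \<bullet> Delta pos x \<alpha>))"

text \<open>Truncated to a finite set of frequencies, so that the square can be expanded and
  integrated term by term.\<close>

definition exp_sum_tuples :: "(real ^ 'n \<Rightarrow> real) \<Rightarrow> nat \<Rightarrow> (int ^ 'n) set \<Rightarrow> real \<Rightarrow> complex" where
  "exp_sum_tuples f N \<Lambda> \<alpha> = (\<Sum>n\<in>\<Lambda>. fourier_coeff f N n * tuple_exp_sum N n \<alpha>)"

lemma continuous_inner_Delta: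
  assumes "x \<in> distinct_tuples k N"
  shows "continuous_on S (\<lambda>\<alpha>. int_vec n \<bullet> Delta pos x \<alpha>)"
proof -
  have "x i \<ge> 1" if "i \<in> {1..k}" for i using assms that by (auto simp: distinct_tuples_def PiE_iff)
  then show ?thesis unfolding inner_Delta by (intro continuous_intros) (auto simp: Suc_le_eq)
qed

lemma exp_sum_tuples_continuous: "continuous_on S (exp_sum_tuples f N \<Lambda>)"
  unfolding exp_sum_tuples_def by (intro continuous_intros continuous_inner_Delta)

text \<open>Each term of the expanded square is at most its weights times a phase integral;
  \<open>encode\<close> sends the terms injectively into \<open>tuple_pairs\<close>, where all
  summands are nonnegative. The bound is uniform in \<open>\<Lambda>\<close>, which permits the
  passage to the full series.\<close>

lemma exp_sum_tuples_mean_square: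
  assumes N: "N \<ge> 1" and \<Lambda>: "finite \<Lambda>" "0 \<notin> \<Lambda>"
    and C: "C \<ge> 0" "\<And>\<xi>. norm (fourier f \<xi>) \<le> C * (\<Prod>i\<in>UNIV. 1 / (1 + \<bar>\<xi> $ i\<bar>) ^ 4)"
    and bound: "\<And>T. finite T \<Longrightarrow> (\<Sum>(w, p)\<in>tuple_pairs index_pairs snd T N.
        (\<Prod>i\<in>index_pairs. int_weight (real N) (w i)) * phase_integral A index_pairs w p) \<le> B"
  shows "integral {A..A + 1} (\<lambda>\<alpha>. (norm (exp_sum_tuples f N \<Lambda> \<alpha>))\<^sup>2) \<le> C\<^sup>2 * B"
proof -
  define X where "X = distinct_tuples k N"
  define Y where "Y = \<Lambda> \<times> X"
  have finX: "finite X" by (simp add: X_def finite_distinct_tuples)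
  have finY: "finite Y" using finX \<Lambda> by (simp add: Y_def)
  define a where "a = (\<lambda>n. fourier_coeff f N n)"
  define ph where "ph = (\<lambda>(n, x) \<alpha>. 2 * pi * (int_vec n \<bullet> Delta pos x \<alpha>))"
  define V where "V = (\<lambda>n. \<Prod>i=1..k. int_weight (real N) (power_coeff n i))"
  let ?J = "\<lambda>v v'. integral {A..A + 1} (\<lambda>\<alpha>. cis (ph v \<alpha> - ph v' \<alpha>))"
  let ?b = "\<lambda>v. V (fst (fst v)) * V (fst (snd v)) * norm (?J (fst v) (snd v))"
  have Vnn: "V n \<ge> 0" for n unfolding V_def using int_weight_bounds[of "real N"] N
      by (intro prod_nonneg) auto
  have a_le: "norm (a n) \<le> C * V n" for n
    using order_trans[OF C(2) mult_left_mono[OF prod_weight_power_coeff C(1)]] N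
        unfolding a_def V_def by simp
  have G: "exp_sum_tuples f N \<Lambda> \<alpha> = (\<Sum>v\<in>Y. a (fst v) * cis (ph v \<alpha>))" for \<alpha>
    unfolding exp_sum_tuples_def Y_def X_def[symmetric] sum.cartesian_product[symmetric] sum_distrib_left
    by (simp add: a_def ph_def sum.cartesian_product case_prod_unfold)
  have cont_ph: "continuous_on S (ph v)" if "v \<in> Y" for v S
    using that unfolding ph_def Y_def X_def by (auto intro!: continuous_intros continuous_inner_Delta)
  have sq: "complex_of_real ((norm (exp_sum_tuples f N \<Lambda> \<alpha>))\<^sup>2)
     = (\<Sum>v\<in>Y. \<Sum>v'\<in>Y. a (fst v) * cnj (a (fst v')) * cis (ph v \<alpha> - ph v' \<alpha>))" for \<alpha>
    unfolding complex_norm_square G cnj_sum sum_product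
  proof (intro sum.cong refl)
    fix v v'
    have "cis (ph v \<alpha> - ph v' \<alpha>) = cis (ph v \<alpha>) * cis (- ph v' \<alpha>)" by (simp add: cis_mult)
    then show "a (fst v) * cis (ph v \<alpha>) * cnj (a (fst v') * cis (ph v' \<alpha>))
        = a (fst v) * cnj (a (fst v')) * cis (ph v \<alpha> - ph v' \<alpha>)"
      by (simp add: cis_cnj mult_ac)
  qed
  have "((\<lambda>\<alpha>. \<Sum>v\<in>Y. \<Sum>v'\<in>Y. a (fst v) * cnj (a (fst v')) * cis (ph v \<alpha> - ph v' \<alpha>)) has_integral
      (\<Sum>v\<in>Y. \<Sum>v'\<in>Y. a (fst v) * cnj (a (fst v')) * ?J v v')) {A..A + 1}"
    by (intro has_integral_sum has_integral_mult_right integrable_integral integrable_continuous_interval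
         continuous_intros finY cont_ph)
  then have I: "((\<lambda>\<alpha>. complex_of_real ((norm (exp_sum_tuples f N \<Lambda> \<alpha>))\<^sup>2)) has_integral
      (\<Sum>v\<in>Y. \<Sum>v'\<in>Y. a (fst v) * cnj (a (fst v')) * ?J v v')) {A..A + 1}"
    (is "(_ has_integral ?I) _") unfolding sq .
  have "integral {A..A + 1} (\<lambda>\<alpha>. (norm (exp_sum_tuples f N \<Lambda> \<alpha>))\<^sup>2) = Re ?I"
    using has_integral_Re[OF I] by (simp add: integral_unique)
  also have "\<dots> \<le> norm ?I" by (rule complex_Re_le_cmod)
  also have "\<dots> \<le> (\<Sum>v\<in>Y. \<Sum>v'\<in>Y. norm (a (fst v) * cnj (a (fst v')) * ?J v v'))"
    by (intro order_trans[OF norm_sum] sum_mono norm_sum)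
  also have "\<dots> \<le> (\<Sum>v\<in>Y. \<Sum>v'\<in>Y. C\<^sup>2 * (V (fst v) * V (fst v') * norm (?J v v')))"
  proof (intro sum_mono)
    fix v v' :: "(int ^ 'n) \<times> (nat \<Rightarrow> nat)"
    have "norm (a (fst v)) * norm (a (fst v')) \<le> (C * V (fst v)) * (C * V (fst v'))"
      using a_le C(1) Vnn by (intro mult_mono) auto
    then have "norm (a (fst v)) * norm (a (fst v')) * norm (?J v v')
       \<le> (C * V (fst v)) * (C * V (fst v')) * norm (?J v v')"
      by (intro mult_right_mono) auto
    then show "norm (a (fst v) * cnj (a (fst v')) * ?J v v')
       \<le> C\<^sup>2 * (V (fst v) * V (fst v') * norm (?J v v'))"
      by (simp add: norm_mult power2_eq_square mult_ac)
  qed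
  also have "\<dots> = C\<^sup>2 * (\<Sum>v\<in>Y \<times> Y. ?b v)"
    by (simp add: sum_distrib_left sum.cartesian_product case_prod_unfold)
  also have "\<dots> \<le> C\<^sup>2 * B"
  proof (rule mult_left_mono)
    \<comment> \<open>All coefficients that occur for frequencies in \<open>\<Lambda>\<close>, with
      both signs because of the conjugate factor.\<close>
    define T where "T = (\<Union>n\<in>\<Lambda>. power_coeff n ` {1..k} \<union> (\<lambda>i. - power_coeff n i) ` {1..k})"
    have finT: "finite T" using \<Lambda> by (auto simp: T_def)
    define g where "g = (\<lambda>(w, p). (\<Prod>i\<in>index_pairs. int_weight (real N) (w i))
        * phase_integral A index_pairs w p)"
    have inj: "inj_on encode (Y \<times> Y)"
      by (rule inj_on_subset[OF encode_inj[of N]]) (auto simp: Y_def X_def)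
    have sub: "encode ` (Y \<times> Y) \<subseteq> tuple_pairs index_pairs snd T N"
    proof (rule image_subsetI)
      fix v assume "v \<in> Y \<times> Y"
      then obtain n x m y where v: "v = ((n, x), (m, y))" "n \<in> \<Lambda>" "m \<in> \<Lambda>" "x \<in> X" "y \<in> X"
        by (auto simp: Y_def)
      have "n \<noteq> 0" using v \<Lambda> by auto
      moreover have "power_coeff n i \<in> T" "- power_coeff m i \<in> T" if "i \<in> {1..k}" for i
        using v that unfolding T_def by blast+
      ultimately show "encode v \<in> tuple_pairs index_pairs snd T N"
        unfolding v(1) using v by (intro encode_mem) (auto simp: X_def)
    qed
    have finI: "finite index_pairs" by (simp add: index_pairs_def)
    have "(\<Sum>v\<in>Y \<times> Y. ?b v)
       = (\<Sum>v\<in>Y \<times> Y. g (encode v))"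
    proof (rule sum.cong[OF refl])
      fix v assume "v \<in> Y \<times> Y"
      obtain n x m y where v: "v = ((n, x), (m, y))" by (metis prod.exhaust)
      have "g (encode v) = V n * V m * norm (integral {A..A + 1} (\<lambda>\<alpha>. cis (2 * pi
          * (int_vec n \<bullet> Delta pos x \<alpha> - int_vec m \<bullet> Delta pos y \<alpha>))))"
        unfolding g_def v case_prod_unfold encode_weight encode_phase V_def ..
      then show "?b v = g (encode v)"
        by (simp add: v ph_def right_diff_distrib)
    qed
    also have "\<dots> = (\<Sum>v\<in>encode ` (Y \<times> Y). g v)" by (simp add: sum.reindex[OF inj])
    also have "\<dots> \<le> (\<Sum>v\<in>tuple_pairs index_pairs snd T N. g v)"
    proof (rule sum_mono2[OF finite_tuple_pairs[OF finI finT] sub])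
      fix v
      show "0 \<le> g v"
        unfolding g_def phase_integral_def using int_weight_bounds[of "real N"] N
        by (auto simp: case_prod_unfold intro!: mult_nonneg_nonneg prod_nonneg)
    qed
    also have "\<dots> \<le> B" using bound[OF finT] by (simp add: g_def)
    finally show "(\<Sum>v\<in>Y \<times> Y. ?b v) \<le> B" .
  qed simp
  finally show ?thesis .
qed

text \<open>The factor N^k combines the N that clears 1/N with the N^(k-1) from Poisson summation.
  Removing the frequency 0 subtracts precisely the mean.\<close>

lemma R_corr_expansion:
  assumes f: "f \<in> Cc_infinity" and N: "k \<le> N" and supp: "\<And>x i. f x \<noteq> 0 \<Longrightarrow> \<bar>x $ i\<bar> < real N / 2"
  shows "(\<lambda>n. fourier_coeff f N n * tuple_exp_sum N n \<alpha>)
     summable_on UNIV - {0}" (is ?summable)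
    "of_real (real N ^ k * (R_corr k pos f \<alpha> N - C_factor k N * (LBINT x. f x)))
     = (\<Sum>\<^sub>\<infinity>n\<in>UNIV - {0}. fourier_coeff f N n *
          tuple_exp_sum N n \<alpha>)" (is ?identity)
proof -
  define X where "X = distinct_tuples k N"
  define a where "a = (\<lambda>n. fourier_coeff f N n)"
  define e where "e = (\<lambda>x n. cis (2 * pi * (int_vec n \<bullet> Delta pos x \<alpha>)))"
  define L where "L = (\<lambda>x. \<Sum>\<^sub>\<infinity>m. f (real N *\<^sub>R (Delta pos x \<alpha> - int_vec m)))"
  have N1: "real N \<ge> 1" "N \<ge> 1" using N k by auto
  have sa: "(\<lambda>n. norm (a n)) summable_on UNIV" unfolding a_def by (rule fourier_summable[OF f N1(1)])
  have "((\<lambda>n. a n * e x n) has_sum (of_real (real N) ^ CARD('n) * of_real (L x))) UNIV" for x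
  proof -
    have "(\<lambda>n. norm (a n * e x n)) summable_on UNIV" using sa by (simp add: e_def norm_mult)
    then have "(\<lambda>n. a n * e x n) summable_on UNIV" by (rule abs_summable_summable)
    then have "((\<lambda>n. a n * e x n) has_sum (\<Sum>\<^sub>\<infinity>n. a n * e x n)) UNIV" by simp
    then show ?thesis
      using poisson_summation_scaled[OF f N1(1) supp, of "Delta pos x \<alpha>"]
          by (simp add: a_def e_def L_def)
  qed
  then have tuple_sum: "((\<lambda>n. a n * e x n) has_sum (of_real (real N ^ (k - 1) * L x))) UNIV" for x
    by (simp add: CARD_eq)
  have "((\<lambda>n. \<Sum>x\<in>X. a n * e x n) has_sum (\<Sum>x\<in>X. of_real (real N ^ (k - 1) * L x))) UNIV"
  proof -
    have "((\<lambda>n. \<Sum>x\<in>Z. a n * e x n) has_sum (\<Sum>x\<in>Z. of_real (real N ^ (k - 1) * L x))) UNIV"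
        if "finite Z" for Z
      using that
    proof (induction Z rule: finite_induct)
      case (insert z Z)
      show ?case unfolding sum.insert[OF insert(1,2)] by (rule has_sum_add[OF tuple_sum insert.IH])
    qed simp
    then show ?thesis by (simp add: X_def finite_distinct_tuples)
  qed
  moreover have "(\<Sum>x\<in>X. complex_of_real (real N ^ (k - 1) * L x))
      = of_real (real N ^ k * R_corr k pos f \<alpha> N)"
  proof -
    have "real N ^ k = real N ^ (k - 1) * real N" using k by (cases k) auto
    then have "real N ^ k * R_corr k pos f \<alpha> N = (\<Sum>x\<in>X. real N ^ (k - 1) * L x)"
      using N1 by (simp add: R_corr_def L_def X_def int_vec_def sum_distrib_left)
    then show ?thesis by (simp only: of_real_sum)
  qed
  ultimately have total: "((\<lambda>n. a n * (\<Sum>x\<in>X. e x n)) has_sum of_real (real N ^ k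
      * R_corr k pos f \<alpha> N)) UNIV"
    by (simp add: sum_distrib_left)
  have a0: "a 0 * (\<Sum>x\<in>X. e x 0) = of_real (real N ^ k * (C_factor k N * (LBINT x. f x)))"
  proof -
    have iv: "int_vec (0 :: int ^ 'n) = 0" by (simp add: int_vec_eq_0)
    have "real (card X) = real N ^ k * C_factor k N" unfolding X_def using k N
        by (intro card_distinct_tuples) auto
    then have "complex_of_real (real (card X)) = of_real (real N ^ k * C_factor k N)" by (simp only:)
    then show ?thesis unfolding a_def e_def iv by (simp add: fourier_0 mult_ac)
  qed
  have "((\<lambda>n. a n * (\<Sum>x\<in>X. e x n)) has_sum (of_real (real N ^ k * R_corr k pos f \<alpha> N) - a 0
      * (\<Sum>x\<in>X. e x 0))) (UNIV - {0})"
    using has_sum_Diff[OF total has_sum_finite[of "{0}" "\<lambda>n. a n * (\<Sum>x\<in>X. e x n)"]] by simp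
  then have rest: "((\<lambda>n. a n * (\<Sum>x\<in>X. e x n)) has_sum of_real (real N ^ k * (R_corr k pos f \<alpha> N
      - C_factor k N * (LBINT x. f x)))) (UNIV - {0})"
    unfolding a0 by (simp add: right_diff_distrib)
  then show ?summable by (auto simp: a_def e_def X_def summable_on_def)
  show ?identity using infsumI[OF rest] by (simp add: a_def e_def X_def)
qed

lemma exp_sum_tuples_uniform_limit:
  assumes f: "f \<in> Cc_infinity" and N: "N \<ge> 1"
  shows "uniform_limit UNIV (exp_sum_tuples f N)
     (\<lambda>\<alpha>. \<Sum>\<^sub>\<infinity>n\<in>UNIV - {0}. fourier_coeff f N n *
          tuple_exp_sum N n \<alpha>) (finite_subsets_at_top (UNIV - {0}))"
  unfolding exp_sum_tuples_def
proof (rule Weierstrass_m_test_general)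
  fix n \<alpha>
  have "norm (tuple_exp_sum N n \<alpha>) \<le> (\<Sum>x\<in>distinct_tuples k N. 1)"
    by (intro order_trans[OF norm_sum] sum_mono) auto
  then show "norm (fourier_coeff f N n * tuple_exp_sum N n \<alpha>)
     \<le> norm (fourier_coeff f N n) * real (card (distinct_tuples k N))"
    by (simp add: norm_mult mult_left_mono)
next
  have "(\<lambda>n. norm (fourier_coeff f N n)) summable_on UNIV - {0}"
    by (rule summable_on_subset_banach[OF fourier_summable[OF f]]) (use N in auto)
  then show "(\<lambda>n. norm (fourier_coeff f N n) * real (card (distinct_tuples k N))) summable_on UNIV - {0}"
    by (rule summable_on_cmult_left)
qed

text \<open>A truncated sum approximates the full expansion within \<epsilon>, uniformly in
  \<alpha>. The factor 2 comes from (g + \<epsilon>)^2 \<le> 2 g^2 + 2 \<epsilon>^2.\<close>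

lemma Var_corr_le:
  assumes f: "f \<in> Cc_infinity" and N: "k \<le> N" and supp: "\<And>x i. f x \<noteq> 0 \<Longrightarrow> \<bar>x $ i\<bar> < real N / 2"
    and C: "C \<ge> 0" "\<And>\<xi>. norm (fourier f \<xi>) \<le> C * (\<Prod>i\<in>UNIV. 1 / (1 + \<bar>\<xi> $ i\<bar>) ^ 4)"
    and bound: "\<And>T. finite T \<Longrightarrow> (\<Sum>(w, p)\<in>tuple_pairs index_pairs snd T N.
        (\<Prod>i\<in>index_pairs. int_weight (real N) (w i)) * phase_integral A index_pairs w p) \<le> B"
  shows "0 \<le> Var_corr k pos f N {A..A + 1}" "Var_corr k pos f N {A..A + 1}
      \<le> 2 * C\<^sup>2 * B / real N ^ (2 * k)"
proof -
  define h where "h = (\<lambda>\<alpha>. R_corr k pos f \<alpha> N - C_factor k N * (LBINT x. f x))"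
  have h_series: "complex_of_real (real N ^ k * h \<alpha>) = (\<Sum>\<^sub>\<infinity>n\<in>UNIV - {0}. fourier_coeff f N n *
          tuple_exp_sum N n \<alpha>)" for \<alpha>
    unfolding h_def by (rule R_corr_expansion(2)[OF f N supp])
  have V: "Var_corr k pos f N {A..A + 1} = (LBINT \<alpha>:{A..A + 1}. (h \<alpha>)\<^sup>2)"
    by (simp add: Var_corr_def h_def)
  show "0 \<le> Var_corr k pos f N {A..A + 1}"
    unfolding V set_lebesgue_integral_def by (rule integral_nonneg_AE) (auto simp: indicator_def)
  have N1: "N \<ge> 1" using N k by simp
  \<comment> \<open>The bound for the empty coefficient set shows that \<open>B\<close> is
    nonnegative.\<close>
  have "0 \<le> (\<Sum>(w, p)\<in>tuple_pairs index_pairs snd {} N.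
      (\<Prod>i\<in>index_pairs. int_weight (real N) (w i)) * phase_integral A index_pairs w p)"
    using int_weight_bounds[of "real N"] N1
    by (intro sum_nonneg) (auto simp: phase_integral_def intro!: mult_nonneg_nonneg prod_nonneg)
  then have Bnn: "B \<ge> 0" using bound[of "{}"] by simp
  have Np: "real N ^ (2 * k) > 0" using N1 by simp
  show "Var_corr k pos f N {A..A + 1} \<le> 2 * C\<^sup>2 * B / real N ^ (2 * k)"
  proof (cases "set_integrable lborel {A..A + 1} (\<lambda>\<alpha>. (h \<alpha>)\<^sup>2)")
    \<comment> \<open>By convention the Lebesgue integral of a non-integrable function is 0, which
      satisfies the bound.\<close>
    case False
    then have "Var_corr k pos f N {A..A + 1} = 0"
      unfolding V set_lebesgue_integral_def set_integrable_def by (rule not_integrable_integral_eq)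
    then show ?thesis using Bnn Np by simp
  next
    case True
    note HK = set_borel_integral_eq_integral[OF True]
    have "Var_corr k pos f N {A..A + 1} \<le> 2 * C\<^sup>2 * B / real N ^ (2 * k) + e" if e: "e > 0" for e
    proof -
      \<comment> \<open>Chosen so that the error 2 \<epsilon>^2 becomes \<open>e\<close> after
        division by N^(2k).\<close>
      define \<epsilon> where "\<epsilon> = sqrt (e * real N ^ (2 * k) / 2)"
      have \<epsilon>: "\<epsilon> > 0" "2 * \<epsilon>\<^sup>2 = e * real N ^ (2 * k)" using e Np by (simp_all add: \<epsilon>_def)
      have ev: "eventually (\<lambda>\<Lambda>. \<forall>\<alpha>. dist (exp_sum_tuples f N \<Lambda> \<alpha>) (of_real (real N ^ k
          * h \<alpha>)) < \<epsilon>) (finite_subsets_at_top (UNIV - {0}))"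
        using uniform_limitD[OF exp_sum_tuples_uniform_limit[OF f N1] \<epsilon>(1)] unfolding h_series by simp
      have ev2: "eventually (\<lambda>\<Lambda>. finite \<Lambda> \<and> \<Lambda> \<subseteq> UNIV - {0}) (finite_subsets_at_top (UNIV
          - {0 :: int ^ 'n}))"
        by (simp add: eventually_finite_subsets_at_top_weakI)
      obtain \<Lambda> where \<Lambda>: "\<And>\<alpha>. dist (exp_sum_tuples f N \<Lambda> \<alpha>) (of_real (real N ^ k
          * h \<alpha>)) < \<epsilon>" "finite \<Lambda>" "0 \<notin> \<Lambda>"
        using eventually_happens[OF eventually_conj[OF ev ev2]] by auto
      define G where "G = (\<lambda>\<alpha>. (norm (exp_sum_tuples f N \<Lambda> \<alpha>))\<^sup>2)"
      have iG: "G integrable_on {A..A + 1}"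
        unfolding G_def by (intro integrable_continuous_interval continuous_intros
            exp_sum_tuples_continuous)
      have le: "real N ^ (2 * k) * (h \<alpha>)\<^sup>2 \<le> 2 * G \<alpha> + 2 * \<epsilon>\<^sup>2" for \<alpha>
      proof -
        define g where "g = norm (exp_sum_tuples f N \<Lambda> \<alpha>)"
        have "\<bar>real N ^ k * h \<alpha>\<bar> = norm (complex_of_real (real N ^ k * h \<alpha>))"
            by (simp only: norm_of_real)
        also have "\<dots> \<le> g + dist (exp_sum_tuples f N \<Lambda> \<alpha>) (of_real (real N ^ k * h \<alpha>))"
          unfolding g_def dist_norm 
          by (subst norm_minus_commute) (rule norm_triangle_sub)
        finally have "\<bar>real N ^ k * h \<alpha>\<bar> \<le> g + \<epsilon>" using \<Lambda>(1)[of \<alpha>] by linarith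
        then have "\<bar>real N ^ k * h \<alpha>\<bar>\<^sup>2 \<le> (g + \<epsilon>)\<^sup>2" by (intro power_mono) auto
        also have "(g + \<epsilon>)\<^sup>2 \<le> 2 * g\<^sup>2 + 2 * \<epsilon>\<^sup>2" using zero_le_power2[of "g - \<epsilon>"]
            by (simp add: power2_eq_square algebra_simps)
        finally show ?thesis by (simp add: G_def g_def power_mult_distrib power_mult[symmetric]
            mult.commute[of k])
      qed
      have "real N ^ (2 * k) * Var_corr k pos f N {A..A + 1}
          = integral {A..A + 1} (\<lambda>\<alpha>. real N ^ (2 * k) * (h \<alpha>)\<^sup>2)"
        unfolding V HK(2) by simp
      also have "\<dots> \<le> integral {A..A + 1} (\<lambda>\<alpha>. 2 * G \<alpha> + 2 * \<epsilon>\<^sup>2)"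
        using HK(1) iG le by (intro integral_le integrable_on_mult_right integrable_add
            integrable_const_ivl) auto
      also have "\<dots> = 2 * integral {A..A + 1} G + 2 * \<epsilon>\<^sup>2"
        using iG by (subst Henstock_Kurzweil_Integration.integral_add) (auto intro!:
            integrable_on_mult_right)
      also have "integral {A..A + 1} G \<le> C\<^sup>2 * B"
        unfolding G_def by (rule exp_sum_tuples_mean_square[OF N1 \<Lambda>(2,3) C bound])
      finally have "real N ^ (2 * k) * Var_corr k pos f N {A..A + 1}
          \<le> 2 * (C\<^sup>2 * B) + e * real N ^ (2 * k)"
        using \<epsilon>(2) by simp
      then have "Var_corr k pos f N {A..A + 1} \<le> (2 * (C\<^sup>2 * B) + e * real N ^ (2
          * k)) / real N ^ (2 * k)"
        using Np by (simp add: pos_le_divide_eq mult.commute)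
      also have "\<dots> = 2 * C\<^sup>2 * B / real N ^ (2 * k) + e" using Np
          by (simp add: add_divide_distrib mult.assoc)
      finally show ?thesis .
    qed
    then show ?thesis by (rule field_le_epsilon)
  qed
qed

end

theorem theorem1p4:
  fixes k :: nat and A :: real and pos :: "'n::finite \<Rightarrow> nat"
  assumes "k \<ge> 2"
    and "bij_betw pos (UNIV :: 'n set) {1..k - 1}"
    and "A > 4 * real k ^ 2 - 4 * real k - 1"
  shows "\<exists>\<rho>>0. \<forall>f \<in> (Cc_infinity :: (real ^ 'n \<Rightarrow> real) set).
           (\<lambda>N. Var_corr k pos f N {A..A + 1}) \<in> O(\<lambda>N. real N powr (- \<rho>))"
proof -
  have half: "card {ib \<in> index_pairs k. snd ib = b} = k" for b
    unfolding index_pairs_half[OF assms(1,2)] by (subst card_image) (auto simp: inj_on_def)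
  have fin: "finite (index_pairs k)" by (simp add: index_pairs_def[OF assms(1,2)])
  \<comment> \<open>\<open>\<rho>\<close> is fixed before \<open>f\<close>: the phase sum does not
    involve \<open>f\<close>, which enters only through \<open>C\<close> and
    \<open>N0\<close>.\<close>
  obtain \<rho> C' where \<rho>: "\<rho> > 0" and C': "C' \<ge> 0" and bound: "\<And>N T. N \<ge> 1 \<Longrightarrow> finite T \<Longrightarrow>
     (\<Sum>(w, p)\<in>tuple_pairs (index_pairs k) snd T N. (\<Prod>i\<in>index_pairs k. int_weight (real N) (w i))
         * phase_integral A (index_pairs k) w p)
       \<le> C' * real N powr (2 * real k - \<rho>)"
    using weighted_phase_sum_bound[OF fin half assms(1,3)] by blast
  show ?thesis
  proof (intro exI[of _ \<rho>] conjI ballI)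
    show "\<rho> > 0" by fact
    fix f :: "real ^ 'n \<Rightarrow> real" assume f: "f \<in> Cc_infinity"
    obtain C where C: "C \<ge> 0" "\<And>\<xi>. norm (fourier f \<xi>) \<le> C * (\<Prod>i\<in>UNIV. 1 / (1 + \<bar>\<xi> $ i\<bar>) ^ 4)"
      using fourier_decay[OF f] by blast
    obtain R where R: "R > 0" "\<And>x. f x \<noteq> 0 \<Longrightarrow> norm x < R" using Cc_infinity_bounded_support[OF f] by blast
    \<comment> \<open>Ensures \<open>k \<le> N\<close>, as the count of distinct tuples requires,
      and that the support of \<open>f\<close>, inside the ball of radius R, fits strictly inside
      the cube of side N.\<close>
    define N0 where "N0 = max k (nat \<lceil>2 * R\<rceil>)"
    have "norm (Var_corr k pos f N {A..A + 1}) \<le> (2 * C\<^sup>2 * C') * norm (real N powr (- \<rho>))"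
        if N: "N \<ge> N0" for N
    proof -
      have Nk: "k \<le> N" "2 * R \<le> real N" "N \<ge> 1" using N assms(1) unfolding N0_def by linarith+
      have supp: "\<bar>x $ i\<bar> < real N / 2" if "f x \<noteq> 0" for x i
        using R(2)[OF that] component_le_norm_cart[of x i] Nk(2) by linarith
      note V = Var_corr_le[OF assms(1,2) f Nk(1) supp C bound[OF Nk(3)]]
      have "norm (Var_corr k pos f N {A..A + 1}) = Var_corr k pos f N {A..A + 1}" using V(1) by simp
      also have "\<dots> \<le> 2 * C\<^sup>2 * (C' * real N powr (2 * real k - \<rho>)) / real N ^ (2 * k)" by (rule V(2))
      also have "\<dots> = 2 * C\<^sup>2 * C' * (real N powr (2 * real k - \<rho>) / real N powr (2 * real k))"
        using Nk(3) by (simp add: powr_realpow[symmetric])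
      also have "real N powr (2 * real k - \<rho>) / real N powr (2 * real k) = real N powr (- \<rho>)"
        by (simp flip: powr_diff)
      finally show ?thesis by simp
    qed
    then show "(\<lambda>N. Var_corr k pos f N {A..A + 1}) \<in> O(\<lambda>N. real N powr (- \<rho>))"
      by (intro bigoI[where c = "2 * C\<^sup>2 * C'"] eventually_sequentiallyI[of N0]) auto
  qed
qed

end
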